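(* Let $F\overset{i}{\hookrightarrow}E\xrightarrow{p}B$ be a fibration with a homotopy section $s$, where $F=\bigvee_{r=1}^m S^{k_r}$ and $B=\bigvee_{j=1}^n S^{l_j}$ with $k_r,l_j\ge2$. Let $\alpha_j:S^{l_j}\hookrightarrow B$ and $\beta_r:S^{k_r}\hookrightarrow F$ be the inclusion maps. Then the map $\varphi_s=(\Omega s\cdot\Omega i):\Omega B\times\Omega F\to\Omega E$ is an $H$-splitting if and only if the James brace product $\{\alpha_j,\beta_r\}_s=0$ for all $1\le r\le m$, $1\le j\le n$.
   Context: All spaces are CW complexes with base point; maps and homotopies preserve base points. A homotopy section of $p$ is a map $s:B\to E$ with $p\circ s\simeq\mathrm{Id}_B$. The map $\varphi_s$ is $\varphi_s(b,f)=\Omega s(b)\cdot\Omega i(f)$ with $\cdot$ loop concatenation; it is always a homotopy equivalence, and is called an $H$-splitting if it is an $H$-map (for loop concatenation on $\Omega E$ and on $\Omega B\times\Omega F$). James brace product: $i_*:\pi_r(F)\to\pi_r(E)$ is injective with image $\ker p_*$, and for $\alpha\in\pi_k(B)$, $\beta\in\pi_l(F)$, $\{\alpha,\beta\}_s\in\pi_{k+l-1}(F)$ is the unique element with $i_*\{\alpha,\beta\}_s=[s_*\alpha,i_*\beta]$ (Whitehead product in $\pi_*(E)$). *)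

theory Defs
  imports "HOL-Analysis.Analysis"
begin

section \<open>Pointed spaces, pointed maps and pointed homotopies\<close>

type_synonym 'a pointed = "'a topology \<times> 'a"

definition pmap :: "'a pointed \<Rightarrow> 'b pointed \<Rightarrow> ('a \<Rightarrow> 'b) \<Rightarrow> bool" where
  "pmap X Y f \<longleftrightarrow> continuous_map (fst X) (fst Y) f \<and> f (snd X) = snd Y"

definition phomotopic :: "'a pointed \<Rightarrow> 'b pointed \<Rightarrow> ('a \<Rightarrow> 'b) \<Rightarrow> ('a \<Rightarrow> 'b) \<Rightarrow> bool" where
  "phomotopic X Y = homotopic_with (\<lambda>h. h (snd X) = snd Y) (fst X) (fst Y)"

definition pprod :: "'a pointed \<Rightarrow> 'b pointed \<Rightarrow> ('a \<times> 'b) pointed" where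
  "pprod X Y = (prod_topology (fst X) (fst Y), (snd X, snd Y))"


section \<open>Spheres, discs and wedges\<close>

definition psphere :: "nat \<Rightarrow> (nat \<Rightarrow> real) pointed" where
  "psphere n = (nsphere n, \<lambda>i. if i = 0 then 1 else 0)"

definition enorm :: "nat \<Rightarrow> (nat \<Rightarrow> real) \<Rightarrow> real" where
  "enorm n x = sqrt (\<Sum>i<n. (x i)\<^sup>2)"

definition disc :: "nat \<Rightarrow> (nat \<Rightarrow> real) topology" where
  "disc n = subtopology (Euclidean_space n) {x. enorm n x \<le> 1}"

text \<open>
  The wedge of a family of pointed spaces: \<^term>\<open>None\<close> is the common base point and
  \<^term>\<open>Some (i, x)\<close> is the point \<open>x\<close> (not the base point) of the \<open>i\<close>-th summand.  The topology is
  the final one for the inclusions of the summands, i.e. the quotient topology of the disjoint union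
  (lemma \<open>quotient_map_wedge\<close> below).  The empty wedge is a point.
\<close>

definition wedge_incl :: "('i \<Rightarrow> 'a pointed) \<Rightarrow> 'i \<Rightarrow> 'a \<Rightarrow> ('i \<times> 'a) option" where
  "wedge_incl P i x = (if x = snd (P i) then None else Some (i, x))"

definition wedge_carrier :: "('i \<Rightarrow> 'a pointed) \<Rightarrow> 'i set \<Rightarrow> ('i \<times> 'a) option set" where
  "wedge_carrier P I = insert None (\<Union>i\<in>I. wedge_incl P i ` topspace (fst (P i)))"

definition wedge :: "('i \<Rightarrow> 'a pointed) \<Rightarrow> 'i set \<Rightarrow> ('i \<times> 'a) option pointed" where
  "wedge P I =
     (topology (\<lambda>U. U \<subseteq> wedge_carrier P I \<and>
        (\<forall>i\<in>I. openin (fst (P i)) {x \<in> topspace (fst (P i)). wedge_incl P i x \<in> U})), None)"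

lemma openin_wedge:
  "openin (fst (wedge P I)) U \<longleftrightarrow> U \<subseteq> wedge_carrier P I \<and>
     (\<forall>i\<in>I. openin (fst (P i)) {x \<in> topspace (fst (P i)). wedge_incl P i x \<in> U})"
proof -
  have 1: "{x \<in> topspace (fst (P i)). wedge_incl P i x \<in> S \<inter> T} =
      {x \<in> topspace (fst (P i)). wedge_incl P i x \<in> S} \<inter> {x \<in> topspace (fst (P i)). wedge_incl P i x \<in> T}"
    for i S T by auto
  have 2: "{x \<in> topspace (fst (P i)). wedge_incl P i x \<in> \<Union>\<K>} =
      (\<Union>K\<in>\<K>. {x \<in> topspace (fst (P i)). wedge_incl P i x \<in> K})"
    for i \<K> by auto
  have "istopology (\<lambda>U. U \<subseteq> wedge_carrier P I \<and>
     (\<forall>i\<in>I. openin (fst (P i)) {x \<in> topspace (fst (P i)). wedge_incl P i x \<in> U}))"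
    unfolding istopology_def 1 2 by blast
  then show ?thesis
    by (simp add: wedge_def)
qed

lemma topspace_wedge: "topspace (fst (wedge P I)) = wedge_carrier P I"
proof
  show "topspace (fst (wedge P I)) \<subseteq> wedge_carrier P I"
    using openin_topspace[of "fst (wedge P I)"] unfolding openin_wedge[of P I] by (rule conjunct1)
  have "{x \<in> topspace (fst (P i)). wedge_incl P i x \<in> wedge_carrier P I} = topspace (fst (P i))"
    if "i \<in> I" for i using that by (auto simp: wedge_carrier_def)
  then have "openin (fst (wedge P I)) (wedge_carrier P I)"
    by (simp add: openin_wedge)
  then show "wedge_carrier P I \<subseteq> topspace (fst (wedge P I))"
    by (rule openin_subset)
qed

lemma quotient_map_wedge:
  assumes "I \<noteq> {}" and "\<And>i. i \<in> I \<Longrightarrow> snd (P i) \<in> topspace (fst (P i))"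
  shows "quotient_map (sum_topology (\<lambda>i. fst (P i)) I) (fst (wedge P I)) (\<lambda>(i, x). wedge_incl P i x)"
proof -
  obtain j where j: "j \<in> I" using assms(1) by blast
  have "None \<in> wedge_incl P j ` topspace (fst (P j))"
    using assms(2)[OF j] by (auto simp: wedge_incl_def image_iff)
  then have "(\<lambda>(i, x). wedge_incl P i x) ` (SIGMA i:I. topspace (fst (P i))) = wedge_carrier P I"
    using j by (force simp: wedge_carrier_def)
  then show ?thesis
    unfolding quotient_map_def openin_sum_topology openin_wedge topspace_wedge topspace_sum_topology
    by (auto simp: comp_def conj_commute cong: conj_cong)
qed


section \<open>CW complexes\<close>

definition CW_complex :: "'a topology \<Rightarrow> bool" where
  "CW_complex X \<longleftrightarrow> Hausdorff_space X \<and>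
     (\<exists>(C :: 'a set set) (d :: 'a set \<Rightarrow> nat) (\<Phi> :: 'a set \<Rightarrow> (nat \<Rightarrow> real) \<Rightarrow> 'a).
        disjoint C \<and> \<Union>C = topspace X \<and>
        (\<forall>e\<in>C. continuous_map (disc (d e)) X (\<Phi> e) \<and>
               homeomorphic_map (subtopology (disc (d e)) {x. enorm (d e) x < 1})
                                (subtopology X e) (\<Phi> e) \<and>
               (\<exists>D \<subseteq> C. finite D \<and> (\<forall>c\<in>D. d c < d e) \<and>
                  \<Phi> e ` {x \<in> topspace (disc (d e)). enorm (d e) x = 1} \<subseteq> \<Union>D)) \<and>
        (\<forall>A \<subseteq> topspace X.
           (\<forall>e\<in>C. closedin (disc (d e)) {x \<in> topspace (disc (d e)). \<Phi> e x \<in> A})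
             \<longrightarrow> closedin X A))"


section \<open>Mapping spaces and loop spaces\<close>

text \<open>Maps are represented by functions that are \<^term>\<open>undefined\<close> outside the domain space.\<close>

definition mapping_set :: "'a topology \<Rightarrow> 'b topology \<Rightarrow> ('a \<Rightarrow> 'b) set" where
  "mapping_set X Y = {f \<in> extensional (topspace X). continuous_map X Y f}"

definition compact_open_topology :: "'a topology \<Rightarrow> 'b topology \<Rightarrow> ('a \<Rightarrow> 'b) topology" where
  "compact_open_topology X Y =
     topology_generated_by {{f \<in> mapping_set X Y. f ` K \<subseteq> U} | K U. compactin X K \<and> openin Y U}"

lemma topspace_compact_open: "topspace (compact_open_topology X Y) = mapping_set X Y"
proof -
  have "mapping_set X Y \<in> {{f \<in> mapping_set X Y. f ` K \<subseteq> U} | K U. compactin X K \<and> openin Y U}"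
    by (rule CollectI, rule exI[of _ "{}"], rule exI[of _ "{}"]) auto
  then show ?thesis
    by (auto simp: compact_open_topology_def)
qed

abbreviation unit_interval :: "real topology" where
  "unit_interval \<equiv> top_of_set {0..1}"

definition loop_space :: "'a pointed \<Rightarrow> (real \<Rightarrow> 'a) pointed" where
  "loop_space X =
     (subtopology (compact_open_topology unit_interval (fst X)) {\<gamma>. \<gamma> 0 = snd X \<and> \<gamma> 1 = snd X},
      restrict (\<lambda>_. snd X) {0..1})"

definition loop_concat :: "(real \<Rightarrow> 'a) \<Rightarrow> (real \<Rightarrow> 'a) \<Rightarrow> real \<Rightarrow> 'a" where
  "loop_concat \<gamma> \<delta> = restrict (\<lambda>t. if t \<le> 1/2 then \<gamma> (2 * t) else \<delta> (2 * t - 1)) {0..1}"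

definition loop_map :: "('a \<Rightarrow> 'b) \<Rightarrow> (real \<Rightarrow> 'a) \<Rightarrow> real \<Rightarrow> 'b" where
  "loop_map f \<gamma> = restrict (f \<circ> \<gamma>) {0..1}"


section \<open>Fibrations and homotopy sections\<close>

definition homotopy_lifting ::
    "'x topology \<Rightarrow> 'e topology \<Rightarrow> 'b topology \<Rightarrow> ('e \<Rightarrow> 'b) \<Rightarrow> bool" where
  "homotopy_lifting X E B p \<longleftrightarrow>
     (\<forall>f h. continuous_map X E f \<and> continuous_map (prod_topology unit_interval X) B h \<and>
            (\<forall>x\<in>topspace X. h (0, x) = p (f x)) \<longrightarrow>
        (\<exists>k. continuous_map (prod_topology unit_interval X) E k \<and>
             (\<forall>x\<in>topspace X. k (0, x) = f x) \<and>
             (\<forall>t\<in>{0..1}. \<forall>x\<in>topspace X. p (k (t, x)) = h (t, x))))"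

text \<open>
  A (Hurewicz) fibration has the homotopy lifting property for all spaces.  One cannot quantify over
  types inside a definition; it suffices to demand the property for all topologies on the type
  \<open>'e \<times> (real \<Rightarrow> 'b)\<close>, which carries the mapping path space of \<open>p\<close>, the universal test space.
  Lemma \<open>fibration_homotopy_lifting\<close> shows that the lifting property then holds for spaces of any type.
\<close>

definition fibration :: "'e topology \<Rightarrow> 'b topology \<Rightarrow> ('e \<Rightarrow> 'b) \<Rightarrow> bool" where
  "fibration E B p \<longleftrightarrow> continuous_map E B p \<and>
     (\<forall>X :: ('e \<times> (real \<Rightarrow> 'b)) topology. homotopy_lifting X E B p)"

lemma continuous_map_curry_unit_interval:
  assumes h: "continuous_map (prod_topology unit_interval X) B h"
  shows "continuous_map X (compact_open_topology unit_interval B)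
           (\<lambda>x. restrict (\<lambda>t. h (t, x)) {0..1})"
  unfolding compact_open_topology_def
proof (rule continuous_on_generated_topo)
  have m: "restrict (\<lambda>t. h (t, x)) {0..1} \<in> mapping_set unit_interval B"
    if x: "x \<in> topspace X" for x
  proof -
    have "continuous_map unit_interval (prod_topology unit_interval X) (\<lambda>t. (t, x))"
      using x by (intro continuous_map_pairedI) auto
    from continuous_map_compose[OF this h]
    have "continuous_map unit_interval B (\<lambda>t. h (t, x))" by (simp add: comp_def)
    then have "continuous_map unit_interval B (restrict (\<lambda>t. h (t, x)) {0..1})"
      by (rule continuous_map_eq) auto
    then show ?thesis by (simp add: mapping_set_def)
  qed
  show "(\<lambda>x. restrict (\<lambda>t. h (t, x)) {0..1}) ` topspace X \<subseteq>
    \<Union>{{f \<in> mapping_set unit_interval B. f ` K \<subseteq> U} | K U. compactin unit_interval K \<and> openin B U}"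
    unfolding topspace_compact_open[of unit_interval B, unfolded compact_open_topology_def
        topology_generated_by_topspace]
    by (rule image_subsetI) (rule m)
  fix S
  assume "S \<in> {{f \<in> mapping_set unit_interval B. f ` K \<subseteq> U} | K U.
                 compactin unit_interval K \<and> openin B U}"
  then obtain K U where S: "S = {f \<in> mapping_set unit_interval B. f ` K \<subseteq> U}"
    and K: "compactin unit_interval K" and U: "openin B U" by auto
  have K01: "K \<subseteq> {0..1}" using compactin_subset_topspace[OF K] by simp
  let ?V = "(\<lambda>x. restrict (\<lambda>t. h (t, x)) {0..1}) -` S \<inter> topspace X"
  let ?W = "{z \<in> topspace (prod_topology unit_interval X). h z \<in> U}"
  have W: "openin (prod_topology unit_interval X) ?W"
    using h U by (rule openin_continuous_map_preimage)
  show "openin X ?V"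
  proof (subst openin_subopen, intro ballI)
    fix x assume x: "x \<in> ?V"
    then have xX: "x \<in> topspace X" by simp
    have "h (t, x) \<in> U" if "t \<in> K" for t
    proof -
      have "restrict (\<lambda>t. h (t, x)) {0..1} t \<in> U"
        using x imageI[OF that, of "restrict (\<lambda>t. h (t, x)) {0..1}"]
        by (simp only: S vimage_eq Int_iff mem_Collect_eq) (elim conjE, erule (1) subsetD)
      then show ?thesis using that K01 by auto
    qed
    then have KW: "K \<times> {x} \<subseteq> ?W" using xX K01 by auto
    obtain A N where AN: "openin X N" "K \<subseteq> A" "x \<in> N" "A \<times> N \<subseteq> ?W"
      using tube_lemma_left[OF W K xX KW] by (elim exE conjE) (rule that)
    have "N \<subseteq> ?V"
    proof
      fix y assume y: "y \<in> N"
      then have yX: "y \<in> topspace X" using AN(1) openin_subset by blast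
      have "h (t, y) \<in> U" if "t \<in> K" for t
        using subsetD[OF AN(4), of "(t, y)"] subsetD[OF AN(2) that] y by simp
      then have "restrict (\<lambda>t. h (t, y)) {0..1} ` K \<subseteq> U"
        using K01 by (intro image_subsetI) (simp add: subset_iff)
      then have "restrict (\<lambda>t. h (t, y)) {0..1} \<in> S"
        unfolding S using m[OF yX] by (intro CollectI conjI)
      then show "y \<in> ?V" using yX by (intro IntI vimageI2)
    qed
    with AN(1,3) show "\<exists>T. openin X T \<and> x \<in> T \<and> T \<subseteq> ?V" by (intro exI[of _ N] conjI)
  qed
qed

lemma continuous_map_eval_unit_interval:
  "continuous_map (prod_topology unit_interval (compact_open_topology unit_interval B)) B
     (\<lambda>(t, \<gamma>). \<gamma> t)"
proof (subst continuous_map, intro conjI allI impI)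
  let ?M = "compact_open_topology unit_interval B"
  show "(\<lambda>(t, \<gamma>). \<gamma> t) ` topspace (prod_topology unit_interval ?M) \<subseteq> topspace B"
    by (auto simp: topspace_compact_open mapping_set_def continuous_map_def)
  fix U assume U: "openin B U"
  let ?W = "{z \<in> topspace (prod_topology unit_interval ?M). (case z of (t, \<gamma>) \<Rightarrow> \<gamma> t) \<in> U}"
  show "openin (prod_topology unit_interval ?M) ?W"
  proof (subst openin_prod_topology_alt, intro allI impI)
    fix t \<gamma> assume "(t, \<gamma>) \<in> ?W"
    then have t: "t \<in> {0..1}" and g: "\<gamma> \<in> mapping_set unit_interval B" and gt: "\<gamma> t \<in> U"
      by (auto simp: topspace_compact_open)
    have "openin unit_interval {s \<in> {0..1}. \<gamma> s \<in> U}"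
      using openin_continuous_map_preimage[of unit_interval B \<gamma> U] g U by (simp add: mapping_set_def)
    then obtain e where e: "e > 0" "\<And>s. s \<in> {0..1} \<Longrightarrow> dist s t < e \<Longrightarrow> \<gamma> s \<in> U"
      using t gt by (force simp: openin_euclidean_subtopology_iff)
    let ?A = "{0..1} \<inter> ball t (e/2)" and ?K = "{0..1} \<inter> cball t (e/2)"
    have K: "compactin unit_interval ?K"
      by (auto simp: compactin_subtopology)
    have "?A \<subseteq> ?K" using ball_subset_cball by blast
    let ?N = "{f \<in> mapping_set unit_interval B. f ` ?K \<subseteq> U}"
    have "openin ?M ?N"
      unfolding compact_open_topology_def
      by (rule topology_generated_by_Basis) (use K U in blast)
    moreover have "openin unit_interval ?A" by (auto simp: openin_open)
    moreover have "t \<in> ?A" using t e by simp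
    moreover have "\<gamma> \<in> ?N" using g e by (auto simp: dist_commute)
    moreover have "?A \<times> ?N \<subseteq> ?W"
      using \<open>?A \<subseteq> ?K\<close> by (auto simp: topspace_compact_open image_subset_iff)
    ultimately show "\<exists>A N. openin unit_interval A \<and> openin ?M N \<and> t \<in> A \<and> \<gamma> \<in> N \<and> A \<times> N \<subseteq> ?W"
      by blast
  qed
qed

lemma fibration_homotopy_lifting:
  fixes X :: "'x topology" and E :: "'e topology" and B :: "'b topology"
  assumes p: "fibration E B p"
  shows "homotopy_lifting X E B p"
  unfolding homotopy_lifting_def
proof (intro allI impI, elim conjE)
  fix f h
  assume f: "continuous_map X E f" and h: "continuous_map (prod_topology unit_interval X) B h"
    and hf: "\<forall>x\<in>topspace X. h (0, x) = p (f x)"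
  let ?M = "compact_open_topology unit_interval B"
  define N where "N = subtopology (prod_topology E ?M) {(e, \<gamma>). \<gamma> 0 = p e}"
  have 1: "continuous_map N E fst"
    unfolding N_def by (intro continuous_map_from_subtopology continuous_map_fst)
  have "continuous_map (prod_topology unit_interval N) (prod_topology unit_interval ?M)
          (\<lambda>(t, z). (t, snd z))"
    unfolding N_def
    unfolding case_prod_unfold
    by (intro continuous_map_pairedI continuous_map_fst
        continuous_map_compose[OF continuous_map_snd, unfolded comp_def]
        continuous_map_from_subtopology continuous_map_snd)
  from continuous_map_compose[OF this continuous_map_eval_unit_interval]
  have 2: "continuous_map (prod_topology unit_interval N) B (\<lambda>(t, z). snd z t)"
    by (simp add: comp_def case_prod_unfold)
  have 3: "\<forall>z\<in>topspace N. (case (0, z) of (t, z) \<Rightarrow> snd z t) = p (fst z)"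
    by (auto simp: N_def)
  from p have "homotopy_lifting N E B p" by (simp add: fibration_def)
  with 1 2 3 obtain k where k: "continuous_map (prod_topology unit_interval N) E k"
    "\<forall>z\<in>topspace N. k (0, z) = fst z"
    "\<forall>t\<in>{0..1}. \<forall>z\<in>topspace N. p (k (t, z)) = (case (t, z) of (t, z) \<Rightarrow> snd z t)"
    unfolding homotopy_lifting_def by blast
  define u where "u = (\<lambda>x. (f x, restrict (\<lambda>t. h (t, x)) {0..1}))"
  have u: "continuous_map X N u"
    unfolding N_def u_def
    by (auto simp: continuous_map_in_subtopology continuous_map_pairwise comp_def f hf
        continuous_map_curry_unit_interval[OF h])
  have "continuous_map (prod_topology unit_interval X) (prod_topology unit_interval N)
          (\<lambda>(t, x). (t, u x))"
    unfolding case_prod_unfold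
    by (intro continuous_map_pairedI continuous_map_fst
        continuous_map_compose[OF continuous_map_snd u, unfolded comp_def])
  from continuous_map_compose[OF this k(1)]
  have "continuous_map (prod_topology unit_interval X) E (\<lambda>(t, x). k (t, u x))"
    by (simp add: comp_def case_prod_unfold)
  moreover have "u x \<in> topspace N" if "x \<in> topspace X" for x
    using u that by (auto simp: continuous_map_def)
  ultimately show "\<exists>k. continuous_map (prod_topology unit_interval X) E k \<and>
             (\<forall>x\<in>topspace X. k (0, x) = f x) \<and>
             (\<forall>t\<in>{0..1}. \<forall>x\<in>topspace X. p (k (t, x)) = h (t, x))"
    using k by (intro exI[of _ "\<lambda>(t, x). k (t, u x)"]) (auto simp: u_def)
qed

text \<open>\<open>F \<rightarrow> E \<rightarrow> B\<close> with \<open>i\<close> identifying \<open>F\<close> with the fibre of \<open>p\<close> over the base point.\<close>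

definition fibration_sequence ::
    "'f pointed \<Rightarrow> 'e pointed \<Rightarrow> 'b pointed \<Rightarrow> ('f \<Rightarrow> 'e) \<Rightarrow> ('e \<Rightarrow> 'b) \<Rightarrow> bool" where
  "fibration_sequence F E B i p \<longleftrightarrow>
     pmap F E i \<and> pmap E B p \<and> fibration (fst E) (fst B) p \<and>
     embedding_map (fst F) (fst E) i \<and>
     i ` topspace (fst F) = {e \<in> topspace (fst E). p e = snd B}"

definition homotopy_section :: "'e pointed \<Rightarrow> 'b pointed \<Rightarrow> ('e \<Rightarrow> 'b) \<Rightarrow> ('b \<Rightarrow> 'e) \<Rightarrow> bool" where
  "homotopy_section E B p s \<longleftrightarrow> pmap B E s \<and> phomotopic B B (p \<circ> s) id"


section \<open>H-maps and H-splittings\<close>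

definition H_map :: "'a pointed \<Rightarrow> ('a \<Rightarrow> 'a \<Rightarrow> 'a) \<Rightarrow> 'b pointed \<Rightarrow> ('b \<Rightarrow> 'b \<Rightarrow> 'b) \<Rightarrow> ('a \<Rightarrow> 'b) \<Rightarrow> bool"
  where
  "H_map X \<mu> Y \<nu> f \<longleftrightarrow>
     pmap X Y f \<and>
     phomotopic (pprod X X) Y (\<lambda>(x, x'). f (\<mu> x x')) (\<lambda>(x, x'). \<nu> (f x) (f x'))"

definition phi_map :: "('b \<Rightarrow> 'e) \<Rightarrow> ('f \<Rightarrow> 'e) \<Rightarrow> (real \<Rightarrow> 'b) \<times> (real \<Rightarrow> 'f) \<Rightarrow> real \<Rightarrow> 'e" where
  "phi_map s i = (\<lambda>(b, f). loop_concat (loop_map s b) (loop_map i f))"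

definition H_splitting :: "'f pointed \<Rightarrow> 'e pointed \<Rightarrow> 'b pointed \<Rightarrow> ('f \<Rightarrow> 'e) \<Rightarrow> ('b \<Rightarrow> 'e) \<Rightarrow> bool" where
  "H_splitting F E B i s \<longleftrightarrow>
     H_map (pprod (loop_space B) (loop_space F))
           (\<lambda>(b, f) (b', f'). (loop_concat b b', loop_concat f f'))
           (loop_space E) loop_concat (phi_map s i)"


section \<open>Homotopy groups, Whitehead product and James brace product\<close>

text \<open>Elements of \<open>\<pi>\<^sub>n(X)\<close> are pointed homotopy classes of pointed maps \<open>S\<^sup>n \<rightarrow> X\<close>.\<close>

definition pi_class :: "nat \<Rightarrow> 'a pointed \<Rightarrow> ((nat \<Rightarrow> real) \<Rightarrow> 'a) \<Rightarrow> ((nat \<Rightarrow> real) \<Rightarrow> 'a) set" where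
  "pi_class n X f = {g. phomotopic (psphere n) X f g}"

definition pi_set :: "nat \<Rightarrow> 'a pointed \<Rightarrow> ((nat \<Rightarrow> real) \<Rightarrow> 'a) set set" where
  "pi_set n X = pi_class n X ` {f. pmap (psphere n) X f}"

definition pi_zero :: "nat \<Rightarrow> 'a pointed \<Rightarrow> ((nat \<Rightarrow> real) \<Rightarrow> 'a) set" where
  "pi_zero n X = pi_class n X (\<lambda>_. snd X)"

definition pi_induced ::
    "nat \<Rightarrow> 'b pointed \<Rightarrow> ('a \<Rightarrow> 'b) \<Rightarrow> ((nat \<Rightarrow> real) \<Rightarrow> 'a) set \<Rightarrow> ((nat \<Rightarrow> real) \<Rightarrow> 'b) set" where
  "pi_induced n Y u \<alpha> = (\<Union>f\<in>\<alpha>. pi_class n Y (u \<circ> f))"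

text \<open>
  \<open>disc_collapse n\<close> is the relative homeomorphism \<open>(D\<^sup>n, \<partial>D\<^sup>n) \<rightarrow> (S\<^sup>n, *)\<close>,
  \<open>x \<mapsto> (2|x|\<^sup>2 - 1, 2 sqrt(1 - |x|\<^sup>2) x)\<close>.
\<close>

definition disc_collapse :: "nat \<Rightarrow> (nat \<Rightarrow> real) \<Rightarrow> nat \<Rightarrow> real" where
  "disc_collapse n x = (\<lambda>j. if j = 0 then 2 * (enorm n x)\<^sup>2 - 1
                            else if j \<le> n then 2 * sqrt (1 - (enorm n x)\<^sup>2) * x (j - 1)
                            else 0)"

text \<open>
  The Whitehead product of \<open>f : S\<^sup>k \<rightarrow> X\<close> and \<open>g : S\<^sup>l \<rightarrow> X\<close> is the composite
  \<open>S\<^sup>k\<^sup>+\<^sup>l\<^sup>-\<^sup>1 \<cong> \<partial>(D\<^sup>k \<times> D\<^sup>l) = D\<^sup>k \<times> \<partial>D\<^sup>l \<union> \<partial>D\<^sup>k \<times> D\<^sup>l \<rightarrow> S\<^sup>k \<or> S\<^sup>l \<rightarrow> X\<close>,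
  with the first map the radial projection \<open>(x, y) \<mapsto> (x, y) / max |x| |y|\<close> and the second one
  induced by the two collapse maps.  The base point \<open>e\<^sub>0\<close> of \<open>S\<^sup>k\<^sup>+\<^sup>l\<^sup>-\<^sup>1\<close> has to go to a point of
  \<open>\<partial>D\<^sup>k \<times> \<partial>D\<^sup>l\<close>, so we first apply the rotation by \<open>\<pi>/4\<close> in the coordinates \<open>0\<close> and \<open>k\<close>, which
  moves \<open>e\<^sub>0\<close> to \<open>(e\<^sub>0 + e\<^sub>k) / sqrt 2\<close>.
\<close>

definition corner_rotation :: "nat \<Rightarrow> (nat \<Rightarrow> real) \<Rightarrow> nat \<Rightarrow> real" where
  "corner_rotation k z =
     z(0 := (z 0 - z k) / sqrt 2, k := (z 0 + z k) / sqrt 2)"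

definition whitehead_map ::
    "nat \<Rightarrow> nat \<Rightarrow> ((nat \<Rightarrow> real) \<Rightarrow> 'a) \<Rightarrow> ((nat \<Rightarrow> real) \<Rightarrow> 'a) \<Rightarrow> (nat \<Rightarrow> real) \<Rightarrow> 'a" where
  "whitehead_map k l f g z =
     (let x = corner_rotation k z; y = (\<lambda>j. x (k + j)); a = enorm k x; b = enorm l y
      in if a \<le> b then f (disc_collapse k (\<lambda>j. x j / b))
         else g (disc_collapse l (\<lambda>j. y j / a)))"

lemma enorm_nonneg: "0 \<le> enorm n x"
  by (simp add: enorm_def sum_nonneg)

lemma enorm_sq: "(enorm n x)\<^sup>2 = (\<Sum>i<n. (x i)\<^sup>2)"
  by (simp add: enorm_def sum_nonneg)

lemma enorm_divide: "b > 0 \<Longrightarrow> enorm n (\<lambda>j. x j / b) = enorm n x / b"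
  by (simp add: enorm_def power_divide real_sqrt_divide flip: sum_divide_distrib)

lemma disc_collapse_boundary:
  assumes "enorm n x = 1"
  shows "disc_collapse n x = snd (psphere n)"
  using assms by (auto simp: disc_collapse_def psphere_def)

lemma disc_collapse_in_nsphere:
  assumes "enorm n x \<le> 1"
  shows "disc_collapse n x \<in> topspace (nsphere n)"
proof -
  let ?r = "(enorm n x)\<^sup>2"
  have r: "?r \<le> 1" using power_mono[OF assms enorm_nonneg, of 2] by simp
  have "(\<Sum>i\<le>n. (disc_collapse n x i)\<^sup>2) = (2 * ?r - 1)\<^sup>2 + (\<Sum>i<n. 4 * (1 - ?r) * (x i)\<^sup>2)"
    using r by (subst sum.atMost_shift) (simp add: disc_collapse_def power_mult_distrib)
  also have "\<dots> = (2 * ?r - 1)\<^sup>2 + 4 * (1 - ?r) * ?r"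
    by (simp only: enorm_sq sum_distrib_left)
  also have "\<dots> = 1"
    by (simp add: power2_eq_square algebra_simps)
  finally show ?thesis
    by (auto simp: nsphere disc_collapse_def)
qed

lemma continuous_map_enorm:
  "(\<And>j. j < n \<Longrightarrow> continuous_map X euclideanreal (\<lambda>z. f z j)) \<Longrightarrow>
    continuous_map X euclideanreal (\<lambda>z. enorm n (f z))"
  unfolding enorm_def by (intro continuous_map_sqrt continuous_map_sum continuous_map_real_pow) auto

lemma continuous_map_disc_collapse:
  assumes "\<And>j. j < n \<Longrightarrow> continuous_map X euclideanreal (\<lambda>z. f z j)"
    and "\<And>z. z \<in> topspace X \<Longrightarrow> enorm n (f z) \<le> 1"
  shows "continuous_map X (nsphere n) (\<lambda>z. disc_collapse n (f z))"
proof -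
  have "continuous_map X euclideanreal (\<lambda>z. disc_collapse n (f z) j)" for j
    unfolding disc_collapse_def using assms(1)
    by (cases "j = 0"; cases "j \<le> n")
       (auto intro!: continuous_intros continuous_map_sqrt continuous_map_enorm)
  moreover have "disc_collapse n (f z) \<in> topspace (nsphere n)" if "z \<in> topspace X" for z
    using disc_collapse_in_nsphere assms(2) that by blast
  ultimately show ?thesis
    by (auto simp: nsphere continuous_map_in_subtopology continuous_map_componentwise_UNIV)
qed

lemma enorm_corner_rotation:
  assumes z: "z \<in> topspace (nsphere (k + l - 1))" and k: "k \<ge> 1" "l \<ge> 1"
  shows "(enorm k (corner_rotation k z))\<^sup>2 + (enorm l (\<lambda>j. corner_rotation k z (k + j)))\<^sup>2 = 1"
proof -
  let ?x = "corner_rotation k z"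
  have split: "(\<Sum>i<k. g i) + (\<Sum>j<l. g (k + j)) = (\<Sum>i<k + l. g i)" for g :: "nat \<Rightarrow> real"
    by (induction l) (simp_all add: add.assoc)
  have S: "(\<Sum>i<k + l. g i) = g 0 + g k + (\<Sum>i\<in>{..<k + l} - {0, k}. g i)" for g :: "nat \<Rightarrow> real"
    using k by (subst sum.subset_diff[of "{0, k}"]) auto
  have "(\<Sum>i<k + l. (?x i)\<^sup>2) = (\<Sum>i<k + l. (z i)\<^sup>2)"
    unfolding S[of "\<lambda>i. (?x i)\<^sup>2"] S[of "\<lambda>i. (z i)\<^sup>2"] using k
    by (simp add: corner_rotation_def power_divide) (simp add: power2_eq_square field_simps)
  also have "\<dots> = 1"
    using z k by (simp add: nsphere lessThan_Suc_atMost[symmetric])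
  finally show ?thesis
    unfolding enorm_sq using split[of "\<lambda>i. (?x i)\<^sup>2"] by simp
qed

lemma pmap_whitehead_map:
  assumes k: "k \<ge> 1" "l \<ge> 1" and f: "pmap (psphere k) X f" and g: "pmap (psphere l) X g"
  shows "pmap (psphere (k + l - 1)) X (whitehead_map k l f g)"
proof -
  let ?S = "nsphere (k + l - 1)"
  let ?x = "\<lambda>z. corner_rotation k z" and ?y = "\<lambda>z j. corner_rotation k z (k + j)"
  let ?a = "\<lambda>z. enorm k (?x z)" and ?b = "\<lambda>z. enorm l (?y z)"
  have x: "continuous_map ?S euclideanreal (\<lambda>z. ?x z j)" for j
  proof -
    have p: "continuous_map (nsphere N) euclideanreal (\<lambda>z. z i)" for N i
      by (rule continuous_map_nsphere_projection)
    show ?thesis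
      unfolding corner_rotation_def
      by (cases "j = k"; cases "j = 0") (auto intro!: continuous_intros p)
  qed
  have ab: "(?a z)\<^sup>2 + (?b z)\<^sup>2 = 1" if "z \<in> topspace ?S" for z
    using enorm_corner_rotation that k by blast
  have pos: "?a z \<le> ?b z \<Longrightarrow> ?b z > 0" "?b z \<le> ?a z \<Longrightarrow> ?a z > 0" if "z \<in> topspace ?S" for z
    using ab[OF that] enorm_nonneg[of k "?x z"] enorm_nonneg[of l "?y z"]
    by (auto simp: order_less_le)
  have a: "continuous_map ?S euclideanreal ?a" and b: "continuous_map ?S euclideanreal ?b"
    by (intro continuous_map_enorm x)+
  have "continuous_map ?S (fst X)
    (\<lambda>z. if ?a z \<le> ?b z then f (disc_collapse k (\<lambda>j. ?x z j / ?b z))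
          else g (disc_collapse l (\<lambda>j. ?y z j / ?a z)))"
  proof (rule continuous_map_cases_le[OF a b])
    have "continuous_map (subtopology ?S {z \<in> topspace ?S. ?a z \<le> ?b z}) (nsphere k)
            (\<lambda>z. disc_collapse k (\<lambda>j. ?x z j / ?b z))"
    proof (rule continuous_map_disc_collapse)
      show "continuous_map (subtopology ?S {z \<in> topspace ?S. ?a z \<le> ?b z}) euclideanreal
              (\<lambda>z. ?x z j / ?b z)" for j
        by (intro continuous_map_real_divide continuous_map_from_subtopology x b) (use pos in fastforce)
    qed (use pos in \<open>auto simp: enorm_divide\<close>)
    then show "continuous_map (subtopology ?S {z \<in> topspace ?S. ?a z \<le> ?b z}) (fst X)
            (\<lambda>z. f (disc_collapse k (\<lambda>j. ?x z j / ?b z)))"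
      using f continuous_map_compose[of _ "nsphere k" _ "fst X" f]
      by (auto simp: pmap_def psphere_def comp_def)
    have "continuous_map (subtopology ?S {z \<in> topspace ?S. ?b z \<le> ?a z}) (nsphere l)
            (\<lambda>z. disc_collapse l (\<lambda>j. ?y z j / ?a z))"
    proof (rule continuous_map_disc_collapse)
      show "continuous_map (subtopology ?S {z \<in> topspace ?S. ?b z \<le> ?a z}) euclideanreal
              (\<lambda>z. ?y z j / ?a z)" for j
        by (intro continuous_map_real_divide continuous_map_from_subtopology x a) (use pos in fastforce)
    qed (use pos in \<open>auto simp: enorm_divide\<close>)
    then show "continuous_map (subtopology ?S {z \<in> topspace ?S. ?b z \<le> ?a z}) (fst X)
            (\<lambda>z. g (disc_collapse l (\<lambda>j. ?y z j / ?a z)))"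
      using g continuous_map_compose[of _ "nsphere l" _ "fst X" g]
      by (auto simp: pmap_def psphere_def comp_def)
    show "f (disc_collapse k (\<lambda>j. ?x z j / ?b z)) = g (disc_collapse l (\<lambda>j. ?y z j / ?a z))"
      if "z \<in> topspace ?S" "?a z = ?b z" for z
      using f g pos[OF that(1)] that(2)
      by (auto simp: disc_collapse_boundary enorm_divide pmap_def)
  qed
  moreover have "whitehead_map k l f g (snd (psphere (k + l - 1))) = snd X"
  proof -
    let ?e = "snd (psphere (k + l - 1))"
    have 1: "corner_rotation k ?e = (\<lambda>j. if j = 0 \<or> j = k then 1 / sqrt 2 else 0)"
      using k by (auto simp: corner_rotation_def psphere_def)
    have 2: "?a ?e = 1 / sqrt 2" "?b ?e = 1 / sqrt 2"
      unfolding 1 enorm_def using k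
      by (auto simp: power_divide if_distrib[of "\<lambda>x. x\<^sup>2"] real_sqrt_divide cong: if_cong)
    then have "disc_collapse k (\<lambda>j. ?x ?e j / ?b ?e) = snd (psphere k)"
      by (intro disc_collapse_boundary) (subst enorm_divide; simp)
    with 2 f show ?thesis by (simp add: whitehead_map_def Let_def pmap_def)
  qed
  ultimately show ?thesis
    by (simp add: pmap_def psphere_def whitehead_map_def[abs_def] Let_def split: if_splits)
qed

definition whitehead_product ::
    "nat \<Rightarrow> nat \<Rightarrow> 'a pointed \<Rightarrow> ((nat \<Rightarrow> real) \<Rightarrow> 'a) set \<Rightarrow> ((nat \<Rightarrow> real) \<Rightarrow> 'a) set
      \<Rightarrow> ((nat \<Rightarrow> real) \<Rightarrow> 'a) set" where
  "whitehead_product k l X \<alpha> \<beta> =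
     (\<Union>f\<in>\<alpha>. \<Union>g\<in>\<beta>. pi_class (k + l - 1) X (whitehead_map k l f g))"

definition james_brace ::
    "nat \<Rightarrow> nat \<Rightarrow> 'f pointed \<Rightarrow> 'e pointed \<Rightarrow> ('f \<Rightarrow> 'e) \<Rightarrow> ('b \<Rightarrow> 'e)
      \<Rightarrow> ((nat \<Rightarrow> real) \<Rightarrow> 'b) set \<Rightarrow> ((nat \<Rightarrow> real) \<Rightarrow> 'f) set \<Rightarrow> ((nat \<Rightarrow> real) \<Rightarrow> 'f) set" where
  "james_brace k l F E i s \<alpha> \<beta> =
     (THE \<gamma>. \<gamma> \<in> pi_set (k + l - 1) F \<and>
        pi_induced (k + l - 1) E i \<gamma> =
          whitehead_product k l E (pi_induced k E s \<alpha>) (pi_induced l E i \<beta>))"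

end

theory Submission
  imports Defs
begin

text \<open>
  Write \<open>a\<^sub>j\<close> and \<open>b\<^sub>r\<close> for the maps \<open>s \<circ> \<alpha> j\<close> and \<open>i \<circ> \<beta> r\<close> of spheres into \<open>E\<close>.  Both sides of the
  equivalence say that the Whitehead products \<open>[a\<^sub>j, b\<^sub>r]\<close> vanish in the homotopy groups of \<open>E\<close>.

  \<^item> Brace products.  The map \<open>i\<^sub>*\<close> is injective because the base has a homotopy section, and its
  image contains \<open>[a\<^sub>j, b\<^sub>r]\<close> because \<open>p\<close> sends this product to the product with a constant map.
  So the brace product is the unique preimage of \<open>[a\<^sub>j, b\<^sub>r]\<close> and is zero exactly if that product is
  (\<open>fibre_inclusion_exact\<close>, \<open>fibre_inclusion_injective\<close>, \<open>james_brace_zero_iff\<close>).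

  \<^item> From products to loops.  A null homotopy of \<open>[a\<^sub>j, b\<^sub>r]\<close> extends the map \<open>(a\<^sub>j, b\<^sub>r)\<close> from the
  axes to the product of the two spheres.  The product of two nontrivial wedges is the finite union of
  these products of spheres, so there is \<open>H : B \<times> F \<rightarrow> E\<close> with axes \<open>s\<close> and \<open>i\<close>.  Then the two
  sides of the H-map condition are the images under \<open>H\<close> of one pair of loops \<open>(b b', f f')\<close>, run
  through with different speeds, and speeds can be interpolated linearly
  (\<open>axes_extend_if_whitehead_null\<close>, \<open>wedge_axes_extend\<close>, \<open>H_splitting_if_axes_extend\<close>).

  \<^item> From loops to products.  The H-map condition at \<open>(*, f)\<close> and \<open>(b, *)\<close> deforms \<open>s b \<cdot> i f\<close> into
  \<open>i f \<cdot> s b\<close>, naturally in both loops.  A sphere \<open>S\<^sup>k\<close> is a family of loops parametrised by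
  \<open>\<real>\<^sup>k\<^sup>-\<^sup>1\<close>, so for two spheres this is a family of squares parametrised by \<open>\<real>\<^sup>k\<^sup>-\<^sup>1 \<times> \<real>\<^sup>l\<^sup>-\<^sup>1\<close>.
  The square over a constant loop need not be degenerate, which is the only obstacle to reading the
  family as a map on \<open>S\<^sup>k \<times> S\<^sup>l\<close>.  It is removed by running through the square forwards with the
  given loop and backwards with the constant loop: where the given loop is constant, the path
  retraces itself and can be shortened to nothing
  (\<open>swap_square_boundary\<close>, \<open>whitehead_null_if_H_splitting\<close>).

  Maps of \<open>S\<^sup>n\<close> are mostly treated as maps of \<open>\<real>\<^sup>n\<close> that take the base point as value off a ball.
  This makes room for explicit formulas: the extra space outside the ball is where homotopies can
  be cut off.
\<close>

section \<open>Pointed homotopies\<close>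

lemma continuous_map_homotopy_at:
  assumes "continuous_map (prod_topology unit_interval W) X h"
    and "continuous_map Z euclideanreal \<tau>" "\<And>z. z \<in> topspace Z \<Longrightarrow> \<tau> z \<in> {0..1}"
    and "continuous_map Z W w"
  shows "continuous_map Z X (\<lambda>z. h (\<tau> z, w z))"
proof -
  have "continuous_map Z (prod_topology unit_interval W) (\<lambda>z. (\<tau> z, w z))"
    using assms by (intro continuous_map_pairedI) (auto simp: continuous_map_in_subtopology)
  from continuous_map_compose[OF this assms(1)] show ?thesis by (simp add: comp_def)
qed

lemma phomotopic_iff:
  assumes "snd X \<in> topspace (fst X)"
  shows "phomotopic X Y f g \<longleftrightarrow>
    (\<exists>h. continuous_map (prod_topology unit_interval (fst X)) (fst Y) h \<and>
         (\<forall>x\<in>topspace (fst X). h (0, x) = f x) \<and> (\<forall>x\<in>topspace (fst X). h (1, x) = g x) \<and>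
         (\<forall>t\<in>{0..1}. h (t, snd X) = snd Y))"
  unfolding phomotopic_def using assms by (subst homotopic_with) auto

lemma phomotopicI:
  assumes "snd X \<in> topspace (fst X)"
    and "continuous_map (prod_topology unit_interval (fst X)) (fst Y) h"
    and "\<And>x. x \<in> topspace (fst X) \<Longrightarrow> h (0, x) = f x"
    and "\<And>x. x \<in> topspace (fst X) \<Longrightarrow> h (1, x) = g x"
    and "\<And>t. t \<in> {0..1} \<Longrightarrow> h (t, snd X) = snd Y"
  shows "phomotopic X Y f g"
  using assms by (subst phomotopic_iff) auto

lemma phomotopic_sym: "phomotopic X Y f g \<Longrightarrow> phomotopic X Y g f"
  unfolding phomotopic_def by (rule homotopic_with_symD)

lemma phomotopic_trans: "phomotopic X Y f g \<Longrightarrow> phomotopic X Y g h \<Longrightarrow> phomotopic X Y f h"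
  unfolding phomotopic_def by (rule homotopic_with_trans)

lemma phomotopic_refl: "phomotopic X Y f f \<longleftrightarrow> pmap X Y f"
  unfolding phomotopic_def pmap_def by simp

lemma phomotopic_eq:
  assumes "pmap X Y f" "snd X \<in> topspace (fst X)" "\<And>x. x \<in> topspace (fst X) \<Longrightarrow> f x = g x"
  shows "phomotopic X Y f g"
  using assms unfolding phomotopic_def pmap_def by (intro homotopic_with_equal) auto

lemma phomotopic_imp_pmap: "phomotopic X Y f g \<Longrightarrow> pmap X Y f \<and> pmap X Y g"
  unfolding phomotopic_def pmap_def
  using homotopic_with_imp_continuous_maps homotopic_with_imp_property by blast

lemma pmap_compose: "pmap X Y f \<Longrightarrow> pmap Y Z g \<Longrightarrow> pmap X Z (g \<circ> f)"
  unfolding pmap_def by (auto intro: continuous_map_compose)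

lemma phomotopic_compose_left:
  "phomotopic X Y f g \<Longrightarrow> pmap Y Z u \<Longrightarrow> phomotopic X Z (u \<circ> f) (u \<circ> g)"
  unfolding phomotopic_def pmap_def
  by (rule homotopic_with_compose_continuous_map_left[where p = "\<lambda>h. h (snd X) = snd Y"]) auto

lemma psphere_base: "snd (psphere n) \<in> topspace (fst (psphere n))"
  using in_topspace_nsphere by (simp add: psphere_def)

lemma fst_psphere [simp]: "fst (psphere n) = nsphere n"
  by (simp add: psphere_def)

lemma pi_class_eq_iff:
  assumes "pmap (psphere n) X f"
  shows "pi_class n X f = pi_class n X g \<longleftrightarrow> phomotopic (psphere n) X f g"
proof
  assume "pi_class n X f = pi_class n X g"
  moreover have "f \<in> pi_class n X f" using assms by (simp add: pi_class_def phomotopic_refl)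
  ultimately show "phomotopic (psphere n) X f g"
    unfolding pi_class_def using phomotopic_sym[of "psphere n" X g f] by blast
next
  assume fg: "phomotopic (psphere n) X f g"
  show "pi_class n X f = pi_class n X g"
    unfolding pi_class_def
    using phomotopic_trans[OF fg] phomotopic_trans[OF phomotopic_sym[OF fg]] by blast
qed

lemma pi_class_eqI: "phomotopic (psphere n) X f g \<Longrightarrow> pi_class n X f = pi_class n X g"
  using phomotopic_imp_pmap[of "psphere n" X f g] by (simp add: pi_class_eq_iff)

lemma pi_class_self: "pmap (psphere n) X f \<Longrightarrow> f \<in> pi_class n X f"
  by (simp add: pi_class_def phomotopic_refl)

lemma pi_induced_class:
  assumes f: "pmap (psphere n) X f" and u: "pmap X Y u"
  shows "pi_induced n Y u (pi_class n X f) = pi_class n Y (u \<circ> f)"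
proof -
  have "pi_class n Y (u \<circ> g) = pi_class n Y (u \<circ> f)" if "g \<in> pi_class n X f" for g
  proof -
    have "phomotopic (psphere n) Y (u \<circ> g) (u \<circ> f)"
      using that unfolding pi_class_def
      by (intro phomotopic_compose_left[OF phomotopic_sym u]) auto
    then show ?thesis
      by (rule pi_class_eqI)
  qed
  then show ?thesis
    using pi_class_self[OF f] unfolding pi_induced_def by (intro SUP_eq_const) blast+
qed

text \<open>
  A pointed homotopy is a pointed map into the space of free paths, based at the constant path.
\<close>

definition path_space :: "'a pointed \<Rightarrow> (real \<Rightarrow> 'a) pointed" where
  "path_space X = (compact_open_topology unit_interval (fst X), restrict (\<lambda>_. snd X) {0..1})"

text \<open>
  Pointed homotopies \<open>f\<^sub>t\<close> and \<open>g\<^sub>t\<close> are pointed maps of spheres into the path space.  Their Whitehead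
  map there evaluates at time \<open>t\<close> to the Whitehead map of \<open>f\<^sub>t\<close> and \<open>g\<^sub>t\<close>, so the continuity of
  Whitehead maps in an arbitrary space already contains their homotopy invariance.
\<close>

lemma whitehead_map_homotopic:
  assumes k: "k \<ge> 1" "l \<ge> 1"
    and f: "phomotopic (psphere k) X f f'" and g: "phomotopic (psphere l) X g g'"
  shows "phomotopic (psphere (k + l - 1)) X (whitehead_map k l f g) (whitehead_map k l f' g')"
proof -
  obtain hf where hf: "continuous_map (prod_topology unit_interval (nsphere k)) (fst X) hf"
    "\<And>x. hf (0, x) = f x" "\<And>x. hf (1, x) = f' x"
    "\<And>t. t \<in> {0..1} \<Longrightarrow> hf (t, snd (psphere k)) = snd X"
    using f unfolding phomotopic_def homotopic_with_def by auto
  obtain hg where hg: "continuous_map (prod_topology unit_interval (nsphere l)) (fst X) hg"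
    "\<And>x. hg (0, x) = g x" "\<And>x. hg (1, x) = g' x"
    "\<And>t. t \<in> {0..1} \<Longrightarrow> hg (t, snd (psphere l)) = snd X"
    using g unfolding phomotopic_def homotopic_with_def by auto
  let ?P = "path_space X"
  define F where "F = (\<lambda>x. restrict (\<lambda>t. hf (t, x)) {0..1})"
  define G where "G = (\<lambda>x. restrict (\<lambda>t. hg (t, x)) {0..1})"
  have F: "pmap (psphere k) ?P F"
    using continuous_map_curry_unit_interval[OF hf(1)] hf(4)
    by (auto simp: pmap_def path_space_def F_def)
  have G: "pmap (psphere l) ?P G"
    using continuous_map_curry_unit_interval[OF hg(1)] hg(4)
    by (auto simp: pmap_def path_space_def G_def)
  let ?W = "whitehead_map k l F G"
  have W: "pmap (psphere (k + l - 1)) ?P ?W"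
    by (rule pmap_whitehead_map[OF k F G])
  have Wt: "?W z t = whitehead_map k l (\<lambda>x. hf (t, x)) (\<lambda>x. hg (t, x)) z" if "t \<in> {0..1}" for z t
    using that by (auto simp: whitehead_map_def Let_def F_def G_def)
  show ?thesis
  proof (rule phomotopicI[where h = "\<lambda>(t, z). ?W z t"])
    have "continuous_map (prod_topology unit_interval (nsphere (k + l - 1)))
       (prod_topology unit_interval (compact_open_topology unit_interval (fst X))) (\<lambda>(t, z). (t, ?W z))"
      unfolding case_prod_unfold using W
      by (intro continuous_map_pairedI continuous_map_fst
          continuous_map_compose[OF continuous_map_snd, unfolded comp_def])
        (auto simp: pmap_def path_space_def)
    from continuous_map_compose[OF this continuous_map_eval_unit_interval]
    show "continuous_map (prod_topology unit_interval (fst (psphere (k + l - 1)))) (fst X)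
        (\<lambda>(t, z). ?W z t)"
      by (simp add: comp_def case_prod_unfold)
    show "(case (t, snd (psphere (k + l - 1))) of (t, z) \<Rightarrow> ?W z t) = snd X" if "t \<in> {0..1}" for t
      using W that by (simp add: pmap_def path_space_def)
  qed (auto simp: Wt hf hg psphere_base[simplified])
qed

lemma whitehead_product_class:
  assumes k: "k \<ge> 1" "l \<ge> 1" and f: "pmap (psphere k) X f" and g: "pmap (psphere l) X g"
  shows "whitehead_product k l X (pi_class k X f) (pi_class l X g) =
    pi_class (k + l - 1) X (whitehead_map k l f g)"
proof -
  have "pi_class (k + l - 1) X (whitehead_map k l f' g') = pi_class (k + l - 1) X (whitehead_map k l f g)"
    if "f' \<in> pi_class k X f" "g' \<in> pi_class l X g" for f' g'
  proof -
    have "phomotopic (psphere (k + l - 1)) X (whitehead_map k l f g) (whitehead_map k l f' g')"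
      using that unfolding pi_class_def by (intro whitehead_map_homotopic[OF k]) auto
    from phomotopic_sym[OF this] show ?thesis
      by (rule pi_class_eqI)
  qed
  then show ?thesis
    using pi_class_self[OF f] pi_class_self[OF g]
    unfolding whitehead_product_def by (intro SUP_eq_const) blast+
qed

section \<open>Maps of spheres as compactly supported maps of Euclidean space\<close>

abbreviation vecs :: "(nat \<Rightarrow> real) topology" where
  "vecs \<equiv> powertop_real UNIV"

text \<open>
  The extension of the collapse of the unit disc to all of \<open>\<real>\<^sup>n\<close>, constant outside the disc.  A
  point of \<open>\<real>\<^sup>n\<close> is any sequence, of which only the first \<open>n\<close> entries are used; so maps can be
  written down on a single space for all \<open>n\<close>.
\<close>

definition collapse :: "nat \<Rightarrow> (nat \<Rightarrow> real) \<Rightarrow> nat \<Rightarrow> real" where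
  "collapse n z = disc_collapse n (\<lambda>j. z j / max 1 (enorm n z))"

lemma continuous_map_vecs: "continuous_map Z vecs w \<longleftrightarrow> (\<forall>j. continuous_map Z euclideanreal (\<lambda>z. w z j))"
  by (rule continuous_map_componentwise_UNIV)

lemma continuous_map_vecs_coord: "continuous_map vecs euclideanreal (\<lambda>z. z j)"
  using continuous_map_product_projection[of j UNIV "\<lambda>_. euclideanreal"] by simp

lemma continuous_map_vecs_proj:
  "continuous_map Z vecs w \<Longrightarrow> continuous_map Z euclideanreal (\<lambda>z. w z j)"
  by (simp add: continuous_map_vecs)

lemma enorm_mult: "enorm n (\<lambda>j. c * z j) = \<bar>c\<bar> * enorm n z"
  by (simp add: enorm_def power_mult_distrib real_sqrt_mult flip: sum_distrib_left)

lemma enorm_fun_upd: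
  assumes "0 < n"
  shows "(enorm n (z(0 := a)))\<^sup>2 = a\<^sup>2 + (enorm n (z(0 := 0)))\<^sup>2"
  using assms by (simp add: enorm_sq sum.remove[of "{..<n}" 0])

lemma abs_le_enorm: "j < n \<Longrightarrow> \<bar>z j\<bar> \<le> enorm n z"
  unfolding enorm_def
  using member_le_sum[of j "{..<n}" "\<lambda>i. (z i)\<^sup>2"] by (intro real_le_rsqrt) simp

lemma enorm_le_fun_upd:
  assumes "0 < n"
  shows "\<bar>a\<bar> \<le> enorm n (z(0 := a))" "enorm n (z(0 := 0)) \<le> enorm n (z(0 := a))"
  using abs_le_enorm[of 0 n "z(0 := a)"] assms enorm_fun_upd[OF assms, of z a]
  by (auto intro: power2_le_imp_le enorm_nonneg)

lemma collapse_inside: "enorm n z \<le> 1 \<Longrightarrow> collapse n z = disc_collapse n z"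
  by (simp add: collapse_def max_def)

lemma collapse_outside: "1 \<le> enorm n z \<Longrightarrow> collapse n z = snd (psphere n)"
  unfolding collapse_def by (intro disc_collapse_boundary) (subst enorm_divide; simp add: max_def)

lemma enorm_collapse_arg: "enorm n (\<lambda>j. z j / max 1 (enorm n z)) \<le> 1"
  by (subst enorm_divide) auto

lemma collapse_in_nsphere: "collapse n z \<in> topspace (nsphere n)"
  unfolding collapse_def by (intro disc_collapse_in_nsphere enorm_collapse_arg)

lemma continuous_map_collapse:
  assumes "\<And>j. j < n \<Longrightarrow> continuous_map Z euclideanreal (\<lambda>x. w x j)"
  shows "continuous_map Z (nsphere n) (\<lambda>x. collapse n (w x))"
  unfolding collapse_def
  by (intro continuous_map_disc_collapse continuous_map_real_divide continuous_map_real_max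
      continuous_map_enorm assms enorm_collapse_arg) auto

lemma continuous_map_pmap_collapse:
  assumes "pmap (psphere n) X f" "continuous_map Z vecs w"
  shows "continuous_map Z (fst X) (\<lambda>x. f (collapse n (w x)))"
proof -
  have "continuous_map Z (nsphere n) (\<lambda>x. collapse n (w x))"
    using assms(2) by (intro continuous_map_collapse) (simp add: continuous_map_vecs)
  from continuous_map_compose[OF this, of "fst X" f] show ?thesis
    using assms(1) by (simp add: pmap_def comp_def)
qed

lemma pmap_collapse_outside:
  "pmap (psphere n) X f \<Longrightarrow> 1 \<le> enorm n z \<Longrightarrow> f (collapse n z) = snd X"
  by (simp add: collapse_outside pmap_def)

lemma topspace_disc: "topspace (disc n) = {z. (\<forall>j\<ge>n. z j = 0) \<and> enorm n z \<le> 1}"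
  by (auto simp: disc_def topspace_Euclidean_space)

lemma disc_boundary_point:
  assumes "n \<ge> 1"
  obtains e where "e \<in> topspace (disc n)" "enorm n e = 1"
proof
  let ?e = "\<lambda>j::nat. if j = 0 then 1 else 0 :: real"
  show "enorm n ?e = 1"
    using assms by (simp add: enorm_def if_distrib[of "\<lambda>x. x\<^sup>2"] cong: if_cong)
  then show "?e \<in> topspace (disc n)" using assms by (auto simp: topspace_disc)
qed

lemma disc_eq: "disc n = subtopology vecs {z. (\<forall>j\<ge>n. z j = 0) \<and> enorm n z \<le> 1}"
  unfolding disc_def Euclidean_space_def subtopology_subtopology
  by (rule arg_cong[where f = "subtopology vecs"]) auto

lemma compact_space_disc: "compact_space (disc n)"
proof -
  let ?D = "{z::nat \<Rightarrow> real. (\<forall>j\<ge>n. z j = 0) \<and> enorm n z \<le> 1}"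
  have "compactin vecs (PiE UNIV (\<lambda>_. {-1..1}))"
    by (simp add: compactin_PiE)
  moreover have "closedin vecs ?D"
  proof -
    have "?D = (\<Inter>j\<in>{n..}. {z \<in> topspace vecs. z j \<in> {0}}) \<inter> {z \<in> topspace vecs. enorm n z \<in> {..1}}"
      by auto
    also have "closedin vecs \<dots>"
    proof (intro closedin_Int closedin_INT
        closedin_continuous_map_preimage[where Y = euclideanreal])
      show "continuous_map vecs euclideanreal (enorm n)"
        by (intro continuous_map_enorm continuous_map_vecs_coord)
    qed (simp_all add: continuous_map_vecs_coord)
    finally show ?thesis .
  qed
  moreover have "?D \<subseteq> PiE UNIV (\<lambda>_. {-1..1})"
  proof
    fix z assume z: "z \<in> ?D"
    have "\<bar>z j\<bar> \<le> 1" for j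
      using z abs_le_enorm[of j n z] by (cases "j < n") auto
    then show "z \<in> PiE UNIV (\<lambda>_. {-1..1})" by (fastforce simp: abs_le_iff)
  qed
  ultimately have "compactin vecs ?D"
    using closed_compactin by blast
  then show ?thesis
    unfolding disc_eq by (simp add: compact_space_subtopology)
qed

text \<open>
  The first coordinate of the collapse recovers the norm, and for norm less than 1 the remaining
  ones recover the direction.
\<close>

lemma collapse_eq_iff:
  assumes z: "z \<in> topspace (disc n)" and z': "z' \<in> topspace (disc n)"
    and eq: "collapse n z = collapse n z'"
  shows "z = z' \<or> (enorm n z = 1 \<and> enorm n z' = 1)"
proof -
  have zz: "enorm n z \<le> 1" "enorm n z' \<le> 1" using z z' by (auto simp: topspace_disc)
  have eq: "disc_collapse n z j = disc_collapse n z' j" for j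
    using eq by (simp add: collapse_inside zz)
  from eq[of 0] have n: "enorm n z = enorm n z'"
    by (simp add: disc_collapse_def) (meson enorm_nonneg power2_eq_iff_nonneg)
  show ?thesis
  proof (cases "enorm n z = 1")
    case False
    then have "enorm n z < 1" using zz by simp
    then have pos: "sqrt (1 - (enorm n z)\<^sup>2) > 0"
      using power_strict_mono[of "enorm n z" 1 2] by (simp add: enorm_nonneg)
    have "z j = z' j" for j
    proof (cases "j < n")
      case True
      then show ?thesis using eq[of "Suc j"] pos n by (simp add: disc_collapse_def)
    qed (use z z' in \<open>auto simp: topspace_disc\<close>)
    then show ?thesis by auto
  qed (use n in auto)
qed

lemma collapse_surj:
  assumes n: "n \<ge> 1"
  shows "collapse n ` topspace (disc n) = topspace (nsphere n)"
proof (intro equalityI subsetI)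
  fix x assume x: "x \<in> topspace (nsphere n)"
  then have x0: "\<And>j. j > n \<Longrightarrow> x j = 0" and xs: "(x 0)\<^sup>2 + (\<Sum>i<n. (x (Suc i))\<^sup>2) = 1"
    by (auto simp: nsphere sum.atMost_shift)
  have s0: "(\<Sum>i<n. (x (Suc i))\<^sup>2) \<ge> 0" by (simp add: sum_nonneg)
  then have "(x 0)\<^sup>2 \<le> 1" using xs by linarith
  then have le: "-1 \<le> x 0" "x 0 \<le> 1" by (auto simp: abs_square_le_1 abs_le_iff)
  show "x \<in> collapse n ` topspace (disc n)"
  proof (cases "x 0 = 1")
    case True
    then have "(\<Sum>i<n. (x (Suc i))\<^sup>2) = 0" using xs by simp
    then have 0: "x (Suc i) = 0" if "i < n" for i using that by (simp add: sum_nonneg_eq_0_iff)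
    have "x = snd (psphere n)"
    proof
      fix j show "x j = snd (psphere n) j"
        using True 0[of "j - 1"] x0[of j] by (cases "j = 0"; cases "j \<le> n") (auto simp: psphere_def)
    qed
    moreover obtain e where "e \<in> topspace (disc n)" "enorm n e = 1"
      by (rule disc_boundary_point[OF n])
    ultimately show ?thesis
      by (intro image_eqI[of _ _ e]) (simp_all add: collapse_outside)
  next
    case False
    \<comment> \<open>The coordinate 0 of a collapsed point \<open>z\<close> is \<open>2|z|\<^sup>2 - 1\<close>, so its factor \<open>2 sqrt (1 - |z|\<^sup>2)\<close> is \<open>d\<close>.\<close>
    define d where "d = sqrt (2 * (1 - x 0))"
    have d: "d > 0" "d\<^sup>2 = 2 * (1 - x 0)" using False le by (auto simp: d_def)
    define z where "z = (\<lambda>j. if j < n then x (Suc j) / d else 0)"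
    have "(enorm n z)\<^sup>2 = (\<Sum>i<n. (x (Suc i))\<^sup>2) / d\<^sup>2"
      by (simp add: enorm_sq z_def power_divide flip: sum_divide_distrib)
    also have "\<dots> = (1 + x 0) / 2"
    proof -
      have "(\<Sum>i<n. (x (Suc i))\<^sup>2) = (1 + x 0) * (1 - x 0)"
        using xs by (simp add: algebra_simps power2_eq_square)
      moreover have "1 - x 0 \<noteq> 0" using False by simp
      ultimately show ?thesis unfolding d(2) by (simp add: divide_simps)
    qed
    finally have r: "(enorm n z)\<^sup>2 = (1 + x 0) / 2" .
    have "(enorm n z)\<^sup>2 \<le> 1" unfolding r using le(2) by auto
    then have r1: "enorm n z \<le> 1" using power2_le_imp_le[of "enorm n z" 1] by simp
    have "1 - (enorm n z)\<^sup>2 = (d / 2)\<^sup>2" using r d by (simp add: power_divide)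
    then have q: "sqrt (1 - (enorm n z)\<^sup>2) = d / 2" using d(1) by simp
    have r2: "2 * (enorm n z)\<^sup>2 - 1 = x 0" unfolding r by (simp add: field_simps)
    have "disc_collapse n z = x"
    proof
      fix j
      show "disc_collapse n z j = x j"
      proof (cases j)
        case 0
        then show ?thesis by (simp add: disc_collapse_def r2)
      next
        case (Suc i)
        have zi: "z i = x (Suc i) / d" if "i < n" using that by (simp add: z_def)
        show ?thesis using Suc x0[of j] d(1) by (simp add: disc_collapse_def q zi)
      qed
    qed
    then show ?thesis
      using r1 by (intro image_eqI[of _ _ z]) (auto simp: topspace_disc collapse_inside z_def)
  qed
qed (use collapse_in_nsphere in auto)

lemma Hausdorff_nsphere: "Hausdorff_space (nsphere n)"
  unfolding nsphere_def by (intro Hausdorff_space_subtopology Hausdorff_Euclidean_space)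

lemma continuous_map_disc_proj: "continuous_map (disc n) euclideanreal (\<lambda>z. z j)"
  unfolding disc_eq by (intro continuous_map_from_subtopology continuous_map_vecs_coord)

lemma continuous_map_disc_vecs: "continuous_map (disc n) vecs (\<lambda>z. z)"
  by (simp add: continuous_map_vecs continuous_map_disc_proj)

lemma quotient_map_collapse:
  assumes "n \<ge> 1"
  shows "quotient_map (disc n) (nsphere n) (collapse n)"
  using continuous_map_collapse[of n "disc n" "\<lambda>z. z"] continuous_map_disc_proj
  by (intro continuous_imp_quotient_map compact_space_disc Hausdorff_nsphere collapse_surj assms) auto

lemma quotient_map_interval_collapse:
  assumes "n \<ge> 1"
  shows "quotient_map (prod_topology unit_interval (disc n)) (prod_topology unit_interval (nsphere n))
    (\<lambda>(t, z). (t, collapse n z))"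
proof (rule continuous_imp_quotient_map)
  show "continuous_map (prod_topology unit_interval (disc n)) (prod_topology unit_interval (nsphere n))
      (\<lambda>(t, z). (t, collapse n z))"
    unfolding case_prod_unfold
    using continuous_map_collapse[of n "disc n" "\<lambda>z. z"] continuous_map_disc_proj
    by (intro continuous_map_pairedI continuous_map_fst
          continuous_map_compose[OF continuous_map_snd, unfolded comp_def]) auto
  show "(\<lambda>(t, z). (t, collapse n z)) ` topspace (prod_topology unit_interval (disc n)) =
    topspace (prod_topology unit_interval (nsphere n))"
    unfolding topspace_prod_topology collapse_surj[OF assms, symmetric] by auto
  have "compact_space unit_interval" by (simp add: compact_space_subtopology)
  then show "compact_space (prod_topology unit_interval (disc n))"
    by (simp add: compact_space_prod_topology compact_space_disc)
  have "Hausdorff_space unit_interval" by (intro Hausdorff_space_subtopology) simp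
  then show "Hausdorff_space (prod_topology unit_interval (nsphere n))"
    by (simp add: Hausdorff_space_prod_topology Hausdorff_nsphere)
qed

definition supported :: "nat \<Rightarrow> real \<Rightarrow> 'a pointed \<Rightarrow> ((nat \<Rightarrow> real) \<Rightarrow> 'a) \<Rightarrow> bool" where
  "supported n R X f \<longleftrightarrow> (\<forall>z. R \<le> enorm n z \<longrightarrow> f z = snd X)"

definition supp_homotopic ::
    "nat \<Rightarrow> real \<Rightarrow> 'a pointed \<Rightarrow> ((nat \<Rightarrow> real) \<Rightarrow> 'a) \<Rightarrow> ((nat \<Rightarrow> real) \<Rightarrow> 'a) \<Rightarrow> bool" where
  "supp_homotopic n R X = homotopic_with (supported n R X) vecs (fst X)"

text \<open>
  The disc is compact and the sphere is Hausdorff, so the collapse is a quotient map and continuous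
  maps that are constant on the boundary of the disc factor through the sphere.
\<close>

lemma supported_descends:
  assumes n: "n \<ge> 1" and f: "continuous_map vecs (fst X) f" and s: "supported n 1 X f"
  obtains g where "pmap (psphere n) X g" "\<And>z. z \<in> topspace (disc n) \<Longrightarrow> g (collapse n z) = f z"
proof -
  have c: "continuous_map (disc n) (fst X) f"
    using continuous_map_compose[OF continuous_map_disc_vecs f] by (simp add: comp_def)
  have fib: "f z = f z'"
    if "z \<in> topspace (disc n)" "z' \<in> topspace (disc n)" "collapse n z = collapse n z'" for z z'
    using collapse_eq_iff[OF that] s by (auto simp: supported_def)
  obtain g where g: "continuous_map (nsphere n) (fst X) g"
    "\<And>z. z \<in> topspace (disc n) \<Longrightarrow> g (collapse n z) = f z"
    by (rule quotient_map_lift_exists[OF quotient_map_collapse[OF n] c fib]) (assumption+, blast)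
  have "g (snd (psphere n)) = snd X"
  proof -
    obtain e where "e \<in> topspace (disc n)" and e: "enorm n e = 1"
      by (rule disc_boundary_point[OF n])
    then show ?thesis
      using g(2)[of e] e s by (simp add: collapse_outside supported_def)
  qed
  with g show ?thesis by (intro that) (auto simp: pmap_def)
qed

lemma supp_homotopic_imp_phomotopic:
  assumes n: "n \<ge> 1" and h: "supp_homotopic n 1 X \<phi> \<psi>"
    and f: "\<And>z. z \<in> topspace (disc n) \<Longrightarrow> f (collapse n z) = \<phi> z"
    and g: "\<And>z. z \<in> topspace (disc n) \<Longrightarrow> g (collapse n z) = \<psi> z"
  shows "phomotopic (psphere n) X f g"
proof -
  obtain h where h: "continuous_map (prod_topology unit_interval vecs) (fst X) h"
    "\<And>z. h (0, z) = \<phi> z" "\<And>z. h (1, z) = \<psi> z"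
    "\<And>t z. t \<in> {0..1} \<Longrightarrow> 1 \<le> enorm n z \<Longrightarrow> h (t, z) = snd X"
    using h unfolding supp_homotopic_def homotopic_with_def supported_def by blast
  have c: "continuous_map (prod_topology unit_interval (disc n)) (fst X) h"
  proof -
    have "continuous_map (prod_topology unit_interval (disc n)) (fst X) (\<lambda>x. h (fst x, snd x))"
      by (rule continuous_map_homotopy_at[OF h(1)])
        (auto intro: continuous_map_compose[OF continuous_map_snd continuous_map_disc_vecs, unfolded comp_def]
           continuous_map_fst[THEN continuous_map_into_fulltopology])
    then show ?thesis by simp
  qed
  have fib: "h x = h y" if "x \<in> topspace (prod_topology unit_interval (disc n))"
    "y \<in> topspace (prod_topology unit_interval (disc n))"
    "(case x of (t, z) \<Rightarrow> (t, collapse n z)) = (case y of (t, z) \<Rightarrow> (t, collapse n z))" for x y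
    using that collapse_eq_iff[of "snd x" n "snd y"] h(4)[of "fst x" "snd x"] h(4)[of "fst x" "snd y"]
    by (cases x; cases y) auto
  obtain k where k: "continuous_map (prod_topology unit_interval (nsphere n)) (fst X) k"
    "\<And>x. x \<in> topspace (prod_topology unit_interval (disc n)) \<Longrightarrow>
       k (case x of (t, z) \<Rightarrow> (t, collapse n z)) = h x"
    by (rule quotient_map_lift_exists[OF quotient_map_interval_collapse[OF n] c fib]) (assumption+, blast)
  have k': "k (t, collapse n z) = h (t, z)" if "t \<in> {0..1}" "z \<in> topspace (disc n)" for t z
    using k(2)[of "(t, z)"] that by simp
  show ?thesis
  proof (rule phomotopicI[where h = k])
    show "k (0, x) = f x" "k (1, x) = g x" if xs: "x \<in> topspace (fst (psphere n))" for x
    proof -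
      obtain z where z: "z \<in> topspace (disc n)" "x = collapse n z"
        using xs unfolding fst_psphere collapse_surj[OF n, symmetric] by blast
      then show "k (0, x) = f x" "k (1, x) = g x"
        using k'[of 0 z] k'[of 1 z] h(2,3)[of z] f[OF z(1)] g[OF z(1)] by simp_all
    qed
    show "k (t, snd (psphere n)) = snd X" if t: "t \<in> {0..1}" for t
    proof -
      obtain e where "e \<in> topspace (disc n)" and e: "enorm n e = 1"
        by (rule disc_boundary_point[OF n])
      then show ?thesis
        using k'[of t e] e t h(4) by (simp add: collapse_outside)
    qed
  qed (use k psphere_base in auto)
qed

lemma phomotopic_imp_supp_homotopic:
  assumes "phomotopic (psphere n) X f g"
  shows "supp_homotopic n 1 X (f \<circ> collapse n) (g \<circ> collapse n)"
  unfolding supp_homotopic_def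
proof (rule homotopic_with_compose_continuous_map_right[OF assms[unfolded phomotopic_def]])
  show "continuous_map vecs (fst (psphere n)) (collapse n)"
    using continuous_map_collapse[of n vecs "\<lambda>z. z"] continuous_map_vecs_coord by simp
qed (auto simp: supported_def collapse_outside)

lemma continuous_map_scale_vecs:
  assumes "continuous_map Z euclideanreal c" "continuous_map Z vecs w"
  shows "continuous_map Z vecs (\<lambda>x j. c x * w x j)"
  using assms by (auto simp: continuous_map_vecs intro: continuous_map_real_mult)

lemma supp_homotopic_dilate:
  assumes f: "pmap (psphere n) X f" and R: "R \<ge> 1"
  shows "supp_homotopic n 1 X (f \<circ> collapse n) (\<lambda>z. f (collapse n (\<lambda>j. R * z j)))"
  unfolding supp_homotopic_def homotopic_with_def
proof (intro exI[of _ "\<lambda>(t, z). f (collapse n (\<lambda>j. (1 + t * (R - 1)) * z j))"] conjI allI ballI)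
  show "continuous_map (prod_topology unit_interval vecs) (fst X)
     (\<lambda>(t, z). f (collapse n (\<lambda>j. (1 + t * (R - 1)) * z j)))"
    unfolding case_prod_unfold
    by (intro continuous_map_pmap_collapse[OF f] continuous_map_scale_vecs continuous_map_snd
         continuous_intros continuous_map_fst[THEN continuous_map_into_fulltopology])
  show "supported n 1 X (\<lambda>z. case (t, z) of (t, z) \<Rightarrow> f (collapse n (\<lambda>j. (1 + t * (R - 1)) * z j)))"
    if t: "t \<in> {0..1}" for t
    unfolding supported_def
  proof (intro allI impI)
    fix z assume z: "1 \<le> enorm n z"
    have "1 \<le> 1 + t * (R - 1)" using t R by simp
    then have "1 * 1 \<le> \<bar>1 + t * (R - 1)\<bar> * enorm n z" using z by (intro mult_mono) auto
    then show "(case (t, z) of (t, z) \<Rightarrow> f (collapse n (\<lambda>j. (1 + t * (R - 1)) * z j))) = snd X"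
      using f by (simp add: pmap_collapse_outside enorm_mult)
  qed
qed auto

lemma supp_homotopic_rescale:
  assumes "supp_homotopic n R X \<phi> \<psi>" and R: "R > 0"
  shows "supp_homotopic n 1 X (\<lambda>z. \<phi> (\<lambda>j. R * z j)) (\<lambda>z. \<psi> (\<lambda>j. R * z j))"
proof -
  have "continuous_map vecs vecs (\<lambda>z j. R * z j)"
    by (intro continuous_map_scale_vecs) auto
  from homotopic_with_compose_continuous_map_right[OF assms(1)[unfolded supp_homotopic_def] this,
      of "supported n 1 X"]
  show ?thesis
    using R by (auto simp: supp_homotopic_def supported_def comp_def enorm_mult)
qed

text \<open>
  The radius of the support does not matter: dilating the argument shrinks the support into the unit
  disc, and dilation by \<open>R \<ge> 1\<close> is homotopic to the identity through maps that keep the complement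
  of the unit disc away from it.
\<close>

lemma supp_homotopic_descend:
  assumes n: "n \<ge> 1" and R: "R \<ge> 1" and f: "pmap (psphere n) X f"
    and h: "supp_homotopic n R X (f \<circ> collapse n) \<phi>"
    and g: "\<And>z. z \<in> topspace (disc n) \<Longrightarrow> g (collapse n z) = \<phi> (\<lambda>j. R * z j)"
  shows "phomotopic (psphere n) X f g"
proof (rule supp_homotopic_imp_phomotopic[OF n])
  have "supp_homotopic n 1 X (\<lambda>z. f (collapse n (\<lambda>j. R * z j))) (\<lambda>z. \<phi> (\<lambda>j. R * z j))"
    using supp_homotopic_rescale[OF h] R by simp
  with supp_homotopic_dilate[OF f R]
  show "supp_homotopic n 1 X (f \<circ> collapse n) (\<lambda>z. \<phi> (\<lambda>j. R * z j))"
    unfolding supp_homotopic_def by (rule homotopic_with_trans)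
qed (use g in auto)

lemma supp_homotopic_collapse_imp_phomotopic:
  assumes n: "n \<ge> 1" and R: "R \<ge> 1" and f: "pmap (psphere n) X f" and g: "pmap (psphere n) X g"
    and h: "supp_homotopic n R X (f \<circ> collapse n) (g \<circ> collapse n)"
  shows "phomotopic (psphere n) X f g"
proof -
  have "continuous_map vecs (fst X) (\<lambda>z. g (collapse n (\<lambda>j. R * z j)))"
    by (intro continuous_map_pmap_collapse[OF g] continuous_map_scale_vecs) auto
  moreover have "supported n 1 X (\<lambda>z. g (collapse n (\<lambda>j. R * z j)))"
    unfolding supported_def
  proof (intro allI impI)
    fix z assume z: "1 \<le> enorm n z"
    then have "1 * 1 \<le> \<bar>R\<bar> * enorm n z" using R by (intro mult_mono) auto
    then show "g (collapse n (\<lambda>j. R * z j)) = snd X" 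
      using g by (simp add: pmap_collapse_outside enorm_mult)
  qed
  ultimately obtain g' where g': "\<And>z. z \<in> topspace (disc n) \<Longrightarrow> g' (collapse n z) = g (collapse n (\<lambda>j. R * z j))"
    using supported_descends[OF n] by metis
  have "phomotopic (psphere n) X f g'"
    using g' by (intro supp_homotopic_descend[OF n R f h]) auto
  moreover have "phomotopic (psphere n) X g g'"
    using g' by (intro supp_homotopic_imp_phomotopic[OF n supp_homotopic_dilate[OF g R]]) auto
  ultimately show ?thesis using phomotopic_sym phomotopic_trans by blast
qed

section \<open>The fibre inclusion on homotopy groups\<close>

lemma continuous_map_fun_upd:
  assumes "continuous_map Z vecs w" "continuous_map Z euclideanreal c"
  shows "continuous_map Z vecs (\<lambda>x. (w x)(j := c x))"
  using assms by (auto simp: continuous_map_vecs)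

lemma continuous_map_enorm_vecs:
  "continuous_map Z vecs w \<Longrightarrow> continuous_map Z euclideanreal (\<lambda>x. enorm n (w x))"
  by (intro continuous_map_enorm) (simp add: continuous_map_vecs)

lemma fibration_lift:
  assumes "fibration E B p" "continuous_map X E f"
    "continuous_map (prod_topology unit_interval X) B h"
    "\<And>x. x \<in> topspace X \<Longrightarrow> h (0, x) = p (f x)"
  obtains k where "continuous_map (prod_topology unit_interval X) E k"
    "\<And>x. x \<in> topspace X \<Longrightarrow> k (0, x) = f x"
    "\<And>t x. t \<in> {0..1} \<Longrightarrow> x \<in> topspace X \<Longrightarrow> p (k (t, x)) = h (t, x)"
proof -
  have "\<exists>k. continuous_map (prod_topology unit_interval X) E k \<and>
    (\<forall>x\<in>topspace X. k (0, x) = f x) \<and> (\<forall>t\<in>{0..1}. \<forall>x\<in>topspace X. p (k (t, x)) = h (t, x))"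
    by (rule fibration_homotopy_lifting[OF assms(1), of X, unfolded homotopy_lifting_def,
          THEN spec, THEN spec, THEN mp]) (simp add: assms)
  then obtain k where "continuous_map (prod_topology unit_interval X) E k"
    "\<forall>x\<in>topspace X. k (0, x) = f x" "\<forall>t\<in>{0..1}. \<forall>x\<in>topspace X. p (k (t, x)) = h (t, x)"
    by (elim exE conjE)
  then show ?thesis by (intro that[of k]) simp_all
qed

lemma fibre_retraction:
  assumes "fibration_sequence F E B i p"
  obtains g where
    "\<And>x. x \<in> topspace (fst F) \<Longrightarrow> g (i x) = x"
    "\<And>Z w. continuous_map Z (fst E) w \<Longrightarrow> (\<And>z. z \<in> topspace Z \<Longrightarrow> p (w z) = snd B) \<Longrightarrow>
       continuous_map Z (fst F) (g \<circ> w)"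
    "\<And>e. e \<in> topspace (fst E) \<Longrightarrow> p e = snd B \<Longrightarrow> i (g e) = e"
proof -
  let ?S = "{e \<in> topspace (fst E). p e = snd B}"
  from assms have im: "i ` topspace (fst F) = ?S" and emb: "embedding_map (fst F) (fst E) i"
    by (auto simp: fibration_sequence_def)
  from emb obtain g where g: "homeomorphic_maps (fst F) (subtopology (fst E) ?S) i g"
    unfolding embedding_map_def im by (auto simp: homeomorphic_map_maps)
  show ?thesis
  proof (rule that[of g])
    show "g (i x) = x" if "x \<in> topspace (fst F)" for x
      using g that by (simp add: homeomorphic_maps_def)
    show "i (g e) = e" if "e \<in> topspace (fst E)" "p e = snd B" for e
      using g that by (auto simp: homeomorphic_maps_def)
    fix Z :: "'x topology" and w
    assume "continuous_map Z (fst E) w" "\<And>z. z \<in> topspace Z \<Longrightarrow> p (w z) = snd B"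
    then have "continuous_map Z (subtopology (fst E) ?S) w"
      by (auto simp: continuous_map_in_subtopology dest: continuous_map_image_subset_topspace)
    moreover have "continuous_map (subtopology (fst E) ?S) (fst F) g"
      using g by (simp add: homeomorphic_maps_def)
    ultimately show "continuous_map Z (fst F) (g \<circ> w)" by (rule continuous_map_compose)
  qed
qed

text \<open>
  Lift the null homotopy of \<open>p \<circ> W\<close>.  The lift need not respect the base point, but in the
  model on \<open>\<real>\<^sup>n\<close> the base homotopy is stationary outside the unit ball, so the lift lies in the fibre
  there at every time.  Hence it can be stopped earlier and earlier as the norm grows from 1 to 2,
  and it still ends in the fibre.
\<close>

lemma fibre_inclusion_exact:
  assumes n: "n \<ge> 1" and fib: "fibration_sequence F E B i p"
    and F0: "snd F \<in> topspace (fst F)" and W: "pmap (psphere n) E W"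
    and null: "phomotopic (psphere n) B (p \<circ> W) (\<lambda>_. snd B)"
  obtains g where "pmap (psphere n) F g" "phomotopic (psphere n) E W (i \<circ> g)"
proof -
  have i: "pmap F E i" and p: "pmap E B p" and fibr: "fibration (fst E) (fst B) p"
    using fib by (auto simp: fibration_sequence_def)
  obtain g where gi: "\<And>x. x \<in> topspace (fst F) \<Longrightarrow> g (i x) = x"
    and gc: "\<And>w. continuous_map vecs (fst E) w \<Longrightarrow>
         (\<And>z. z \<in> topspace vecs \<Longrightarrow> p (w z) = snd B) \<Longrightarrow> continuous_map vecs (fst F) (g \<circ> w)"
    and ig: "\<And>e. e \<in> topspace (fst E) \<Longrightarrow> p e = snd B \<Longrightarrow> i (g e) = e"
    by (rule fibre_retraction[OF fib]) (assumption | blast)+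
  have E0: "i (snd F) = snd E" using i by (simp add: pmap_def)
  let ?I = "prod_topology unit_interval vecs"
  have sh: "supp_homotopic n 1 B (p \<circ> W \<circ> collapse n) ((\<lambda>_. snd B) \<circ> collapse n)"
    by (rule phomotopic_imp_supp_homotopic[OF null])
  obtain M where M: "continuous_map ?I (fst B) M" "\<And>z. M (0, z) = p (W (collapse n z))"
    "\<And>z. M (1, z) = snd B" "\<And>t z. t \<in> {0..1} \<Longrightarrow> 1 \<le> enorm n z \<Longrightarrow> M (t, z) = snd B"
    using sh unfolding supp_homotopic_def homotopic_with_def supported_def comp_def by blast
  have Wc: "continuous_map vecs (fst E) (\<lambda>z. W (collapse n z))"
    by (intro continuous_map_pmap_collapse[OF W]) auto
  have M0: "M (0, z) = p (W (collapse n z))" for z by (rule M(2))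
  obtain k where k: "continuous_map ?I (fst E) k" "\<And>z. k (0, z) = W (collapse n z)"
    "\<And>t z. t \<in> {0..1} \<Longrightarrow> p (k (t, z)) = M (t, z)"
    by (rule fibration_lift[OF fibr Wc M(1) M0]) simp
  define cut where "cut = (\<lambda>z. max 0 (min 1 (2 - enorm n z)))"
  have cut: "cut z \<in> {0..1}" for z by (auto simp: cut_def)
  have cutc: "continuous_map Z euclideanreal (\<lambda>x. cut (w x))" if "continuous_map Z vecs w" for Z :: "'z topology" and w
    unfolding cut_def by (intro continuous_intros continuous_map_enorm_vecs that)
  define \<phi> where "\<phi> = (\<lambda>z. k (cut z, z))"
  have \<phi>c: "continuous_map vecs (fst E) \<phi>"
    unfolding \<phi>_def using cut by (intro continuous_map_homotopy_at[OF k(1)] cutc) auto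
  have \<phi>p: "p (\<phi> z) = snd B" for z
  proof (cases "enorm n z \<le> 1")
    case True
    then have "cut z = 1" by (simp add: cut_def)
    then show ?thesis by (simp add: \<phi>_def k M)
  next
    case False
    then show ?thesis using cut by (simp add: \<phi>_def k M)
  qed
  have \<phi>0: "\<phi> z = snd E" if "enorm n z \<ge> 2" for z
    using that W by (simp add: \<phi>_def cut_def k pmap_collapse_outside)
  have sh2: "supp_homotopic n 2 E (W \<circ> collapse n) \<phi>"
    unfolding supp_homotopic_def homotopic_with_def
  proof (intro exI[of _ "\<lambda>(t, z). k (t * cut z, z)"] conjI allI ballI)
    have "t * cut z \<in> {0..1}" if "t \<in> {0..1}" for t z
      using that cut[of z] by (auto simp: mult_le_one)
    then show "continuous_map ?I (fst E) (\<lambda>(t, z). k (t * cut z, z))"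
      unfolding case_prod_unfold
      by (intro continuous_map_homotopy_at[OF k(1)] continuous_map_real_mult cutc continuous_map_snd
          continuous_map_fst[THEN continuous_map_into_fulltopology]) auto
    show "supported n 2 E (\<lambda>z. case (t, z) of (t, z) \<Rightarrow> k (t * cut z, z))" for t
      using W by (auto simp: supported_def cut_def k pmap_collapse_outside)
  qed (auto simp: k \<phi>_def)
  have "continuous_map vecs (fst E) (\<lambda>z. \<phi> (\<lambda>j. 2 * z j))"
    using continuous_map_compose[OF continuous_map_scale_vecs \<phi>c, of vecs "\<lambda>_. 2" "\<lambda>z. z"]
    by (simp add: comp_def)
  from gc[OF this] have c: "continuous_map vecs (fst F) (\<lambda>z. g (\<phi> (\<lambda>j. 2 * z j)))"
    using \<phi>p by (simp add: comp_def)
  have "supported n 1 F (\<lambda>z. g (\<phi> (\<lambda>j. 2 * z j)))"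
    using gi[OF F0] E0 by (auto simp: supported_def \<phi>0 enorm_mult)
  from supported_descends[OF n c this]
  obtain \<gamma> where \<gamma>: "pmap (psphere n) F \<gamma>"
    "\<And>z. z \<in> topspace (disc n) \<Longrightarrow> \<gamma> (collapse n z) = g (\<phi> (\<lambda>j. 2 * z j))" by blast
  show ?thesis
  proof (rule that[OF \<gamma>(1)])
    have "i (g (\<phi> z)) = \<phi> z" for z
      using \<phi>c \<phi>p by (intro ig) (auto simp: continuous_map_def)
    then show "phomotopic (psphere n) E W (i \<circ> \<gamma>)"
      using \<gamma>(2) by (intro supp_homotopic_descend[OF n _ W sh2]) auto
  qed
qed

text \<open>
  Neither the fold map \<open>z 0 \<mapsto> min (z 0) (2 - z 0)\<close> nor anything that decreases the coordinate 0
  further moves a distant point into the unit ball.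
\<close>

lemma enorm_reflected_ge_1:
  assumes n: "n \<ge> 1" and z: "enorm n z \<ge> 4" and c: "c \<le> z 0" "c \<le> 2 - z 0"
  shows "enorm n (z(0 := c)) \<ge> 1"
proof (cases "enorm n (z(0 := 0)) \<ge> 1")
  case True
  then show ?thesis using enorm_le_fun_upd(2)[of n z c] n by simp
next
  case False
  then have "(enorm n (z(0 := 0)))\<^sup>2 \<le> 1"
    using power_mono[of "enorm n (z(0 := 0))" 1 2] enorm_nonneg by simp
  moreover have "(enorm n z)\<^sup>2 = (z 0)\<^sup>2 + (enorm n (z(0 := 0)))\<^sup>2"
    using enorm_fun_upd[of n z "z 0"] n by simp
  moreover have "(enorm n z)\<^sup>2 \<ge> 16" using power_mono[OF z, of 2] by simp
  ultimately have "(z 0)\<^sup>2 \<ge> 3\<^sup>2" by simp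
  then have "\<bar>z 0\<bar> \<ge> 3" using abs_le_square_iff[of 3 "z 0"] by simp
  then have "\<bar>c\<bar> \<ge> 1" using c by linarith
  then show ?thesis using enorm_le_fun_upd(1)[of n c z] n by simp
qed

text \<open>
  A homotopy \<open>K\<close> from \<open>i \<circ> f\<close> to \<open>i \<circ> f'\<close> projects to a family of loops in \<open>B\<close>, that is, to a class
  \<open>\<delta>\<close> one dimension up, and can be pushed into the fibre if \<open>\<delta> = 0\<close>.  To achieve this, subtract
  \<open>s\<^sub>* \<delta>\<close>: outside the unit ball, where \<open>K\<close> is stationary, there is room for the mirror image of
  \<open>s \<circ> p \<circ> K\<close> in the hyperplane \<open>z 0 = 1\<close>.  The projection of the new homotopy is then, up to
  \<open>p \<circ> s \<simeq> id\<close>, invariant under the reflection, and it is contracted by pulling it back along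
  a deformation of the fold map out of the unit ball.

  This contraction is lifted without prescribing the lift at the two ends of the homotopy.  They
  move, but inside the fibre, because the contraction is stationary there.
\<close>

lemma fibre_inclusion_injective:
  assumes n: "n \<ge> 1" and fib: "fibration_sequence F E B i p" and sec: "homotopy_section E B p s"
    and F0: "snd F \<in> topspace (fst F)"
    and f: "pmap (psphere n) F f" "pmap (psphere n) F f'"
    and h: "phomotopic (psphere n) E (i \<circ> f) (i \<circ> f')"
  shows "phomotopic (psphere n) F f f'"
proof -
  have i: "pmap F E i" and p: "pmap E B p" and fibr: "fibration (fst E) (fst B) p"
    and pi: "\<And>x. x \<in> topspace (fst F) \<Longrightarrow> p (i x) = snd B"
    using fib by (auto simp: fibration_sequence_def)
  have s: "pmap B E s" and ps: "phomotopic B B (p \<circ> s) id"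
    using sec by (auto simp: homotopy_section_def)
  obtain g where gi: "\<And>x. x \<in> topspace (fst F) \<Longrightarrow> g (i x) = x"
    and gc: "\<And>w. continuous_map (prod_topology unit_interval vecs) (fst E) w \<Longrightarrow>
         (\<And>z. z \<in> topspace (prod_topology unit_interval vecs) \<Longrightarrow> p (w z) = snd B) \<Longrightarrow>
       continuous_map (prod_topology unit_interval vecs) (fst F) (g \<circ> w)"
    by (rule fibre_retraction[OF fib]) (assumption | blast)+
  have E0: "i (snd F) = snd E" and g0: "g (snd E) = snd F"
    using i gi[OF F0] by (auto simp: pmap_def)
  have s0: "s (snd B) = snd E" and p0: "p (snd E) = snd B" using s p by (auto simp: pmap_def)
  obtain A where A: "continuous_map (prod_topology unit_interval (fst B)) (fst B) A"
    "\<And>b. A (0, b) = p (s b)" "\<And>b. A (1, b) = b" "\<And>t. t \<in> {0..1} \<Longrightarrow> A (t, snd B) = snd B"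
    using ps unfolding phomotopic_def homotopic_with_def by auto
  let ?I = "prod_topology unit_interval vecs"
  let ?J = "prod_topology unit_interval ?I"
  obtain K where K: "continuous_map ?I (fst E) K" "\<And>z. K (0, z) = i (f (collapse n z))"
    "\<And>z. K (1, z) = i (f' (collapse n z))" "\<And>t z. t \<in> {0..1} \<Longrightarrow> 1 \<le> enorm n z \<Longrightarrow> K (t, z) = snd E"
    using phomotopic_imp_supp_homotopic[OF h]
    unfolding supp_homotopic_def homotopic_with_def supported_def comp_def by blast
  define lam where "lam = (\<lambda>(t, z). p (K (t, z)))"
  have lamc: "continuous_map ?I (fst B) lam"
    using continuous_map_compose[OF K(1), of "fst B" p] p
    by (simp add: lam_def comp_def case_prod_unfold pmap_def)
  have lam0: "lam (t, z) = snd B" if "t \<in> {0..1}" "1 \<le> enorm n z" for t z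
    using that by (simp add: lam_def K p0)
  have ff: "f (collapse n z) \<in> topspace (fst F)" "f' (collapse n z) \<in> topspace (fst F)" for z
    using f collapse_in_nsphere[of n z] by (auto simp: pmap_def continuous_map_def)
  have lam01: "lam (t, z) = snd B" if "t = 0 \<or> t = 1" for t z
    using that by (auto simp: lam_def K pi ff)
  have up1: "1 \<le> enorm n (z(0 := 1))" for z
    using enorm_le_fun_upd(1)[of n 1 z] n by simp
  \<comment> \<open>The corrected homotopy: \<open>K\<close> together with the mirror image of its projection.\<close>
  define K' where "K' = (\<lambda>(t, z). if z 0 \<le> 1 then K (t, z) else s (lam (t, z(0 := 2 - z 0))))"
  have snd2: "continuous_map ?I vecs snd" by (rule continuous_map_snd)
  have K'c: "continuous_map ?I (fst E) K'"
    unfolding K'_def case_prod_unfold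
  proof (rule continuous_map_cases_le)
    show c: "continuous_map ?I euclideanreal (\<lambda>x. snd x 0)"
      by (rule continuous_map_vecs_proj[OF snd2])
    have "continuous_map ?I (fst B) (\<lambda>x. lam (fst x, (snd x)(0 := 2 - snd x 0)))"
      by (intro continuous_map_homotopy_at[OF lamc] continuous_map_fun_upd snd2 continuous_map_diff c
          continuous_map_fst[THEN continuous_map_into_fulltopology]) auto
    from continuous_map_compose[OF this, of "fst E" s]
    show "continuous_map (subtopology ?I {x \<in> topspace ?I. 1 \<le> snd x 0}) (fst E)
        (\<lambda>x. s (lam (fst x, (snd x)(0 := 2 - snd x 0))))"
      using s by (auto intro!: continuous_map_from_subtopology simp: pmap_def comp_def)
    show "K (fst x, snd x) = s (lam (fst x, (snd x)(0 := 2 - snd x 0)))"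
      if "x \<in> topspace ?I" "snd x 0 = 1" for x
      using that up1[of "snd x"] by (auto simp: lam0 s0 K(4) fun_upd_idem)
  qed (use K(1) in \<open>auto intro: continuous_map_from_subtopology\<close>)
  \<comment> \<open>The null homotopy of \<open>p \<circ> K'\<close>.  For \<open>\<tau> \<le> 1/2\<close> it replaces \<open>p \<circ> s\<close> by the identity on the mirror
    image; at \<open>\<tau> = 1/2\<close> it is the pull-back of \<open>lam\<close> along the fold map \<open>min (z 0) (2 - z 0)\<close>, which is
    then cut down until, at \<open>\<tau> = 1\<close>, its values are at most \<open>-1\<close>.\<close>
  define c where "c = (\<lambda>\<tau> (z :: nat \<Rightarrow> real). min (min (z 0) (2 - z 0)) (1 - 2 * max (2 * \<tau> - 1) (0::real)))"
  define L where "L = (\<lambda>(\<tau>, t, z). if z (0::nat) \<le> 1 then lam (t, z(0 := c \<tau> z))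
     else A (min (2 * \<tau>) 1, lam (t, z(0 := c \<tau> z))))"
  have Lc: "continuous_map ?J (fst B) L"
    unfolding L_def case_prod_unfold
  proof (rule continuous_map_cases_le)
    have c1: "continuous_map ?J euclideanreal fst"
      by (rule continuous_map_fst[THEN continuous_map_into_fulltopology])
    have c2: "continuous_map ?J unit_interval (\<lambda>x. fst (snd x))"
      using continuous_map_compose[OF continuous_map_snd continuous_map_fst] by (simp add: comp_def)
    have c3: "continuous_map ?J vecs (\<lambda>x. snd (snd x))"
      using continuous_map_compose[OF continuous_map_snd continuous_map_snd] by (simp add: comp_def)
    show c30: "continuous_map ?J euclideanreal (\<lambda>x. snd (snd x) 0)"
      by (rule continuous_map_vecs_proj[OF c3])
    have l: "continuous_map ?J (fst B) (\<lambda>x. lam (fst (snd x), (snd (snd x))(0 := c (fst x) (snd (snd x)))))"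
      unfolding c_def
      by (intro continuous_map_homotopy_at[OF lamc] continuous_map_fun_upd c3 c30 c1 continuous_intros
          c2[THEN continuous_map_into_fulltopology]) auto
    then show "continuous_map (subtopology ?J {x \<in> topspace ?J. snd (snd x) 0 \<le> 1}) (fst B)
       (\<lambda>x. lam (fst (snd x), (snd (snd x))(0 := c (fst x) (snd (snd x)))))"
      by (rule continuous_map_from_subtopology)
    show "continuous_map (subtopology ?J {x \<in> topspace ?J. 1 \<le> snd (snd x) 0}) (fst B)
       (\<lambda>x. A (min (2 * fst x) 1, lam (fst (snd x), (snd (snd x))(0 := c (fst x) (snd (snd x))))))"
      by (intro continuous_map_from_subtopology continuous_map_homotopy_at[OF A(1) _ _ l]
          continuous_intros c1) auto
    show "lam (fst (snd x), (snd (snd x))(0 := c (fst x) (snd (snd x)))) =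
       A (min (2 * fst x) 1, lam (fst (snd x), (snd (snd x))(0 := c (fst x) (snd (snd x)))))"
      if x: "x \<in> topspace ?J" "snd (snd x) 0 = 1" for x
    proof (cases "fst x \<le> 1/2")
      case True
      then have "c (fst x) (snd (snd x)) = 1" using x(2) by (simp add: c_def)
      moreover have "fst (snd x) \<in> {0..1}" "min (2 * fst x) 1 \<in> {0..1}" using x(1) True by auto
      ultimately show ?thesis using lam0[OF _ up1] A(4) by simp
    next
      case False
      then have "min (2 * fst x) 1 = 1" by simp
      then show ?thesis by (simp only: A(3))
    qed
  qed auto
  have L0: "L (0, x) = p (K' x)" for x
  proof -
    obtain t z where x: "x = (t, z)" by (cases x)
    have "z(0 := c 0 z) = z" if "z 0 \<le> 1" using that by (simp add: c_def min_def)
    moreover have "c 0 z = 2 - z 0" if "\<not> z 0 \<le> 1" using that by (simp add: c_def min_def)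
    ultimately show ?thesis
      by (cases "z 0 \<le> 1") (simp_all add: x L_def K'_def A lam_def)
  qed
  have L1: "L (\<tau>, t, z) = snd B"
    if "\<tau> \<in> {0..1}" "t \<in> {0..1}" "t = 0 \<or> t = 1 \<or> \<tau> = 1 \<or> 4 \<le> enorm n z" for \<tau> t z
  proof -
    have "lam (t, z(0 := c \<tau> z)) = snd B"
    proof (cases "t = 0 \<or> t = 1")
      case False
      have "1 \<le> enorm n (z(0 := c \<tau> z))"
      proof (cases "\<tau> = 1")
        case True
        then have "\<bar>c \<tau> z\<bar> \<ge> 1" by (simp add: c_def)
        then show ?thesis using enorm_le_fun_upd(1)[of n "c \<tau> z" z] n by linarith
      next
        case F: False
        with False that(3) have "4 \<le> enorm n z" by blast
        then show ?thesis by (rule enorm_reflected_ge_1[OF n]) (simp_all add: c_def)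
      qed
      then show ?thesis by (rule lam0[OF that(2)])
    qed (use lam01 in blast)
    then show ?thesis using that(1) by (simp add: L_def A)
  qed
  obtain k where k: "continuous_map ?J (fst E) k" "\<And>t z. t \<in> {0..1} \<Longrightarrow> k (0, t, z) = K' (t, z)"
    "\<And>\<tau> t z. \<tau> \<in> {0..1} \<Longrightarrow> t \<in> {0..1} \<Longrightarrow> p (k (\<tau>, t, z)) = L (\<tau>, t, z)"
    by (rule fibration_lift[OF fibr K'c Lc L0]) simp
  define cut where "cut = (\<lambda>z. max 0 (min 1 (5 - enorm n z)))"
  have cut: "cut z \<in> {0..1}" for z by (auto simp: cut_def)
  have cutt: "t * cut z \<in> {0..1}" if "t \<in> {0..1}" for t z
    using that cut[of z] by (auto simp: mult_le_one)
  have cutc: "continuous_map ?I euclideanreal (\<lambda>x. cut (snd x))"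
    unfolding cut_def by (intro continuous_intros continuous_map_enorm_vecs continuous_map_snd)
  have K'0: "K' (t, z) = snd E" if "t \<in> {0..1}" "4 \<le> enorm n z" for t z
  proof (cases "z 0 \<le> 1")
    case False
    then have "1 \<le> enorm n (z(0 := 2 - z 0))"
      by (intro enorm_reflected_ge_1[OF n that(2)]) auto
    then show ?thesis using False that(1) by (simp add: K'_def lam0 s0)
  qed (use that in \<open>simp add: K'_def K\<close>)
  have kout: "k (t * cut z, t', z) = snd E" if "t' \<in> {0..1}" "5 \<le> enorm n z" for t t' z
    using that by (simp add: cut_def k K'0)
  \<comment> \<open>In the fibre, \<open>f\<close> and \<open>f'\<close> are joined along the three free sides of the square \<open>(\<tau>, t)\<close>.\<close>
  have side: "supp_homotopic n 5 F (\<lambda>z. g (k (0, t0, z))) (\<lambda>z. g (k (cut z, t0, z)))" if t0: "t0 = 0 \<or> t0 = 1" for t0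
    unfolding supp_homotopic_def homotopic_with_def
  proof (intro exI[of _ "\<lambda>(t, z). g (k (t * cut z, t0, z))"] conjI allI ballI)
    have t01: "t0 \<in> {0..1}" using t0 by auto
    have "continuous_map ?I (fst E) (\<lambda>x. k (fst x * cut (snd x), t0, snd x))"
      using t01 cutt
      by (intro continuous_map_homotopy_at[OF k(1)] continuous_map_real_mult cutc continuous_map_pairedI
          continuous_map_snd continuous_map_fst[THEN continuous_map_into_fulltopology]) auto
    moreover have "p (k (t * cut z, t0, z)) = snd B" if "t \<in> {0..1}" for t z
      using k(3)[OF cutt[OF that] t01, of z z] L1[OF cutt[OF that] t01, of z z] t0 by metis
    ultimately show "continuous_map ?I (fst F) (\<lambda>(t, z). g (k (t * cut z, t0, z)))"
      using gc[of "\<lambda>x. k (fst x * cut (snd x), t0, snd x)"] by (auto simp: comp_def case_prod_unfold)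
    show "supported n 5 F (\<lambda>z. case (t, z) of (t, z) \<Rightarrow> g (k (t * cut z, t0, z)))" for t
      by (simp add: supported_def kout[OF t01] g0)
  qed auto
  have top: "supp_homotopic n 5 F (\<lambda>z. g (k (cut z, 0, z))) (\<lambda>z. g (k (cut z, 1, z)))"
    unfolding supp_homotopic_def homotopic_with_def
  proof (intro exI[of _ "\<lambda>(t, z). g (k (cut z, t, z))"] conjI allI ballI)
    have "continuous_map ?I (fst E) (\<lambda>x. k (cut (snd x), fst x, snd x))"
      using cut
      by (intro continuous_map_homotopy_at[OF k(1)] cutc continuous_map_pairedI
          continuous_map_snd continuous_map_fst) auto
    moreover have "p (k (cut z, t, z)) = snd B" if t: "t \<in> {0..1}" for t z
    proof (cases "4 \<le> enorm n z")
      case True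
      then show ?thesis using L1[OF cut t] cut t by (simp add: k)
    next
      case False
      then have "cut z = 1" by (simp add: cut_def)
      then show ?thesis using L1[of 1 t z] t by (simp add: k)
    qed
    ultimately show "continuous_map ?I (fst F) (\<lambda>(t, z). g (k (cut z, t, z)))"
      using gc[of "\<lambda>x. k (cut (snd x), fst x, snd x)"] by (auto simp: comp_def case_prod_unfold)
    show "supported n 5 F (\<lambda>z. case (t, z) of (t, z) \<Rightarrow> g (k (cut z, t, z)))" if "t \<in> {0..1}" for t
      using kout[OF that, of _ 1] by (simp add: supported_def g0)
  qed auto
  have end0: "K' (0, z) = i (f (collapse n z))" for z
  proof (cases "z 0 \<le> 1")
    case False
    then have "1 \<le> enorm n z" using abs_le_enorm[of 0 n z] n by simp
    then show ?thesis using False lam01 f by (simp add: K'_def s0 pmap_collapse_outside E0)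
  qed (simp add: K'_def K)
  have end1: "K' (1, z) = i (f' (collapse n z))" for z
  proof (cases "z 0 \<le> 1")
    case False
    then have "1 \<le> enorm n z" using abs_le_enorm[of 0 n z] n by simp
    then show ?thesis using False lam01 f by (simp add: K'_def s0 pmap_collapse_outside E0)
  qed (simp add: K'_def K)
  have ends: "(\<lambda>z. g (k (0, 0, z))) = f \<circ> collapse n" "(\<lambda>z. g (k (0, 1, z))) = f' \<circ> collapse n"
    by (auto simp: k end0 end1 gi ff)
  have "supp_homotopic n 5 F (f \<circ> collapse n) (f' \<circ> collapse n)"
    using side[of 0] top side[of 1] unfolding ends supp_homotopic_def
    by (meson homotopic_with_trans homotopic_with_symD)
  then show ?thesis
    by (intro supp_homotopic_collapse_imp_phomotopic[OF n _ f]) auto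
qed

section \<open>Vanishing Whitehead products\<close>

lemma continuous_map_nsphere:
  assumes "\<And>j. continuous_map Z euclideanreal (\<lambda>x. w x j)"
    and "\<And>x. x \<in> topspace Z \<Longrightarrow> w x \<in> topspace (nsphere n)"
  shows "continuous_map Z (nsphere n) w"
  using assms by (auto simp: nsphere continuous_map_in_subtopology continuous_map_vecs)

lemma continuous_map_corner_rotation:
  "continuous_map (nsphere N) euclideanreal (\<lambda>z. corner_rotation k z j)"
proof -
  have p: "continuous_map (nsphere N) euclideanreal (\<lambda>z. z i)" for i
    by (rule continuous_map_nsphere_projection)
  show ?thesis
    unfolding corner_rotation_def
    by (cases "j = k"; cases "j = 0") (auto intro!: continuous_intros p)
qed

text \<open>
  Dividing by this maximum projects the rotated sphere radially to the boundary of the product of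
  the two unit discs.
\<close>

definition corner_max :: "nat \<Rightarrow> nat \<Rightarrow> (nat \<Rightarrow> real) \<Rightarrow> real" where
  "corner_max k l z = max (enorm k (corner_rotation k z)) (enorm l (\<lambda>j. corner_rotation k z (k + j)))"

lemma corner_max_pos:
  assumes "z \<in> topspace (nsphere (k + l - 1))" "k \<ge> 1" "l \<ge> 1"
  shows "corner_max k l z > 0"
proof (rule ccontr)
  assume "\<not> corner_max k l z > 0"
  then have "enorm k (corner_rotation k z) = 0" "enorm l (\<lambda>j. corner_rotation k z (k + j)) = 0"
    using enorm_nonneg[of k "corner_rotation k z"] enorm_nonneg[of l "\<lambda>j. corner_rotation k z (k + j)"]
    unfolding corner_max_def by linarith+
  then show False using enorm_corner_rotation[OF assms] by simp
qed

lemma continuous_map_corner_max: "continuous_map (nsphere N) euclideanreal (corner_max k l)"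
  unfolding corner_max_def[abs_def]
  by (intro continuous_map_real_max continuous_map_enorm continuous_map_corner_rotation)

lemma whitehead_map_eq_collapse:
  assumes z: "z \<in> topspace (nsphere (k + l - 1))" "k \<ge> 1" "l \<ge> 1"
  shows "whitehead_map k l f g z =
    (if enorm k (corner_rotation k z) \<le> enorm l (\<lambda>j. corner_rotation k z (k + j))
     then f (collapse k (\<lambda>j. corner_rotation k z j / corner_max k l z))
     else g (collapse l (\<lambda>j. corner_rotation k z (k + j) / corner_max k l z)))"
proof -
  let ?a = "enorm k (corner_rotation k z)" and ?b = "enorm l (\<lambda>j. corner_rotation k z (k + j))"
  have pos: "corner_max k l z > 0" by (rule corner_max_pos[OF z])
  show ?thesis
  proof (cases "?a \<le> ?b")
    case True
    then have m: "corner_max k l z = ?b" by (simp add: corner_max_def)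
    then have "enorm k (\<lambda>j. corner_rotation k z j / ?b) \<le> 1"
      using True pos by (subst enorm_divide) auto
    then show ?thesis using True m by (simp add: whitehead_map_def Let_def collapse_inside)
  next
    case False
    then have m: "corner_max k l z = ?a" by (simp add: corner_max_def)
    then have "enorm l (\<lambda>j. corner_rotation k z (k + j) / ?a) \<le> 1"
      using False pos by (subst enorm_divide) auto
    then show ?thesis using False m by (simp add: whitehead_map_def Let_def collapse_inside)
  qed
qed

lemma corner_rotation_base:
  assumes "k \<ge> 1" "l \<ge> 1"
  shows "enorm k (corner_rotation k (snd (psphere N))) = 1 / sqrt 2"
    "enorm l (\<lambda>j. corner_rotation k (snd (psphere N)) (k + j)) = 1 / sqrt 2"
    "corner_max k l (snd (psphere N)) = 1 / sqrt 2"
proof -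
  have 1: "corner_rotation k (snd (psphere N)) = (\<lambda>j. if j = 0 \<or> j = k then 1 / sqrt 2 else 0)"
    using assms by (auto simp: corner_rotation_def psphere_def)
  show "enorm k (corner_rotation k (snd (psphere N))) = 1 / sqrt 2"
    "enorm l (\<lambda>j. corner_rotation k (snd (psphere N)) (k + j)) = 1 / sqrt 2"
    unfolding 1 enorm_def using assms
    by (auto simp: power_divide if_distrib[of "\<lambda>x. x\<^sup>2"] real_sqrt_divide cong: if_cong)
  then show "corner_max k l (snd (psphere N)) = 1 / sqrt 2" by (simp add: corner_max_def)
qed

text \<open>
  The product of two balls of radius \<open>R\<close> is contractible, and on its boundary \<open>\<Gamma>\<close> is the Whitehead
  map up to the dilation by \<open>R\<close>.  The contraction is a straight line to the image of the base point,
  in order to be a pointed homotopy.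
\<close>

lemma whitehead_null_if_extends:
  assumes k: "k \<ge> 1" "l \<ge> 1" and f: "pmap (psphere k) X f" and g: "pmap (psphere l) X g"
    and \<Gamma>: "continuous_map (prod_topology vecs vecs) (fst X) \<Gamma>" and R: "R \<ge> 1"
    and \<Gamma>f: "\<And>x y. R \<le> enorm l y \<Longrightarrow> \<Gamma> (x, y) = f (collapse k x)"
    and \<Gamma>g: "\<And>x y. R \<le> enorm k x \<Longrightarrow> \<Gamma> (x, y) = g (collapse l y)"
  shows "phomotopic (psphere (k + l - 1)) X (whitehead_map k l f g) (\<lambda>_. snd X)"
proof -
  let ?N = "k + l - 1" let ?S = "nsphere ?N"
  let ?Z = "prod_topology unit_interval ?S"
  let ?x = "\<lambda>z j. corner_rotation k z j / corner_max k l z"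
    and ?y = "\<lambda>z j. corner_rotation k z (k + j) / corner_max k l z"
  let ?a = "\<lambda>z. enorm k (corner_rotation k z)" and ?b = "\<lambda>z. enorm l (\<lambda>j. corner_rotation k z (k + j))"
  have cx: "continuous_map ?S vecs ?x" and cy: "continuous_map ?S vecs ?y"
    unfolding continuous_map_vecs using corner_max_pos[OF _ k]
    by (auto intro!: continuous_map_real_divide continuous_map_corner_rotation continuous_map_corner_max
        simp: less_imp_neq[symmetric] dest: less_imp_neq)
  have cx': "continuous_map ?Z vecs (\<lambda>q. ?x (snd q))" and cy': "continuous_map ?Z vecs (\<lambda>q. ?y (snd q))"
    using continuous_map_compose[OF continuous_map_snd cx] continuous_map_compose[OF continuous_map_snd cy]
    by (simp_all add: comp_def)
  have ct: "continuous_map ?Z euclideanreal fst"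
    by (rule continuous_map_fst[THEN continuous_map_into_fulltopology])
  have ca: "continuous_map ?Z euclideanreal (\<lambda>q. ?a (snd q))"
    and cb: "continuous_map ?Z euclideanreal (\<lambda>q. ?b (snd q))"
    by (intro continuous_map_enorm continuous_map_compose[OF continuous_map_snd, unfolded comp_def]
       continuous_map_corner_rotation)+
  have ex: "enorm k (?x z) = 1" if "z \<in> topspace ?S" "?b z \<le> ?a z" for z
    using corner_max_pos[OF that(1) k] that(2) by (subst enorm_divide) (auto simp: corner_max_def max_def)
  have ey: "enorm l (?y z) = 1" if "z \<in> topspace ?S" "?a z \<le> ?b z" for z
    using corner_max_pos[OF that(1) k] that(2) by (subst enorm_divide) (auto simp: corner_max_def max_def)
  have big: "1 \<le> \<bar>1 + t * (R - 1)\<bar>" if "t \<in> {0..1}" for t using that R by simp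
  define W1 where "W1 = (\<lambda>(t, z). if ?a z \<le> ?b z
      then f (collapse k (\<lambda>j. (1 + t * (R - 1)) * ?x z j))
      else g (collapse l (\<lambda>j. (1 + t * (R - 1)) * ?y z j)))"
  have W1: "phomotopic (psphere ?N) X (whitehead_map k l f g) (\<lambda>z. W1 (1, z))"
  proof (rule phomotopicI[where h = W1])
    have "continuous_map ?Z (fst X) (\<lambda>q. if ?a (snd q) \<le> ?b (snd q)
       then f (collapse k (\<lambda>j. (1 + fst q * (R - 1)) * ?x (snd q) j))
       else g (collapse l (\<lambda>j. (1 + fst q * (R - 1)) * ?y (snd q) j)))"
    proof (rule continuous_map_cases_le[OF ca cb])
      show "f (collapse k (\<lambda>j. (1 + fst q * (R - 1)) * ?x (snd q) j)) =
         g (collapse l (\<lambda>j. (1 + fst q * (R - 1)) * ?y (snd q) j))"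
        if "q \<in> topspace ?Z" "?a (snd q) = ?b (snd q)" for q
      proof -
        have q: "snd q \<in> topspace ?S" "1 \<le> \<bar>1 + fst q * (R - 1)\<bar>" using that big[of "fst q"] by auto
        have "1 \<le> enorm k (\<lambda>j. (1 + fst q * (R - 1)) * ?x (snd q) j)"
          "1 \<le> enorm l (\<lambda>j. (1 + fst q * (R - 1)) * ?y (snd q) j)"
          unfolding enorm_mult using ex[OF q(1)] ey[OF q(1)] q(2) that(2) by simp_all
        then show ?thesis
          by (simp only: pmap_collapse_outside[OF f] pmap_collapse_outside[OF g])
      qed
    qed (intro continuous_map_from_subtopology continuous_map_pmap_collapse[OF f]
         continuous_map_pmap_collapse[OF g] continuous_map_scale_vecs cx' cy' ct continuous_intros)+
    then show "continuous_map (prod_topology unit_interval (fst (psphere ?N))) (fst X) W1"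
      by (simp add: W1_def case_prod_unfold)
    show "W1 (0, z) = whitehead_map k l f g z" if "z \<in> topspace (fst (psphere ?N))" for z
      using whitehead_map_eq_collapse[OF _ k, of z f g] that by (simp add: W1_def)
    show "W1 (t, snd (psphere ?N)) = snd X" if t: "t \<in> {0..1}" for t
      using ex[OF psphere_base[of ?N, unfolded fst_psphere]] f big[OF t]
      unfolding W1_def by (simp add: corner_rotation_base[OF k] pmap_collapse_outside enorm_mult)
  qed (auto simp: psphere_base[simplified])
  have W1R: "W1 (1, z) = \<Gamma> (\<lambda>j. R * ?x z j, \<lambda>j. R * ?y z j)" if "z \<in> topspace ?S" for z
  proof (cases "?a z \<le> ?b z")
    case True
    then have "R \<le> enorm l (\<lambda>j. R * ?y z j)" unfolding enorm_mult using ey[OF that] R by simp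
    from \<Gamma>f[OF this] show ?thesis using True by (simp add: W1_def)
  next
    case False
    then have "R \<le> enorm k (\<lambda>j. R * ?x z j)" unfolding enorm_mult using ex[OF that] R by simp
    from \<Gamma>g[OF this] show ?thesis using False by (simp add: W1_def)
  qed
  let ?e = "snd (psphere ?N)"
  let ?v = "\<lambda>t a b j. (1 - t) * (R * a j) + t * (R * b j)"
  have "phomotopic (psphere ?N) X (\<lambda>z. W1 (1, z)) (\<lambda>_. snd X)"
  proof (rule phomotopicI[where h = "\<lambda>(t, z). \<Gamma> (?v t (?x z) (?x ?e), ?v t (?y z) (?y ?e))"])
    have e0: "\<Gamma> (\<lambda>j. R * ?x ?e j, \<lambda>j. R * ?y ?e j) = snd X"
      using W1R[OF psphere_base[of ?N, unfolded fst_psphere]] phomotopic_imp_pmap[OF W1] by (simp add: pmap_def)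
    have "continuous_map ?Z (prod_topology vecs vecs)
       (\<lambda>q. (?v (fst q) (?x (snd q)) (?x ?e), ?v (fst q) (?y (snd q)) (?y ?e)))"
      by (intro continuous_map_pairedI; unfold continuous_map_vecs; intro allI continuous_intros ct
          continuous_map_vecs_proj[OF cx'] continuous_map_vecs_proj[OF cy'])
    from continuous_map_compose[OF this \<Gamma>]
    show "continuous_map (prod_topology unit_interval (fst (psphere ?N))) (fst X)
        (\<lambda>(t, z). \<Gamma> (?v t (?x z) (?x ?e), ?v t (?y z) (?y ?e)))"
      by (simp add: comp_def case_prod_unfold)
    show "(case (0, z) of (t, z) \<Rightarrow> \<Gamma> (?v t (?x z) (?x ?e), ?v t (?y z) (?y ?e))) = W1 (1, z)"
      if "z \<in> topspace (fst (psphere ?N))" for z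
      using that W1R by simp
    show "(case (1, z) of (t, z) \<Rightarrow> \<Gamma> (?v t (?x z) (?x ?e), ?v t (?y z) (?y ?e))) = snd X" for z
      using e0 by simp
    have v: "?v t a a = (\<lambda>j. R * a j)" for t and a :: "nat \<Rightarrow> real"
      by (simp add: algebra_simps)
    show "(case (t, ?e) of (t, z) \<Rightarrow> \<Gamma> (?v t (?x z) (?x ?e), ?v t (?y z) (?y ?e))) = snd X" for t
      unfolding prod.case v by (rule e0)
  qed (rule psphere_base)
  with W1 show ?thesis by (rule phomotopic_trans)
qed

text \<open>
  The vector \<open>z\<close> is the inverse rotation of \<open>(x, y) / q\<close>.
\<close>

lemma polydisc_to_sphere:
  assumes k: "k \<ge> 1" "l \<ge> 1"
    and q: "q > 0" "q\<^sup>2 = (enorm k x)\<^sup>2 + (enorm l y)\<^sup>2"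
  defines "w \<equiv> \<lambda>i. if i < k then x i / q else if i < k + l then y (i - k) / q else 0"
  defines "z \<equiv> w(0 := (w 0 + w k) / sqrt 2, k := (w k - w 0) / sqrt 2)"
  shows "z \<in> topspace (nsphere (k + l - 1))"
    "enorm k (corner_rotation k z) = enorm k x / q"
    "enorm l (\<lambda>j. corner_rotation k z (k + j)) = enorm l y / q"
    "\<And>j. j < k \<Longrightarrow> corner_rotation k z j = x j / q"
    "\<And>j. j < l \<Longrightarrow> corner_rotation k z (k + j) = y j / q"
proof -
  have z0: "z 0 - z k = sqrt 2 * w 0" "z 0 + z k = sqrt 2 * w k"
    using k by (simp_all add: z_def field_simps)
  have rot: "corner_rotation k z = w"
  proof
    fix j show "corner_rotation k z j = w j"
      using z0 k unfolding corner_rotation_def by (auto simp: z_def)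
  qed
  show c1: "corner_rotation k z j = x j / q" if "j < k" for j
    using that by (simp add: rot w_def)
  show c2: "corner_rotation k z (k + j) = y j / q" if "j < l" for j
    using that by (simp add: rot w_def)
  have "enorm k (corner_rotation k z) = enorm k (\<lambda>j. x j / q)"
    using c1 by (simp add: enorm_def)
  then show "enorm k (corner_rotation k z) = enorm k x / q"
    using q by (simp add: enorm_divide)
  have "enorm l (\<lambda>j. corner_rotation k z (k + j)) = enorm l (\<lambda>j. y j / q)"
    using c2 by (simp add: enorm_def)
  then show "enorm l (\<lambda>j. corner_rotation k z (k + j)) = enorm l y / q"
    using q by (simp add: enorm_divide)
  have split: "(\<Sum>i<k + l. g i) = (\<Sum>i<k. g i) + (\<Sum>j<l. g (k + j))" for g :: "nat \<Rightarrow> real"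
    by (induction l) (simp_all add: add.assoc)
  have S: "(\<Sum>i<k + l. g i) = g 0 + g k + (\<Sum>i\<in>{..<k + l} - {0, k}. g i)" for g :: "nat \<Rightarrow> real"
    using k by (subst sum.subset_diff[of "{0, k}"]) auto
  have "(z 0)\<^sup>2 + (z k)\<^sup>2 = (w 0)\<^sup>2 + (w k)\<^sup>2"
    using k by (simp add: z_def power_divide) (simp add: power2_eq_square field_simps)
  then have "(\<Sum>i<k + l. (z i)\<^sup>2) = (\<Sum>i<k + l. (w i)\<^sup>2)"
    unfolding S[of "\<lambda>i. (z i)\<^sup>2"] S[of "\<lambda>i. (w i)\<^sup>2"] by (simp add: z_def)
  also have "\<dots> = ((enorm k x)\<^sup>2 + (enorm l y)\<^sup>2) / q\<^sup>2"
    unfolding split enorm_sq by (simp add: w_def power_divide add_divide_distrib flip: sum_divide_distrib)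
  also have "\<dots> = 1" unfolding q(2)[symmetric] using q(1) by simp
  finally have "(\<Sum>i<k + l. (z i)\<^sup>2) = 1" .
  moreover have "{..k + l - 1} = {..<k + l}" using k by auto
  ultimately have "(\<Sum>i\<le>k + l - 1. (z i)\<^sup>2) = 1" by simp
  moreover have "\<forall>i>k + l - 1. z i = 0"
  proof (intro allI impI)
    fix i assume "i > k + l - 1"
    then have "i \<noteq> 0" "i \<noteq> k" "\<not> i < k" "\<not> i < k + l" using k by linarith+
    then show "z i = 0" by (simp add: z_def w_def)
  qed
  ultimately show "z \<in> topspace (nsphere (k + l - 1))"
    unfolding nsphere by simp
qed

lemma collapse_cong:
  assumes "\<And>j. j < n \<Longrightarrow> z j = z' j"
  shows "collapse n z = collapse n z'"
proof -
  have "enorm n z = enorm n z'" using assms by (simp add: enorm_def)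
  moreover have "enorm n (\<lambda>j. z j / c) = enorm n (\<lambda>j. z' j / c)" for c
    using assms by (simp add: enorm_def)
  ultimately show ?thesis
    using assms by (auto simp: collapse_def disc_collapse_def)
qed

text \<open>
  The null homotopy fills the product of the discs along the rays from the centre, its time being
  determined by \<open>max |x| |y|\<close>.  It is finished at \<open>max |x| |y| = 1/2\<close>, so that nothing has to be
  checked at the centre.
\<close>

lemma extends_if_whitehead_null:
  assumes k: "k \<ge> 1" "l \<ge> 1" and f: "pmap (psphere k) X f" and g: "pmap (psphere l) X g"
    and X: "snd X \<in> topspace (fst X)"
    and null: "phomotopic (psphere (k + l - 1)) X (whitehead_map k l f g) (\<lambda>_. snd X)"
  obtains M where "continuous_map (prod_topology vecs vecs) (fst X) M"
    and "\<And>x y. enorm k x \<le> 1 \<Longrightarrow> enorm l y = 1 \<Longrightarrow> M (x, y) = f (collapse k x)"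
    and "\<And>x y. enorm k x = 1 \<Longrightarrow> enorm l y \<le> 1 \<Longrightarrow> M (x, y) = g (collapse l y)"
proof -
  obtain h where h: "continuous_map (prod_topology unit_interval (nsphere (k + l - 1))) (fst X) h"
    "\<And>z. h (0, z) = whitehead_map k l f g z" "\<And>z. h (1, z) = snd X"
    using null unfolding phomotopic_def homotopic_with_def by auto
  define m where "m = (\<lambda>u. max (enorm k (fst u)) (enorm l (snd u)))"
  define q where "q = (\<lambda>u. sqrt ((enorm k (fst u))\<^sup>2 + (enorm l (snd u))\<^sup>2))"
  define w where "w = (\<lambda>u i. if i < k then fst u i / q u
      else if i < k + l then snd u (i - k) / q u else 0)"
  define z where "z = (\<lambda>u. (w u)(0 := (w u 0 + w u k) / sqrt 2, k := (w u k - w u 0) / sqrt 2))"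
  define M where "M = (\<lambda>u. if m u \<le> 1/2 then snd X else h (max 0 (min 1 (2 - 2 * m u)), z u))"
  let ?Z = "prod_topology vecs vecs"
  have e1: "continuous_map ?Z euclideanreal (\<lambda>u. enorm k (fst u))"
    and e2: "continuous_map ?Z euclideanreal (\<lambda>u. enorm l (snd u))"
    by (intro continuous_map_enorm continuous_map_vecs_proj continuous_map_fst continuous_map_snd)+
  have m: "continuous_map ?Z euclideanreal m"
    unfolding m_def by (intro continuous_map_real_max e1 e2)
  have qc: "continuous_map ?Z euclideanreal q"
    unfolding q_def by (intro continuous_intros e1 e2)
  have qpos: "q u > 0" if "m u \<ge> 1/2" for u
  proof -
    have "enorm k (fst u) > 0 \<or> enorm l (snd u) > 0"
      using that by (auto simp: m_def max_def split: if_splits)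
    then show ?thesis by (auto simp: q_def intro: add_pos_nonneg add_nonneg_pos)
  qed
  have q2: "(q u)\<^sup>2 = (enorm k (fst u))\<^sup>2 + (enorm l (snd u))\<^sup>2" for u
    by (simp add: q_def)
  have zw: "z u = (let w = \<lambda>i. if i < k then fst u i / q u else if i < k + l then snd u (i - k) / q u else 0
       in w(0 := (w 0 + w k) / sqrt 2, k := (w k - w 0) / sqrt 2))" for u
    by (simp only: z_def w_def Let_def)
  note zs = polydisc_to_sphere[OF k qpos q2, folded zw[unfolded Let_def]]
  let ?Z1 = "subtopology ?Z {u \<in> topspace ?Z. 1/2 \<le> m u}"
  have "continuous_map ?Z1 euclideanreal (\<lambda>u. w u j)" for j
  proof -
    have "continuous_map ?Z1 euclideanreal (\<lambda>u. fst u j / q u)"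
      "continuous_map ?Z1 euclideanreal (\<lambda>u. snd u (j - k) / q u)"
      using qpos
      by (intro continuous_map_real_divide continuous_map_from_subtopology[of ?Z] qc
        continuous_map_vecs_proj[OF continuous_map_fst] continuous_map_vecs_proj[OF continuous_map_snd];
        simp add: less_imp_neq[symmetric])+
    then show ?thesis
      by (cases "j < k"; cases "j < k + l") (auto simp: w_def)
  qed note wc = this
  have zc: "continuous_map ?Z1 euclideanreal (\<lambda>u. z u j)" for j
  proof -
    have "(\<lambda>u. z u j) = (if j = k then (\<lambda>u. (w u k - w u 0) / sqrt 2)
      else if j = 0 then (\<lambda>u. (w u 0 + w u k) / sqrt 2) else (\<lambda>u. w u j))"
      by (auto simp: z_def)
    moreover have "continuous_map ?Z1 euclideanreal (\<lambda>u. (w u k - w u 0) / sqrt 2)"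
      "continuous_map ?Z1 euclideanreal (\<lambda>u. (w u 0 + w u k) / sqrt 2)"
      by (intro continuous_intros wc; simp)+
    ultimately show ?thesis using wc[of j] by (simp only: split: if_split) blast
  qed
  have "continuous_map ?Z (fst X) M"
    unfolding M_def
  proof (rule continuous_map_cases_le[OF m])
    show "continuous_map ?Z1 (fst X) (\<lambda>u. h (max 0 (min 1 (2 - 2 * m u)), z u))"
    proof (rule continuous_map_homotopy_at[OF h(1)])
      show "continuous_map ?Z1 (nsphere (k + l - 1)) z"
        using zs(1) by (intro continuous_map_nsphere zc) auto
    qed (auto intro!: continuous_intros continuous_map_from_subtopology m)
  qed (auto simp: X h)
  moreover have "M (x, y) = f (collapse k x)" if xy: "enorm k x \<le> 1" "enorm l y = 1" for x y
  proof -
    have m1: "m (x, y) = 1" using xy by (simp add: m_def)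
    note Z = zs[of "(x, y)", unfolded m1]
    have q: "q (x, y) > 0" using qpos[of "(x, y)"] m1 by simp
    have cm: "corner_max k l (z (x, y)) = 1 / q (x, y)"
      unfolding corner_max_def using Z(2,3) xy q by (simp add: max_def divide_right_mono)
    have "M (x, y) = whitehead_map k l f g (z (x, y))" using m1 by (simp add: M_def h)
    also have "\<dots> = f (collapse k (\<lambda>j. corner_rotation k (z (x, y)) j / corner_max k l (z (x, y))))"
      using whitehead_map_eq_collapse[OF Z(1) k, of f g] Z(2,3) xy q by (simp add: divide_right_mono)
    also have "\<dots> = f (collapse k x)"
      using Z(4) q by (intro arg_cong[where f = f] collapse_cong) (simp add: cm)
    finally show ?thesis .
  qed
  moreover have "M (x, y) = g (collapse l y)" if xy: "enorm k x = 1" "enorm l y \<le> 1" for x y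
  proof (cases "enorm l y = 1")
    case True
    then have "M (x, y) = f (collapse k x)" using calculation(2) xy by simp
    then show ?thesis using True xy f g by (simp add: pmap_collapse_outside)
  next
    case False
    have m1: "m (x, y) = 1" using xy by (simp add: m_def)
    note Z = zs[of "(x, y)", unfolded m1]
    have q: "q (x, y) > 0" using qpos[of "(x, y)"] m1 by simp
    have cm: "corner_max k l (z (x, y)) = 1 / q (x, y)"
      unfolding corner_max_def using Z(2,3) xy divide_right_mono[OF xy(2) less_imp_le[OF q]]
      by (simp add: max_absorb1)
    have nle: "\<not> enorm k x / q (x, y) \<le> enorm l y / q (x, y)"
    proof
      assume "enorm k x / q (x, y) \<le> enorm l y / q (x, y)"
      then have "enorm k x \<le> enorm l y" using q by (simp add: divide_le_cancel)
      then show False using xy False by simp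
    qed
    have "M (x, y) = whitehead_map k l f g (z (x, y))" using m1 by (simp add: M_def h)
    also have "\<dots> = g (collapse l (\<lambda>j. corner_rotation k (z (x, y)) (k + j) / corner_max k l (z (x, y))))"
      using whitehead_map_eq_collapse[OF Z(1) k, of f g] Z(2,3) nle by simp
    also have "\<dots> = g (collapse l y)"
      using Z(5) q by (intro arg_cong[where f = g] collapse_cong) (simp add: cm)
    finally show ?thesis .
  qed
  ultimately show ?thesis by (rule that)
qed

text \<open>
  Passing to the quotient turns the filled product of discs into a product of spheres, whose axes
  are the images of the two parts of the boundary.
\<close>

lemma axes_extend_if_whitehead_null:
  assumes k: "k \<ge> 1" "l \<ge> 1" and f: "pmap (psphere k) X f" and g: "pmap (psphere l) X g"
    and X: "snd X \<in> topspace (fst X)"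
    and null: "phomotopic (psphere (k + l - 1)) X (whitehead_map k l f g) (\<lambda>_. snd X)"
  obtains H where "continuous_map (prod_topology (nsphere k) (nsphere l)) (fst X) H"
    and "\<And>x. x \<in> topspace (nsphere k) \<Longrightarrow> H (x, snd (psphere l)) = f x"
    and "\<And>y. y \<in> topspace (nsphere l) \<Longrightarrow> H (snd (psphere k), y) = g y"
proof -
  obtain M where M: "continuous_map (prod_topology vecs vecs) (fst X) M"
    and Mf: "\<And>x y. enorm k x \<le> 1 \<Longrightarrow> enorm l y = 1 \<Longrightarrow> M (x, y) = f (collapse k x)"
    and Mg: "\<And>x y. enorm k x = 1 \<Longrightarrow> enorm l y \<le> 1 \<Longrightarrow> M (x, y) = g (collapse l y)"
    using extends_if_whitehead_null[OF assms] by blast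
  let ?D = "prod_topology (disc k) (disc l)" and ?S = "prod_topology (nsphere k) (nsphere l)"
  let ?q = "\<lambda>(x, y). (collapse k x, collapse l y)"
  have q: "quotient_map ?D ?S ?q"
  proof (rule continuous_imp_quotient_map)
    show "continuous_map ?D ?S ?q"
      unfolding case_prod_unfold
      by (intro continuous_map_pairedI continuous_map_collapse)
        (auto intro: continuous_map_compose[OF continuous_map_fst continuous_map_disc_proj, unfolded comp_def]
           continuous_map_compose[OF continuous_map_snd continuous_map_disc_proj, unfolded comp_def])
    show "?q ` topspace ?D = topspace ?S"
      unfolding topspace_prod_topology collapse_surj[OF k(1), symmetric] collapse_surj[OF k(2), symmetric]
      by auto
  qed (simp_all add: compact_space_prod_topology compact_space_disc Hausdorff_space_prod_topology
      Hausdorff_nsphere)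
  have "continuous_map ?D (prod_topology vecs vecs) (\<lambda>u. (fst u, snd u))"
    by (intro continuous_map_pairedI)
      (auto intro: continuous_map_compose[OF continuous_map_fst continuous_map_disc_vecs, unfolded comp_def]
         continuous_map_compose[OF continuous_map_snd continuous_map_disc_vecs, unfolded comp_def])
  from continuous_map_compose[OF this M] have MD: "continuous_map ?D (fst X) M"
    by (simp add: comp_def)
  have fib: "M u = M v" if u: "u \<in> topspace ?D" and v: "v \<in> topspace ?D" and uv: "?q u = ?q v" for u v
  proof -
    obtain x y x' y' where [simp]: "u = (x, y)" "v = (x', y')" by (cases u, cases v) auto
    have d: "x \<in> topspace (disc k)" "x' \<in> topspace (disc k)" "y \<in> topspace (disc l)" "y' \<in> topspace (disc l)"
      and c: "collapse k x = collapse k x'" "collapse l y = collapse l y'" using u v uv by auto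
    have le: "enorm k x \<le> 1" "enorm k x' \<le> 1" "enorm l y \<le> 1" "enorm l y' \<le> 1"
      using d by (auto simp: topspace_disc)
    consider "x = x'" "y = y'" | "enorm k x = 1" "enorm k x' = 1" | "enorm l y = 1" "enorm l y' = 1"
      using collapse_eq_iff[OF d(1,2) c(1)] collapse_eq_iff[OF d(3,4) c(2)] by blast
    then show ?thesis
      by cases (simp_all add: Mf Mg le c)
  qed
  obtain H where H: "continuous_map ?S (fst X) H" "\<And>u. u \<in> topspace ?D \<Longrightarrow> H (?q u) = M u"
    by (rule quotient_map_lift_exists[OF q MD fib]) (assumption+, blast)
  have H': "H (collapse k x, collapse l y) = M (x, y)"
    if "x \<in> topspace (disc k)" "y \<in> topspace (disc l)" for x y
    using H(2)[of "(x, y)"] that by simp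
  obtain e where e: "e \<in> topspace (disc k)" "enorm k e = 1"
    by (rule disc_boundary_point[OF k(1)])
  obtain e' where e': "e' \<in> topspace (disc l)" "enorm l e' = 1"
    by (rule disc_boundary_point[OF k(2)])
  show ?thesis
  proof (rule that[OF H(1)])
    fix x assume "x \<in> topspace (nsphere k)"
    then obtain u where "u \<in> topspace (disc k)" "x = collapse k u"
      unfolding collapse_surj[OF k(1), symmetric] by blast
    then show "H (x, snd (psphere l)) = f x"
      using H'[of u e'] Mf[of u e'] e' by (auto simp: topspace_disc collapse_outside)
  next
    fix y assume "y \<in> topspace (nsphere l)"
    then obtain u where "u \<in> topspace (disc l)" "y = collapse l u"
      unfolding collapse_surj[OF k(2), symmetric] by blast
    then show "H (snd (psphere k), y) = g y"
      using H'[of e u] Mg[of e u] e by (auto simp: topspace_disc collapse_outside)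
  qed
qed

section \<open>Families of loops\<close>

lemma topspace_loop_space:
  "topspace (fst (loop_space X)) =
    {\<gamma> \<in> mapping_set unit_interval (fst X). \<gamma> 0 = snd X \<and> \<gamma> 1 = snd X}"
  by (auto simp: loop_space_def topspace_compact_open)

lemma snd_loop_space: "snd (loop_space X) = restrict (\<lambda>_. snd X) {0..1}"
  by (simp add: loop_space_def)

lemma loop_space_base:
  "snd X \<in> topspace (fst X) \<Longrightarrow> snd (loop_space X) \<in> topspace (fst (loop_space X))"
  by (auto simp: topspace_loop_space snd_loop_space mapping_set_def intro: continuous_map_eq[of _ _ "\<lambda>_. snd X"])

lemma loop_in_space:
  "\<gamma> \<in> topspace (fst (loop_space X)) \<Longrightarrow> t \<in> {0..1} \<Longrightarrow> \<gamma> t \<in> topspace (fst X)"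
  by (auto simp: topspace_loop_space mapping_set_def continuous_map_def)

lemma loop_ends:
  "\<gamma> \<in> topspace (fst (loop_space X)) \<Longrightarrow> \<gamma> 0 = snd X" "\<gamma> \<in> topspace (fst (loop_space X)) \<Longrightarrow> \<gamma> 1 = snd X"
  by (auto simp: topspace_loop_space)

lemma continuous_map_loop_eval:
  assumes \<gamma>: "continuous_map Z (fst (loop_space X)) \<gamma>" and t: "continuous_map Z euclideanreal t"
    "\<And>z. z \<in> topspace Z \<Longrightarrow> t z \<in> {0..1}"
  shows "continuous_map Z (fst X) (\<lambda>z. \<gamma> z (t z))"
proof -
  have "continuous_map Z (compact_open_topology unit_interval (fst X)) \<gamma>"
    using \<gamma> by (simp add: loop_space_def continuous_map_in_subtopology)
  from continuous_map_homotopy_at[OF continuous_map_eval_unit_interval t this] show ?thesis by simp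
qed

lemma continuous_map_into_loop_space:
  assumes h: "continuous_map (prod_topology unit_interval Z) (fst X) h"
    and ends: "\<And>z. z \<in> topspace Z \<Longrightarrow> h (0, z) = snd X" "\<And>z. z \<in> topspace Z \<Longrightarrow> h (1, z) = snd X"
  shows "continuous_map Z (fst (loop_space X)) (\<lambda>z. restrict (\<lambda>t. h (t, z)) {0..1})"
  using continuous_map_curry_unit_interval[OF h] ends
  by (auto simp: loop_space_def continuous_map_in_subtopology)

lemma continuous_map_fst_real:
  "continuous_map (prod_topology unit_interval Z) euclideanreal fst"
  by (rule continuous_map_fst[THEN continuous_map_into_fulltopology])

lemma loop_concat_eq:
  "t \<in> {0..1} \<Longrightarrow> loop_concat \<gamma> \<delta> t = (if t \<le> 1/2 then \<gamma> (2 * t) else \<delta> (2 * t - 1))"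
  by (simp add: loop_concat_def)

lemma continuous_map_loop_concat:
  assumes \<gamma>: "continuous_map Z (fst (loop_space X)) \<gamma>" and \<delta>: "continuous_map Z (fst (loop_space X)) \<delta>"
  shows "continuous_map Z (fst (loop_space X)) (\<lambda>z. loop_concat (\<gamma> z) (\<delta> z))"
proof -
  let ?I = "prod_topology unit_interval Z"
  have g: "\<gamma> z \<in> topspace (fst (loop_space X))" "\<delta> z \<in> topspace (fst (loop_space X))" if "z \<in> topspace Z" for z
    using \<gamma> \<delta> that by (auto simp: continuous_map_def)
  have \<gamma>': "continuous_map ?I (fst (loop_space X)) (\<lambda>x. \<gamma> (snd x))"
    and \<delta>': "continuous_map ?I (fst (loop_space X)) (\<lambda>x. \<delta> (snd x))"
    using continuous_map_compose[OF continuous_map_snd \<gamma>] continuous_map_compose[OF continuous_map_snd \<delta>]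
    by (simp_all add: comp_def)
  have "continuous_map ?I (fst X)
     (\<lambda>x. if fst x \<le> 1/2 then \<gamma> (snd x) (2 * fst x) else \<delta> (snd x) (2 * fst x - 1))"
  proof (rule continuous_map_cases_le[OF continuous_map_fst_real])
    show "continuous_map (subtopology ?I {x \<in> topspace ?I. fst x \<le> 1/2}) (fst X) (\<lambda>x. \<gamma> (snd x) (2 * fst x))"
      by (rule continuous_map_loop_eval[OF continuous_map_from_subtopology[OF \<gamma>']])
        (auto intro!: continuous_map_from_subtopology continuous_intros continuous_map_fst_real)
    show "continuous_map (subtopology ?I {x \<in> topspace ?I. 1/2 \<le> fst x}) (fst X) (\<lambda>x. \<delta> (snd x) (2 * fst x - 1))"
      by (rule continuous_map_loop_eval[OF continuous_map_from_subtopology[OF \<delta>']])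
        (auto intro!: continuous_map_from_subtopology continuous_intros continuous_map_fst_real)
    show "\<gamma> (snd x) (2 * fst x) = \<delta> (snd x) (2 * fst x - 1)"
      if "x \<in> topspace ?I" "fst x = 1/2" for x
    proof -
      have "snd x \<in> topspace Z" using that(1) by auto
      moreover have "2 * fst x = 1" using that(2) by simp
      ultimately show ?thesis using g[of "snd x"] by (metis loop_ends diff_self)
    qed
  qed auto
  from continuous_map_into_loop_space[OF this] g
  have "continuous_map Z (fst (loop_space X))
     (\<lambda>z. restrict (\<lambda>t. if t \<le> 1/2 then \<gamma> z (2 * t) else \<delta> z (2 * t - 1)) {0..1})"
    by (simp add: loop_ends cong: if_cong)
  then show ?thesis by (simp add: loop_concat_def)
qed

section \<open>From an extension over the product to an H-splitting\<close>

text \<open>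
  Both sides of the H-map condition have the form \<open>t \<mapsto> H (b b' (\<rho> t), f f' (\<sigma> t))\<close> with
  \<open>\<rho>\<close> and \<open>\<sigma>\<close> from \<open>0\<close> to \<open>1\<close>: on one side \<open>\<rho>\<close> runs during the first half and \<open>\<sigma>\<close> during
  the second half, on the other side they take turns, each moving by \<open>1/2\<close> in a quarter of the time.
  The homotopy interpolates between these reparametrisations.
\<close>

lemma H_splitting_if_axes_extend:
  fixes E :: "'e pointed"
  assumes H: "continuous_map (prod_topology (fst B) (fst F)) (fst E) H"
    and Hs: "\<And>b. b \<in> topspace (fst B) \<Longrightarrow> H (b, snd F) = s b"
    and Hi: "\<And>f. f \<in> topspace (fst F) \<Longrightarrow> H (snd B, f) = i f"
    and B0: "snd B \<in> topspace (fst B)" and F0: "snd F \<in> topspace (fst F)" and s: "s (snd B) = snd E"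
  shows "H_splitting F E B i s"
proof -
  let ?LB = "fst (loop_space B)" and ?LF = "fst (loop_space F)" and ?LE = "fst (loop_space E)"
  let ?P = "prod_topology ?LB ?LF"
  let ?Q = "prod_topology ?P ?P"
  have H0: "H (snd B, snd F) = snd E" using Hs B0 s by simp
  have family: "continuous_map Z ?LE (\<lambda>z. restrict (\<lambda>t. H (b z (\<rho> (t, z)), f z (\<sigma> (t, z)))) {0..1})"
    if b: "continuous_map Z ?LB b" and f: "continuous_map Z ?LF f"
      and c: "continuous_map (prod_topology unit_interval Z) euclideanreal \<rho>"
      "continuous_map (prod_topology unit_interval Z) euclideanreal \<sigma>"
      and r: "\<And>x. x \<in> topspace (prod_topology unit_interval Z) \<Longrightarrow> \<rho> x \<in> {0..1} \<and> \<sigma> x \<in> {0..1}"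
      and e: "\<And>z. z \<in> topspace Z \<Longrightarrow> \<rho> (0, z) = 0 \<and> \<sigma> (0, z) = 0 \<and> \<rho> (1, z) = 1 \<and> \<sigma> (1, z) = 1"
    for Z :: "'z topology" and b f \<rho> \<sigma>
  proof -
    have "continuous_map (prod_topology unit_interval Z) (fst B) (\<lambda>x. b (snd x) (\<rho> x))"
      "continuous_map (prod_topology unit_interval Z) (fst F) (\<lambda>x. f (snd x) (\<sigma> x))"
      using continuous_map_loop_eval[OF continuous_map_compose[OF continuous_map_snd b] c(1)]
        continuous_map_loop_eval[OF continuous_map_compose[OF continuous_map_snd f] c(2)] r
      by (simp_all add: comp_def)
    then have "continuous_map (prod_topology unit_interval Z) (fst E)
      (\<lambda>x. H (b (snd x) (\<rho> x), f (snd x) (\<sigma> x)))"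
      using continuous_map_compose[OF continuous_map_pairedI H] by (simp add: comp_def)
    moreover have "b z 0 = snd B" "b z 1 = snd B" "f z 0 = snd F" "f z 1 = snd F"
      if "z \<in> topspace Z" for z
    proof -
      have "b z \<in> topspace ?LB" "f z \<in> topspace ?LF"
        using b f that by (auto simp: continuous_map_def)
      then show "b z 0 = snd B" "b z 1 = snd B" "f z 0 = snd F" "f z 1 = snd F"
        by (simp_all add: loop_ends)
    qed
    ultimately show ?thesis
      using continuous_map_into_loop_space[of Z E "\<lambda>x. H (b (snd x) (\<rho> x), f (snd x) (\<sigma> x))"] e
      by (simp add: H0)
  qed
  have phi: "phi_map s i (b, f) = restrict (\<lambda>t. H (b (min (2 * t) 1), f (max (2 * t - 1) 0))) {0..1}"
    if b: "b \<in> topspace ?LB" and f: "f \<in> topspace ?LF" for b f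
  proof
    fix t
    show "phi_map s i (b, f) t = restrict (\<lambda>t. H (b (min (2 * t) 1), f (max (2 * t - 1) 0))) {0..1} t"
    proof (cases "t \<in> {0..1}")
      case t: True
      show ?thesis
      proof (cases "t \<le> 1/2")
        case True
        then show ?thesis
          using t Hs[OF loop_in_space[OF b, of "2 * t"]] loop_ends[OF f]
          by (simp add: phi_map_def loop_concat_eq loop_map_def)
      next
        case False
        then show ?thesis
          using t Hi[OF loop_in_space[OF f, of "2 * t - 1"]] loop_ends[OF b]
          by (simp add: phi_map_def loop_concat_eq loop_map_def)
      qed
    qed (auto simp: phi_map_def loop_concat_def)
  qed
  have phic: "continuous_map ?P ?LE (phi_map s i)"
  proof (rule continuous_map_eq[OF family[OF continuous_map_fst continuous_map_snd]])
    show "continuous_map (prod_topology unit_interval ?P) euclideanreal (\<lambda>x. min (2 * fst x) 1)"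
      "continuous_map (prod_topology unit_interval ?P) euclideanreal (\<lambda>x. max (2 * fst x - 1) 0)"
      by (intro continuous_intros continuous_map_fst_real)+
  qed (auto simp: phi)
  have LB0: "snd (loop_space B) \<in> topspace ?LB" and LF0: "snd (loop_space F) \<in> topspace ?LF"
    by (intro loop_space_base B0 F0)+
  have phi0: "phi_map s i (snd (loop_space B), snd (loop_space F)) = snd (loop_space E)"
    unfolding phi[OF LB0 LF0] by (auto simp: snd_loop_space H0 fun_eq_iff)
  let ?L = "loop_space"
  let ?X = "pprod (?L B) (?L F)"
  let ?bb = "\<lambda>x. loop_concat (fst (fst x)) (fst (snd x))" and ?ff = "\<lambda>x. loop_concat (snd (fst x)) (snd (snd x))"
  define \<rho> where "\<rho> = (\<lambda>\<tau> t::real. (1 - \<tau>) * min (2 * t) 1 +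
      \<tau> * (min (2 * t) (1/2) + max 0 (min (1/2) (2 * t - 1))))"
  define \<sigma> where "\<sigma> = (\<lambda>\<tau> t::real. (1 - \<tau>) * max (2 * t - 1) 0 +
      \<tau> * (max 0 (min (1/2) (2 * t - 1/2)) + max 0 (min (1/2) (2 * t - 3/2))))"
  have bb: "continuous_map ?Q ?LB ?bb" and ff: "continuous_map ?Q ?LF ?ff"
    by (intro continuous_map_loop_concat continuous_map_compose[OF continuous_map_fst continuous_map_fst, unfolded comp_def]
       continuous_map_compose[OF continuous_map_snd continuous_map_fst, unfolded comp_def]
       continuous_map_compose[OF continuous_map_fst continuous_map_snd, unfolded comp_def]
       continuous_map_compose[OF continuous_map_snd continuous_map_snd, unfolded comp_def])+
  have "phomotopic (pprod ?X ?X) (?L E)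
    (\<lambda>(x, x'). phi_map s i ((\<lambda>(b, f) (b', f'). (loop_concat b b', loop_concat f f')) x x'))
    (\<lambda>(x, x'). loop_concat (phi_map s i x) (phi_map s i x'))"
  proof (rule phomotopicI[where h = "\<lambda>(\<tau>, x). restrict (\<lambda>t. H (?bb x (\<rho> \<tau> t), ?ff x (\<sigma> \<tau> t))) {0..1}"])
    show "snd (pprod ?X ?X) \<in> topspace (fst (pprod ?X ?X))"
      using LB0 LF0 by (simp add: pprod_def)
    have "continuous_map (prod_topology unit_interval ?Q) ?LE
      (\<lambda>z. restrict (\<lambda>t. H (?bb (snd z) (\<rho> (fst (snd (t, z))) (fst (t, z))),
          ?ff (snd z) (\<sigma> (fst (snd (t, z))) (fst (t, z))))) {0..1})"
    proof (rule family)
      show "continuous_map (prod_topology unit_interval ?Q) ?LB (\<lambda>z. ?bb (snd z))"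
        "continuous_map (prod_topology unit_interval ?Q) ?LF (\<lambda>z. ?ff (snd z))"
        using continuous_map_compose[OF continuous_map_snd bb] continuous_map_compose[OF continuous_map_snd ff]
        by (simp_all add: comp_def)
      let ?J = "prod_topology unit_interval (prod_topology unit_interval ?Q)"
      have 1: "continuous_map ?J euclideanreal (\<lambda>x. fst (snd x))"
        by (rule continuous_map_compose[OF continuous_map_snd continuous_map_fst_real, unfolded comp_def])
      have 2: "continuous_map ?J euclideanreal fst" by (rule continuous_map_fst_real)
      show "continuous_map ?J euclideanreal (\<lambda>x. \<rho> (fst (snd x)) (fst x))"
        "continuous_map ?J euclideanreal (\<lambda>x. \<sigma> (fst (snd x)) (fst x))"
        unfolding \<rho>_def \<sigma>_def
        by (intro continuous_map_add continuous_map_real_mult continuous_map_diff continuous_map_real_min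
            continuous_map_real_max continuous_map_canonical_const 1 2)+
      have conv: "(1 - \<tau>) * u + \<tau> * v \<in> {0..1}" if "\<tau> \<in> {0..1}" "u \<in> {0..1}" "v \<in> {0..1}" for \<tau> u v :: real
        using that convex_bound_le[of u 1 v "1 - \<tau>" \<tau>] by auto
      show "\<rho> (fst (snd x)) (fst x) \<in> {0..1} \<and> \<sigma> (fst (snd x)) (fst x) \<in> {0..1}"
        if "x \<in> topspace (prod_topology unit_interval (prod_topology unit_interval ?Q))" for x
        unfolding \<rho>_def \<sigma>_def using that by (intro conjI conv) auto
    qed (auto simp: \<rho>_def \<sigma>_def)
    then show "continuous_map (prod_topology unit_interval (fst (pprod ?X ?X))) (fst (?L E))
      (\<lambda>(\<tau>, x). restrict (\<lambda>t. H (?bb x (\<rho> \<tau> t), ?ff x (\<sigma> \<tau> t))) {0..1})"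
      by (simp add: pprod_def case_prod_unfold)
  next
    fix x assume x: "x \<in> topspace (fst (pprod ?X ?X))"
    then have x': "fst (fst x) \<in> topspace ?LB" "snd (fst x) \<in> topspace ?LF"
      "fst (snd x) \<in> topspace ?LB" "snd (snd x) \<in> topspace ?LF"
      by (auto simp: pprod_def)
    have xQ: "x \<in> topspace ?Q" using x by (simp add: pprod_def)
    have bx: "?bb x \<in> topspace ?LB" and fx: "?ff x \<in> topspace ?LF"
      using bb ff xQ unfolding continuous_map_def by blast+
    show "(case (0, x) of (\<tau>, x) \<Rightarrow> restrict (\<lambda>t. H (?bb x (\<rho> \<tau> t), ?ff x (\<sigma> \<tau> t))) {0..1}) =
      (case x of (x, x') \<Rightarrow> phi_map s i ((\<lambda>(b, f) (b', f'). (loop_concat b b', loop_concat f f')) x x'))"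
      using phi[OF bx fx] by (simp add: case_prod_unfold \<rho>_def \<sigma>_def)
    show "(case (1, x) of (\<tau>, x) \<Rightarrow> restrict (\<lambda>t. H (?bb x (\<rho> \<tau> t), ?ff x (\<sigma> \<tau> t))) {0..1}) =
      (case x of (x, x') \<Rightarrow> loop_concat (phi_map s i x) (phi_map s i x'))"
    proof
      fix t
      show "(case (1, x) of (\<tau>, x) \<Rightarrow> restrict (\<lambda>t. H (?bb x (\<rho> \<tau> t), ?ff x (\<sigma> \<tau> t))) {0..1}) t =
        (case x of (x, x') \<Rightarrow> loop_concat (phi_map s i x) (phi_map s i x')) t"
      proof (cases "t \<in> {0..1}")
        case t: True
        have p1: "phi_map s i (fst x) u = H (fst (fst x) (min (2 * u) 1), snd (fst x) (max (2 * u - 1) 0))"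
          and p2: "phi_map s i (snd x) u = H (fst (snd x) (min (2 * u) 1), snd (snd x) (max (2 * u - 1) 0))"
          if "u \<in> {0..1}" for u
          using phi[OF x'(1,2)] phi[OF x'(3,4)] that by simp_all
        consider "t \<le> 1/4" | "1/4 < t" "t \<le> 1/2" | "1/2 < t" "t \<le> 3/4" | "3/4 < t" by linarith
        then have "H (?bb x (\<rho> 1 t), ?ff x (\<sigma> 1 t)) = loop_concat (phi_map s i (fst x)) (phi_map s i (snd x)) t"
        proof cases
          case 1
          then have "\<rho> 1 t = 2 * t" "\<sigma> 1 t = 0" using t by (auto simp: \<rho>_def \<sigma>_def)
          then show ?thesis using 1 t p1[of "2 * t"] x' by (simp add: loop_concat_eq loop_ends)
        next
          case 2
          then have r: "\<rho> 1 t = 1/2" "\<sigma> 1 t = 2 * t - 1/2" using t by (auto simp: \<rho>_def \<sigma>_def)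
          have "?ff x (2 * t - 1/2) = snd (fst x) (2 * (2 * t - 1/2))"
            using 2 t by (simp add: loop_concat_def)
          also have "2 * (2 * t - 1/2) = 2 * (2 * t) - 1" by simp
          finally show ?thesis using 2 t p1[of "2 * t"] x' unfolding r
            by (simp add: loop_concat_eq loop_ends)
        next
          case 3
          then have r: "\<rho> 1 t = 2 * t - 1/2" "\<sigma> 1 t = 1/2" using t by (auto simp: \<rho>_def \<sigma>_def)
          have "?bb x (2 * t - 1/2) = fst (snd x) (2 * (2 * t - 1/2) - 1)"
            using 3 t by (simp add: loop_concat_def)
          also have "2 * (2 * t - 1/2) - 1 = 2 * (2 * t - 1)" by simp
          finally show ?thesis using 3 t p2[of "2 * t - 1"] x' unfolding r
            by (simp add: loop_concat_eq loop_ends)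
        next
          case 4
          then have r: "\<rho> 1 t = 1" "\<sigma> 1 t = 2 * t - 1" using t by (auto simp: \<rho>_def \<sigma>_def)
          then show ?thesis using 4 t p2[of "2 * t - 1"] x' unfolding r
            by (simp add: loop_concat_eq loop_ends)
        qed
        then show ?thesis using t by (simp add: case_prod_unfold)
      next
        case False
        then have "loop_concat \<gamma> \<delta> t = undefined" for \<gamma> \<delta> :: "real \<Rightarrow> 'e"
          by (auto simp: loop_concat_def)
        then show ?thesis using False by (auto simp: case_prod_unfold)
      qed
    qed
  next
    fix \<tau> :: real assume \<tau>: "\<tau> \<in> {0..1}"
    have const: "loop_concat (snd (?L Y)) (snd (?L Y)) r = snd Y" if "r \<in> {0..1}" for r :: real and Y :: "'y pointed"
      using that by (simp add: loop_concat_eq snd_loop_space)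
    have conv: "(1 - \<tau>) * u + \<tau> * v \<in> {0..1}" if "u \<in> {0..1}" "v \<in> {0..1}" for u v :: real
      using that \<tau> convex_bound_le[of u 1 v "1 - \<tau>" \<tau>] by auto
    have "\<rho> \<tau> t \<in> {0..1}" "\<sigma> \<tau> t \<in> {0..1}" if "t \<in> {0..1}" for t
      unfolding \<rho>_def \<sigma>_def using that by (intro conv; auto)+
    then show "(case (\<tau>, snd (pprod ?X ?X)) of (\<tau>, x) \<Rightarrow> restrict (\<lambda>t. H (?bb x (\<rho> \<tau> t), ?ff x (\<sigma> \<tau> t))) {0..1}) =
       snd (?L E)"
      by (auto simp: pprod_def const H0 fun_eq_iff snd_loop_space[of E])
  qed
  then show ?thesis
    using phic phi0 by (simp add: H_splitting_def H_map_def pmap_def pprod_def)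
qed

section \<open>From an H-splitting to vanishing Whitehead products\<close>

definition clamp01 :: "real \<Rightarrow> real" where
  "clamp01 t = max 0 (min 1 t)"

lemma clamp01_range: "clamp01 t \<in> {0..1}"
  by (auto simp: clamp01_def)

lemma clamp01_le: "t \<le> 0 \<Longrightarrow> clamp01 t = 0" and clamp01_ge: "1 \<le> t \<Longrightarrow> clamp01 t = 1"
  by (auto simp: clamp01_def)

lemma clamp01_id: "t \<in> {0..1} \<Longrightarrow> clamp01 t = t"
  by (auto simp: clamp01_def)

lemma continuous_map_clamp01:
  "continuous_map Z euclideanreal f \<Longrightarrow> continuous_map Z euclideanreal (\<lambda>x. clamp01 (f x))"
  unfolding clamp01_def
  by (intro continuous_map_real_min continuous_map_real_max continuous_map_canonical_const)

text \<open>
  Let \<open>h \<tau>\<close> deform the path \<open>a\<close> followed by \<open>b\<close> into \<open>b\<close> followed by \<open>a\<close>, with waiting times of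
  a quarter before, and after, the two paths; in the coordinate \<open>w = 4t - 2\<close> the paths run on \<open>[-1, 0]\<close>
  and \<open>[0, 1]\<close>.  The square is the same deformation drawn in the plane: well below the diagonal \<open>x = y\<close>,
  the time \<open>w\<close> is \<open>u\<close>, which first follows \<open>x\<close> (the path \<open>a\<close>) and then \<open>y\<close> (the path \<open>b\<close>), and well above
  it is \<open>v\<close>, with the roles interchanged.  Adjacent sides of the square that meet on the diagonal
  need the values 0 and 1 of \<open>\<tau>\<close>.  The interpolation between them does no harm, because far out on
  the diagonal \<open>w\<close> has left \<open>[-2, 2]\<close> and \<open>h\<close> is at the base point for every \<open>\<tau>\<close>.
\<close>

definition swap_square ::
    "(real \<times> (real \<Rightarrow> 'b) \<times> (real \<Rightarrow> 'f) \<Rightarrow> real \<Rightarrow> 'e) \<Rightarrow> real \<Rightarrow> real \<Rightarrow> (real \<Rightarrow> 'b) \<Rightarrow> (real \<Rightarrow> 'f) \<Rightarrow> 'e"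
  where
  "swap_square h x y a b =
     (let \<tau> = clamp01 (1/2 + y - x);
          u = min (x - 1) 0 + max y 0; v = min (y - 1) 0 + max x 0
      in h (\<tau>, a, b) (clamp01 (((1 - \<tau>) * u + \<tau> * v + 2) / 4)))"

text \<open>
  The H-map condition for \<open>(*, b)\<close> and \<open>(a, *)\<close>: at one end the loops are run through in the order
  constant, \<open>a\<close>, \<open>b\<close>, constant and at the other end in the order constant, \<open>b\<close>, \<open>a\<close>, constant.
\<close>

lemma H_splitting_swap:
  assumes H: "H_splitting F E B i s"
    and B0: "snd B \<in> topspace (fst B)" and F0: "snd F \<in> topspace (fst F)"
    and s: "s (snd B) = snd E" and i: "i (snd F) = snd E"
  obtains h where
    "continuous_map (prod_topology unit_interval (prod_topology (fst (loop_space B)) (fst (loop_space F))))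
       (fst (loop_space E)) h"
    "\<And>a b w. a \<in> topspace (fst (loop_space B)) \<Longrightarrow> b \<in> topspace (fst (loop_space F)) \<Longrightarrow>
       h (0, a, b) (clamp01 ((w + 2) / 4)) = (if w \<le> 0 then s (a (clamp01 (w + 1))) else i (b (clamp01 w)))"
    "\<And>a b w. a \<in> topspace (fst (loop_space B)) \<Longrightarrow> b \<in> topspace (fst (loop_space F)) \<Longrightarrow>
       h (1, a, b) (clamp01 ((w + 2) / 4)) = (if w \<le> 0 then i (b (clamp01 (w + 1))) else s (a (clamp01 w)))"
proof -
  let ?LB = "fst (loop_space B)" and ?LF = "fst (loop_space F)" and ?LE = "fst (loop_space E)"
  let ?cB = "snd (loop_space B)" and ?cF = "snd (loop_space F)"
  let ?P = "prod_topology ?LB ?LF"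
  obtain k where k: "continuous_map (prod_topology unit_interval (prod_topology ?P ?P)) ?LE k"
    "\<And>x x'. k (0, x, x') = phi_map s i ((\<lambda>(b, f) (b', f'). (loop_concat b b', loop_concat f f')) x x')"
    "\<And>x x'. k (1, x, x') = loop_concat (phi_map s i x) (phi_map s i x')"
    using H unfolding H_splitting_def H_map_def phomotopic_def homotopic_with_def pprod_def by auto
  define h where "h = (\<lambda>(\<tau>, a, b). k (\<tau>, (?cB, b), (a, ?cF)))"
  have LB0: "?cB \<in> topspace ?LB" and LF0: "?cF \<in> topspace ?LF"
    by (intro loop_space_base B0 F0)+
  have split4: "\<exists>t\<in>{0..1}. clamp01 ((w + 2) / 4) = t \<and>
      (w \<le> -1 \<and> t \<le> 1/4 \<or> -1 < w \<and> w \<le> 0 \<and> 1/4 < t \<and> t \<le> 1/2 \<and> w = 4 * t - 2 \<or>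
       0 < w \<and> w \<le> 1 \<and> 1/2 < t \<and> t \<le> 3/4 \<and> w = 4 * t - 2 \<or> 1 < w \<and> 3/4 < t)" for w :: real
  proof (intro bexI[OF _ clamp01_range] conjI refl)
    consider "w \<le> -2" | "-2 < w" "w \<le> -1" | "-1 < w" "w \<le> 0" | "0 < w" "w \<le> 1" | "1 < w" by linarith
    then show "w \<le> -1 \<and> clamp01 ((w + 2) / 4) \<le> 1/4 \<or>
      -1 < w \<and> w \<le> 0 \<and> 1/4 < clamp01 ((w + 2) / 4) \<and> clamp01 ((w + 2) / 4) \<le> 1/2 \<and> w = 4 * clamp01 ((w + 2) / 4) - 2 \<or>
      0 < w \<and> w \<le> 1 \<and> 1/2 < clamp01 ((w + 2) / 4) \<and> clamp01 ((w + 2) / 4) \<le> 3/4 \<and> w = 4 * clamp01 ((w + 2) / 4) - 2 \<or>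
      1 < w \<and> 3/4 < clamp01 ((w + 2) / 4)"
      by cases (auto simp: clamp01_def max_def min_def field_simps)
  qed simp
  show ?thesis
  proof (rule that[of h])
    have "continuous_map (prod_topology unit_interval ?P) (prod_topology ?P ?P)
        (\<lambda>x. ((?cB, snd (snd x)), (fst (snd x), ?cF)))"
      using LB0 LF0
      by (intro continuous_map_pairedI continuous_map_compose[OF continuous_map_snd continuous_map_fst, unfolded comp_def]
          continuous_map_compose[OF continuous_map_snd continuous_map_snd, unfolded comp_def]) auto
    then have "continuous_map (prod_topology unit_interval ?P) ?LE
        (\<lambda>x. k (fst x, (?cB, snd (snd x)), (fst (snd x), ?cF)))"
      by (intro continuous_map_homotopy_at[OF k(1) continuous_map_fst_real]) auto
    then show "continuous_map (prod_topology unit_interval ?P) ?LE h"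
      by (simp add: h_def case_prod_unfold)
    fix a b and w :: real assume a: "a \<in> topspace ?LB" and b: "b \<in> topspace ?LF"
    obtain t where t: "t \<in> {0..1}" and ct: "clamp01 ((w + 2) / 4) = t"
      and cases: "w \<le> -1 \<and> t \<le> 1/4 \<or> -1 < w \<and> w \<le> 0 \<and> 1/4 < t \<and> t \<le> 1/2 \<and> w = 4 * t - 2 \<or>
       0 < w \<and> w \<le> 1 \<and> 1/2 < t \<and> t \<le> 3/4 \<and> w = 4 * t - 2 \<or> 1 < w \<and> 3/4 < t"
      using split4[of w] by blast
    have e: "a 0 = snd B" "a 1 = snd B" "b 0 = snd F" "b 1 = snd F" using a b by (simp_all add: loop_ends)
    have h0: "h (0, a, b) t = (if t \<le> 1/2 then s (loop_concat ?cB a (2 * t)) else i (loop_concat b ?cF (2 * t - 1)))"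
      using t by (simp add: h_def k phi_map_def loop_concat_eq loop_map_def)
    have h1: "h (1, a, b) t = (if t \<le> 1/2 then (if 2 * t \<le> 1/2 then s (?cB (2 * (2 * t))) else i (b (2 * (2 * t) - 1)))
        else (if 2 * t - 1 \<le> 1/2 then s (a (2 * (2 * t - 1))) else i (?cF (2 * (2 * t - 1) - 1))))"
      using t by (simp add: h_def k phi_map_def loop_concat_eq loop_map_def)
    from cases consider "w \<le> -1" "t \<le> 1/4" | "-1 < w" "w \<le> 0" "1/4 < t" "t \<le> 1/2" "w = 4 * t - 2"
       | "0 < w" "w \<le> 1" "1/2 < t" "t \<le> 3/4" "w = 4 * t - 2" | "1 < w" "3/4 < t" by blast
    then show "h (0, a, b) (clamp01 ((w + 2) / 4)) = (if w \<le> 0 then s (a (clamp01 (w + 1))) else i (b (clamp01 w)))"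
    proof cases
      case 1
      then show ?thesis unfolding ct h0 using t
        by (simp add: loop_concat_eq snd_loop_space clamp01_le e)
    next
      case 2
      then have "clamp01 (w + 1) = 2 * (2 * t) - 1" by (simp add: clamp01_def)
      then show ?thesis unfolding ct h0 using 2 t by (simp add: loop_concat_eq)
    next
      case 3
      then have "clamp01 w = 2 * (2 * t - 1)" by (simp add: clamp01_def)
      then show ?thesis unfolding ct h0 using 3 t by (simp add: loop_concat_eq)
    next
      case 4
      then show ?thesis unfolding ct h0 using t
        by (simp add: loop_concat_eq snd_loop_space clamp01_ge e)
    qed
    from cases consider "w \<le> -1" "t \<le> 1/4" | "-1 < w" "w \<le> 0" "1/4 < t" "t \<le> 1/2" "w = 4 * t - 2"
       | "0 < w" "w \<le> 1" "1/2 < t" "t \<le> 3/4" "w = 4 * t - 2" | "1 < w" "3/4 < t" by blast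
    then show "h (1, a, b) (clamp01 ((w + 2) / 4)) = (if w \<le> 0 then i (b (clamp01 (w + 1))) else s (a (clamp01 w)))"
    proof cases
      case 1
      then show ?thesis unfolding ct h1 using t
        by (simp add: snd_loop_space clamp01_le e s i)
    next
      case 2
      then have "clamp01 (w + 1) = 2 * (2 * t) - 1" by (simp add: clamp01_def)
      then show ?thesis unfolding ct h1 using 2 t by simp
    next
      case 3
      then have "clamp01 w = 2 * (2 * t - 1)" by (simp add: clamp01_def)
      then show ?thesis unfolding ct h1 using 3 t by simp
    next
      case 4
      then show ?thesis unfolding ct h1 using t
        by (simp add: snd_loop_space clamp01_ge e s i)
    qed
  qed
qed

lemma continuous_map_swap_square:
  assumes h: "continuous_map (prod_topology unit_interval (prod_topology (fst (loop_space B)) (fst (loop_space F))))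
       (fst (loop_space E)) h"
    and "continuous_map Z euclideanreal x" "continuous_map Z euclideanreal y"
    and "continuous_map Z (fst (loop_space B)) a" "continuous_map Z (fst (loop_space F)) b"
  shows "continuous_map Z (fst E) (\<lambda>z. swap_square h (x z) (y z) (a z) (b z))"
proof -
  have \<tau>: "continuous_map Z euclideanreal (\<lambda>z. clamp01 (1/2 + y z - x z))"
    by (intro continuous_map_clamp01 continuous_map_diff continuous_map_add continuous_map_canonical_const assms)
  have "continuous_map Z (fst (loop_space E)) (\<lambda>z. h (clamp01 (1/2 + y z - x z), a z, b z))"
    by (intro continuous_map_homotopy_at[OF h \<tau>] clamp01_range continuous_map_pairedI assms)
  then show ?thesis
    unfolding swap_square_def Let_def
    by (rule continuous_map_loop_eval)
      (intro continuous_map_clamp01 continuous_map_real_divide continuous_map_add continuous_map_real_mult \<tau>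
        continuous_map_diff continuous_map_canonical_const continuous_map_real_min continuous_map_real_max
        clamp01_range assms; simp)+
qed

text \<open>
  On each side of the square one of \<open>u\<close> and \<open>v\<close> is in charge, except near the corners on the
  diagonal, where both are at most \<open>-2\<close> or both at least \<open>2\<close>.
\<close>

lemma swap_square_boundary:
  assumes h: "continuous_map (prod_topology unit_interval (prod_topology (fst (loop_space B)) (fst (loop_space F))))
       (fst (loop_space E)) h"
    and h0: "\<And>a b w. a \<in> topspace (fst (loop_space B)) \<Longrightarrow> b \<in> topspace (fst (loop_space F)) \<Longrightarrow>
       h (0, a, b) (clamp01 ((w + 2) / 4)) = (if w \<le> 0 then s (a (clamp01 (w + 1))) else i (b (clamp01 w)))"
    and h1: "\<And>a b w. a \<in> topspace (fst (loop_space B)) \<Longrightarrow> b \<in> topspace (fst (loop_space F)) \<Longrightarrow>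
       h (1, a, b) (clamp01 ((w + 2) / 4)) = (if w \<le> 0 then i (b (clamp01 (w + 1))) else s (a (clamp01 w)))"
    and s: "s (snd B) = snd E" and i: "i (snd F) = snd E"
    and a: "a \<in> topspace (fst (loop_space B))" and b: "b \<in> topspace (fst (loop_space F))"
  shows "3 \<le> \<bar>y\<bar> \<Longrightarrow> swap_square h x y a b = s (a (clamp01 x))"
    and "3 \<le> \<bar>x\<bar> \<Longrightarrow> swap_square h x y a b = i (b (clamp01 y))"
proof -
  have e: "a 0 = snd B" "a 1 = snd B" "b 0 = snd F" "b 1 = snd F" using a b by (simp_all add: loop_ends)
  define u where "u = min (x - 1) 0 + max y 0"
  define v where "v = min (y - 1) 0 + max x 0"
  define \<tau> where "\<tau> = clamp01 (1/2 + y - x)"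
  have \<tau>: "\<tau> \<in> {0..1}" by (simp only: \<tau>_def clamp01_range)
  have sq: "swap_square h x y a b = h (\<tau>, a, b) (clamp01 (((1 - \<tau>) * u + \<tau> * v + 2) / 4))"
    by (simp add: swap_square_def Let_def u_def v_def \<tau>_def)
  have hE: "h (\<tau>, a, b) \<in> topspace (fst (loop_space E))"
    using h \<tau> a b by (auto simp: continuous_map_def)
  have conv: "(1 - \<tau>) * u + \<tau> * v \<le> c" if "u \<le> c" "v \<le> c" for c
    using convex_bound_le[of u c v "1 - \<tau>" \<tau>] that \<tau> by simp
  have conv': "c \<le> (1 - \<tau>) * u + \<tau> * v" if "c \<le> u" "c \<le> v" for c
    using convex_bound_le[of "-u" "-c" "-v" "1 - \<tau>" \<tau>] that \<tau> by simp
  have low: "swap_square h x y a b = snd E" if "u \<le> -2" "v \<le> -2"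
  proof -
    have "((1 - \<tau>) * u + \<tau> * v + 2) / 4 \<le> 0" using conv[OF that] by simp
    then show ?thesis unfolding sq using hE by (simp add: clamp01_le loop_ends)
  qed
  have high: "swap_square h x y a b = snd E" if "2 \<le> u" "2 \<le> v"
  proof -
    have "1 \<le> ((1 - \<tau>) * u + \<tau> * v + 2) / 4" using conv'[OF that] by simp
    then show ?thesis unfolding sq using hE by (simp add: clamp01_ge loop_ends)
  qed
  have zero: "swap_square h x y a b = (if u \<le> 0 then s (a (clamp01 (u + 1))) else i (b (clamp01 u)))"
    if "y \<le> x - 1/2"
  proof -
    have "\<tau> = 0" using that by (simp add: \<tau>_def clamp01_le)
    then show ?thesis unfolding sq using h0[OF a b, of u] by simp
  qed
  have one: "swap_square h x y a b = (if v \<le> 0 then i (b (clamp01 (v + 1))) else s (a (clamp01 v)))"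
    if "x + 1/2 \<le> y"
  proof -
    have "\<tau> = 1" using that by (simp add: \<tau>_def clamp01_ge)
    then show ?thesis unfolding sq using h1[OF a b, of v] by simp
  qed
  have cl: "clamp01 (min r 1) = clamp01 r" "clamp01 (max r 0) = clamp01 r" for r
    by (auto simp: clamp01_def)
  show "swap_square h x y a b = s (a (clamp01 x))" if y: "3 \<le> \<bar>y\<bar>"
  proof (cases "y \<le> -3")
    case True
    show ?thesis
    proof (cases "y \<le> x - 1/2")
      case le: True
      have "u = min x 1 - 1" using True by (simp add: u_def min_def)
      then show ?thesis using zero[OF le] by (simp add: cl)
    next
      case False
      then have "swap_square h x y a b = snd E" using True by (intro low) (simp_all add: u_def v_def)
      then show ?thesis using False True by (simp add: clamp01_le e s)
    qed
  next
    case False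
    then have y3: "3 \<le> y" using y by linarith
    show ?thesis
    proof (cases "x + 1/2 \<le> y")
      case le: True
      have v: "v = max x 0" using y3 by (simp add: v_def)
      show ?thesis
      proof (cases "x \<le> 0")
        case True
        then show ?thesis using one[OF le] v by (simp add: clamp01_le clamp01_ge e s i)
      next
        case False
        then show ?thesis using one[OF le] v by simp
      qed
    next
      case False
      then have "swap_square h x y a b = snd E" using y3 by (intro high) (simp_all add: u_def v_def)
      then show ?thesis using False y3 by (simp add: clamp01_ge e s)
    qed
  qed
  show "swap_square h x y a b = i (b (clamp01 y))" if x: "3 \<le> \<bar>x\<bar>"
  proof (cases "x \<le> -3")
    case True
    show ?thesis
    proof (cases "x + 1/2 \<le> y")
      case le: True
      have "v = min y 1 - 1" using True by (simp add: v_def min_def)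
      then show ?thesis using one[OF le] by (simp add: cl)
    next
      case False
      then have "swap_square h x y a b = snd E" using True by (intro low) (simp_all add: u_def v_def)
      then show ?thesis using False True by (simp add: clamp01_le e i)
    qed
  next
    case False
    then have x3: "3 \<le> x" using x by linarith
    show ?thesis
    proof (cases "y \<le> x - 1/2")
      case le: True
      have u: "u = max y 0" using x3 by (simp add: u_def)
      show ?thesis
      proof (cases "y \<le> 0")
        case True
        then show ?thesis using zero[OF le] u by (simp add: clamp01_le clamp01_ge e s i)
      next
        case False
        then show ?thesis using zero[OF le] u by simp
      qed
    next
      case False
      then have "swap_square h x y a b = snd E" using x3 by (intro high) (simp_all add: u_def v_def)
      then show ?thesis using False x3 by (simp add: clamp01_ge e i)
    qed
  qed
qed

text \<open>
  The sphere as a family of loops: the coordinate 0 of \<open>\<real>\<^sup>k\<close> becomes the time and the family depends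
  on the remaining coordinates.
\<close>

definition sphere_loops :: "nat \<Rightarrow> ((nat \<Rightarrow> real) \<Rightarrow> 'a) \<Rightarrow> (nat \<Rightarrow> real) \<Rightarrow> real \<Rightarrow> 'a" where
  "sphere_loops k f z = restrict (\<lambda>t. f (collapse k (z(0 := 2 * t - 1)))) {0..1}"

lemma continuous_map_sphere_loops:
  assumes k: "k \<ge> 1" and f: "pmap (psphere k) X f"
  shows "continuous_map vecs (fst (loop_space X)) (sphere_loops k f)"
proof -
  have "continuous_map (prod_topology unit_interval vecs) (fst X)
      (\<lambda>x. f (collapse k ((snd x)(0 := 2 * fst x - 1))))"
    by (intro continuous_map_pmap_collapse[OF f] continuous_map_fun_upd continuous_map_snd
        continuous_map_diff continuous_map_real_mult continuous_map_canonical_const continuous_map_fst_real)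
  moreover have "f (collapse k (z(0 := c))) = snd X" if "\<bar>c\<bar> \<ge> 1" for z c
    using enorm_le_fun_upd(1)[of k c z] k that by (intro pmap_collapse_outside[OF f]) simp
  ultimately show ?thesis
    using continuous_map_into_loop_space[of vecs X "\<lambda>x. f (collapse k ((snd x)(0 := 2 * fst x - 1)))"]
    by (simp add: sphere_loops_def[abs_def])
qed

lemma sphere_loops_outside:
  assumes k: "k \<ge> 1" and f: "pmap (psphere k) X f" and z: "1 \<le> enorm k (z(0 := 0))"
  shows "sphere_loops k f z = snd (loop_space X)"
proof -
  have "f (collapse k (z(0 := c))) = snd X" for c
    using enorm_le_fun_upd(2)[of k z c] k z by (intro pmap_collapse_outside[OF f]) simp
  then show ?thesis by (simp add: sphere_loops_def snd_loop_space)
qed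

lemma sphere_loops_eval:
  assumes k: "k \<ge> 1" and f: "pmap (psphere k) X f"
  shows "sphere_loops k f z (clamp01 ((z 0 + 1) / 2)) = f (collapse k z)"
proof (cases "\<bar>z 0\<bar> \<le> 1")
  case True
  then have "clamp01 ((z 0 + 1) / 2) = (z 0 + 1) / 2" by (intro clamp01_id) auto
  moreover have "2 * ((z 0 + 1) / 2) - 1 = z 0" by (simp add: field_simps)
  then have "z(0 := 2 * ((z 0 + 1) / 2) - 1) = z" by (simp only: fun_upd_triv)
  moreover have "(z 0 + 1) / 2 \<in> {0..1}" using True by auto
  ultimately show ?thesis by (simp only: sphere_loops_def restrict_apply if_True)
next
  case False
  then have "(z 0 + 1) / 2 \<le> 0 \<or> 1 \<le> (z 0 + 1) / 2" by auto
  then have "clamp01 ((z 0 + 1) / 2) = 0 \<or> clamp01 ((z 0 + 1) / 2) = 1"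
    using clamp01_le clamp01_ge by blast
  moreover have "sphere_loops k f z \<in> topspace (fst (loop_space X))"
    using continuous_map_sphere_loops[OF k f] by (auto simp: continuous_map_def)
  ultimately have "sphere_loops k f z (clamp01 ((z 0 + 1) / 2)) = snd X" by (auto simp: loop_ends)
  moreover have "1 \<le> enorm k z" using abs_le_enorm[of 0 k z] k False by simp
  ultimately show ?thesis by (simp add: pmap_collapse_outside[OF f])
qed

text \<open>
  The position in the square as a function on \<open>\<real>\<^sup>n\<close>.  With \<open>x = (z 0 + 1) / 2\<close>, the time of the
  loop in which \<open>z\<close> lies, it goes forwards up to \<open>3\<close>, which it reaches at \<open>x = 3\<close>, that is
  \<open>z 0 = 5\<close>, and then back; on the way back the loop is replaced by the constant one.  The last term
  \<open>9 - 6|z'|\<close>, with \<open>z'\<close> the remaining coordinates, is at least \<open>3\<close> for \<open>|z'| \<le> 1\<close> and at most \<open>-3\<close>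
  for \<open>|z'| \<ge> 2\<close>: where the loop is constant anyhow, the way back retraces the way forth, and the
  excursion is shortened until it disappears.
\<close>

definition stretch :: "nat \<Rightarrow> (nat \<Rightarrow> real) \<Rightarrow> real" where
  "stretch n z = min (min ((z 0 + 1) / 2) (6 - (z 0 + 1) / 2)) (9 - 6 * enorm n (z(0 := 0)))"

lemma continuous_map_stretch:
  assumes "continuous_map Z vecs w"
  shows "continuous_map Z euclideanreal (\<lambda>x. stretch n (w x))"
  unfolding stretch_def
  by (intro continuous_map_real_min continuous_map_diff continuous_map_real_divide continuous_map_add
      continuous_map_real_mult continuous_map_canonical_const continuous_map_vecs_proj[OF assms]
      continuous_map_enorm_vecs continuous_map_fun_upd assms) simp_all

text \<open>
  Norm 20 leaves two cases: either the remaining coordinates have norm at least 2 or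
  \<open>(z 0 + 1) / 2\<close> lies outside the open interval from \<open>-9\<close> to \<open>10\<close>.
\<close>

lemma stretch_far:
  assumes n: "n \<ge> 1" and z: "20 \<le> enorm n z"
  shows "stretch n z \<le> -3"
proof (cases "2 \<le> enorm n (z(0 := 0))")
  case False
  then have "(enorm n (z(0 := 0)))\<^sup>2 \<le> 4"
    using power_mono[of "enorm n (z(0 := 0))" 2 2] enorm_nonneg by simp
  moreover have "(enorm n z)\<^sup>2 = (z 0)\<^sup>2 + (enorm n (z(0 := 0)))\<^sup>2"
    using enorm_fun_upd[of n z "z 0"] n by simp
  moreover have "(enorm n z)\<^sup>2 \<ge> 400" using power_mono[OF z, of 2] by simp
  ultimately have "(z 0)\<^sup>2 \<ge> 19\<^sup>2" by simp
  then have "\<bar>z 0\<bar> \<ge> 19" using abs_le_square_iff[of 19 "z 0"] by simp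
  then have "z 0 + 1 \<le> -18 \<or> 20 \<le> z 0 + 1" by linarith
  then have "(z 0 + 1) / 2 \<le> -3 \<or> 6 - (z 0 + 1) / 2 \<le> -3" by auto
  then show ?thesis unfolding stretch_def by linarith
qed (auto simp: stretch_def)

lemma stretch_turn:
  assumes "enorm n (z(0 := 0)) \<le> 1" "z 0 = 5"
  shows "stretch n z = 3"
  using assms by (simp add: stretch_def)

lemma stretched_loop_eval:
  assumes n: "n \<ge> 1" and f: "pmap (psphere n) X f"
  shows "(if z 0 \<le> 5 then sphere_loops n f z else snd (loop_space X)) (clamp01 (stretch n z)) = f (collapse n z)"
proof (cases "z 0 \<le> 5")
  case True
  show ?thesis
  proof (cases "1 \<le> enorm n (z(0 := 0))")
    case out: True
    then have "1 \<le> enorm n z" using enorm_le_fun_upd(2)[of n z "z 0"] n by simp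
    then show ?thesis
      using clamp01_range[of "stretch n z"] sphere_loops_outside[OF n f out] pmap_collapse_outside[OF f]
      by (simp add: snd_loop_space)
  next
    case False
    have "(z 0 + 1) / 2 \<le> 3" using True by simp
    then have st: "stretch n z = (z 0 + 1) / 2" using False unfolding stretch_def by linarith
    show ?thesis unfolding st using True sphere_loops_eval[OF n f, of z] by simp
  qed
next
  case False
  then have "1 \<le> enorm n z" using abs_le_enorm[of 0 n z] n by simp
  then show ?thesis
    using False clamp01_range[of "stretch n z"] pmap_collapse_outside[OF f] by (simp add: snd_loop_space)
qed

text \<open>
  The forth and back construction in both directions of the square gives a map on
  \<open>\<real>\<^sup>k \<times> \<real>\<^sup>l\<close> which is continuous at each turning point: there either the square is at its side
  \<open>\<plusminus>3\<close>, where it does not depend on the loop that is exchanged, or that loop is constant already.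
\<close>

lemma whitehead_null_if_H_splitting:
  assumes H: "H_splitting F E B i s" and s: "pmap B E s" and i: "pmap F E i"
    and B0: "snd B \<in> topspace (fst B)" and F0: "snd F \<in> topspace (fst F)"
    and k: "k \<ge> 1" "l \<ge> 1" and f: "pmap (psphere k) B f" and g: "pmap (psphere l) F g"
  shows "phomotopic (psphere (k + l - 1)) E (whitehead_map k l (s \<circ> f) (i \<circ> g)) (\<lambda>_. snd E)"
proof -
  have s0: "s (snd B) = snd E" and i0: "i (snd F) = snd E" using s i by (auto simp: pmap_def)
  obtain h where hc: "continuous_map (prod_topology unit_interval
       (prod_topology (fst (loop_space B)) (fst (loop_space F)))) (fst (loop_space E)) h"
    and h0: "\<And>a b w. a \<in> topspace (fst (loop_space B)) \<Longrightarrow> b \<in> topspace (fst (loop_space F)) \<Longrightarrow>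
       h (0, a, b) (clamp01 ((w + 2) / 4)) = (if w \<le> 0 then s (a (clamp01 (w + 1))) else i (b (clamp01 w)))"
    and h1: "\<And>a b w. a \<in> topspace (fst (loop_space B)) \<Longrightarrow> b \<in> topspace (fst (loop_space F)) \<Longrightarrow>
       h (1, a, b) (clamp01 ((w + 2) / 4)) = (if w \<le> 0 then i (b (clamp01 (w + 1))) else s (a (clamp01 w)))"
    using H_splitting_swap[OF H B0 F0 s0 i0] by blast
  have edge1: "swap_square h x y a b = s (a (clamp01 x))"
    if "a \<in> topspace (fst (loop_space B))" "b \<in> topspace (fst (loop_space F))" "3 \<le> \<bar>y\<bar>" for x y a b
    by (rule swap_square_boundary(1)[where s = s and i = i, OF hc _ _ s0 i0 that]) (rule h0 h1, assumption+)+
  have edge2: "swap_square h x y a b = i (b (clamp01 y))"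
    if "a \<in> topspace (fst (loop_space B))" "b \<in> topspace (fst (loop_space F))" "3 \<le> \<bar>x\<bar>" for x y a b
    by (rule swap_square_boundary(2)[where s = s and i = i, OF hc _ _ s0 i0 that]) (rule h0 h1, assumption+)+
  let ?G = "swap_square h" and ?cB = "snd (loop_space B)" and ?cF = "snd (loop_space F)"
  let ?Z = "prod_topology vecs vecs"
  let ?a = "\<lambda>u :: (nat \<Rightarrow> real) \<times> (nat \<Rightarrow> real). sphere_loops k f (fst u)"
  let ?b = "\<lambda>u :: (nat \<Rightarrow> real) \<times> (nat \<Rightarrow> real). sphere_loops l g (snd u)"
  let ?X = "\<lambda>u. stretch k (fst u)" and ?Y = "\<lambda>u. stretch l (snd u)"
  have cB: "?cB \<in> topspace (fst (loop_space B))" and cF: "?cF \<in> topspace (fst (loop_space F))"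
    by (intro loop_space_base B0 F0)+
  have ac: "continuous_map ?Z (fst (loop_space B)) ?a" and bc: "continuous_map ?Z (fst (loop_space F)) ?b"
    using continuous_map_compose[OF continuous_map_fst continuous_map_sphere_loops[OF k(1) f]]
      continuous_map_compose[OF continuous_map_snd continuous_map_sphere_loops[OF k(2) g]]
    by (simp_all add: comp_def)
  have a: "?a u \<in> topspace (fst (loop_space B))" and b: "?b u \<in> topspace (fst (loop_space F))" for u
    using continuous_map_sphere_loops[OF k(1) f] continuous_map_sphere_loops[OF k(2) g]
    by (auto simp: continuous_map_def)
  have Xc: "continuous_map ?Z euclideanreal ?X" and Yc: "continuous_map ?Z euclideanreal ?Y"
    by (intro continuous_map_stretch continuous_map_fst continuous_map_snd)+
  have f0: "continuous_map ?Z euclideanreal (\<lambda>u. fst u 0)" and s0': "continuous_map ?Z euclideanreal (\<lambda>u. snd u 0)"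
    by (intro continuous_map_vecs_proj continuous_map_fst continuous_map_snd)+
  define I where "I = (\<lambda>A u. if snd u (0::nat) \<le> (5::real) then ?G (?X u) (?Y u) (A u) (?b u) else ?G (?X u) (?Y u) (A u) ?cF)"
  have Ic: "continuous_map ?Z (fst E) (I A)" if A: "continuous_map ?Z (fst (loop_space B)) A" for A
    unfolding I_def
  proof (rule continuous_map_cases_le[OF s0'])
    show "continuous_map (subtopology ?Z {u \<in> topspace ?Z. snd u 0 \<le> 5}) (fst E) (\<lambda>u. ?G (?X u) (?Y u) (A u) (?b u))"
      by (rule continuous_map_from_subtopology[OF continuous_map_swap_square[OF hc Xc Yc A bc]])
    show "continuous_map (subtopology ?Z {u \<in> topspace ?Z. 5 \<le> snd u 0}) (fst E) (\<lambda>u. ?G (?X u) (?Y u) (A u) ?cF)"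
      using cF by (intro continuous_map_from_subtopology continuous_map_swap_square[OF hc Xc Yc A]) simp
    show "?G (?X u) (?Y u) (A u) (?b u) = ?G (?X u) (?Y u) (A u) ?cF" if u: "u \<in> topspace ?Z" "snd u 0 = 5" for u
    proof (cases "1 \<le> enorm l ((snd u)(0 := 0))")
      case True
      then show ?thesis by (simp add: sphere_loops_outside[OF k(2) g])
    next
      case False
      then have "?Y u = 3" using u(2) by (intro stretch_turn) auto
      then have Y: "3 \<le> \<bar>?Y u\<bar>" by linarith
      have Au: "A u \<in> topspace (fst (loop_space B))"
        using A u(1) unfolding continuous_map_def by blast
      show ?thesis unfolding edge1[OF Au b Y] edge1[OF Au cF Y] ..
    qed
  qed simp
  define \<Gamma> where "\<Gamma> = (\<lambda>u. if fst u 0 \<le> 5 then I ?a u else I (\<lambda>_. ?cB) u)"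
  have "continuous_map ?Z (fst E) \<Gamma>"
    unfolding \<Gamma>_def
  proof (rule continuous_map_cases_le[OF f0])
    show "continuous_map (subtopology ?Z {u \<in> topspace ?Z. fst u 0 \<le> 5}) (fst E) (I ?a)"
      by (intro continuous_map_from_subtopology Ic ac)
    show "continuous_map (subtopology ?Z {u \<in> topspace ?Z. 5 \<le> fst u 0}) (fst E) (I (\<lambda>_. ?cB))"
      using cB by (intro continuous_map_from_subtopology Ic) simp
    show "I ?a u = I (\<lambda>_. ?cB) u" if u: "u \<in> topspace ?Z" "fst u 0 = 5" for u
    proof (cases "1 \<le> enorm k ((fst u)(0 := 0))")
      case True
      then show ?thesis by (simp add: I_def sphere_loops_outside[OF k(1) f])
    next
      case False
      then have "?X u = 3" using u(2) by (intro stretch_turn) auto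
      then have X: "3 \<le> \<bar>?X u\<bar>" by linarith
      show ?thesis
        unfolding I_def edge2[OF a b X] edge2[OF cB b X] edge2[OF a cF X] edge2[OF cB cF X] ..
    qed
  qed simp
  moreover have "\<Gamma> (x, y) = (s \<circ> f) (collapse k x)" if "20 \<le> enorm l y" for x y
  proof -
    have Y: "3 \<le> \<bar>stretch l y\<bar>" using stretch_far[OF k(2) that] by simp
    have "\<Gamma> (x, y) = s ((if x 0 \<le> 5 then sphere_loops k f x else ?cB) (clamp01 (stretch k x)))"
      using edge1[OF a[of "(x, y)"] b[of "(x, y)"] Y] edge1[OF a[of "(x, y)"] cF Y]
        edge1[OF cB b[of "(x, y)"] Y] edge1[OF cB cF Y]
      by (simp add: \<Gamma>_def I_def)
    then show ?thesis by (simp only: stretched_loop_eval[OF k(1) f] comp_def)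
  qed
  moreover have "\<Gamma> (x, y) = (i \<circ> g) (collapse l y)" if "20 \<le> enorm k x" for x y
  proof -
    have X: "3 \<le> \<bar>stretch k x\<bar>" using stretch_far[OF k(1) that] by simp
    have "\<Gamma> (x, y) = i ((if y 0 \<le> 5 then sphere_loops l g y else ?cF) (clamp01 (stretch l y)))"
      using edge2[OF a[of "(x, y)"] b[of "(x, y)"] X] edge2[OF a[of "(x, y)"] cF X]
        edge2[OF cB b[of "(x, y)"] X] edge2[OF cB cF X]
      by (simp add: \<Gamma>_def I_def)
    then show ?thesis by (simp only: stretched_loop_eval[OF k(2) g] comp_def)
  qed
  ultimately show ?thesis
    by (intro whitehead_null_if_extends[OF k pmap_compose[OF f s] pmap_compose[OF g i], where R = 20]) auto
qed

section \<open>James brace products\<close>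

lemma whitehead_map_const_null:
  assumes k: "k \<ge> 1" "l \<ge> 1" and f: "pmap (psphere k) X f" and X: "snd X \<in> topspace (fst X)"
  shows "phomotopic (psphere (k + l - 1)) X (whitehead_map k l f (\<lambda>_. snd X)) (\<lambda>_. snd X)"
proof (rule whitehead_null_if_extends[OF k f, where \<Gamma> = "\<lambda>u. f (collapse k (fst u))" and R = 1])
  show "continuous_map (prod_topology vecs vecs) (fst X) (\<lambda>u. f (collapse k (fst u)))"
    by (intro continuous_map_pmap_collapse[OF f] continuous_map_fst)
qed (use f X in \<open>auto simp: pmap_def pmap_collapse_outside\<close>)

text \<open>
  Exactness provides a class of \<open>F\<close> over the Whitehead product and injectivity its uniqueness; only
  then does the definite description in the brace product denote.
\<close>

lemma james_brace_zero_iff: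
  assumes fib: "fibration_sequence F E B i p" and sec: "homotopy_section E B p s"
    and F0: "snd F \<in> topspace (fst F)" and B0: "snd B \<in> topspace (fst B)"
    and k: "k \<ge> 1" "l \<ge> 1" and a: "pmap (psphere k) B a" and b: "pmap (psphere l) F b"
  shows "james_brace k l F E i s (pi_class k B a) (pi_class l F b) = pi_zero (k + l - 1) F \<longleftrightarrow>
    phomotopic (psphere (k + l - 1)) E (whitehead_map k l (s \<circ> a) (i \<circ> b)) (\<lambda>_. snd E)"
proof -
  let ?N = "k + l - 1" and ?W = "whitehead_map k l (s \<circ> a) (i \<circ> b)"
  have N: "?N \<ge> 1" using k by linarith
  have i: "pmap F E i" and p: "pmap E B p" and pi: "\<And>x. x \<in> topspace (fst F) \<Longrightarrow> p (i x) = snd B"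
    using fib by (auto simp: fibration_sequence_def)
  have s: "pmap B E s" using sec by (simp add: homotopy_section_def)
  have sa: "pmap (psphere k) E (s \<circ> a)" and ib: "pmap (psphere l) E (i \<circ> b)"
    by (rule pmap_compose[OF a s], rule pmap_compose[OF b i])
  have W: "pmap (psphere ?N) E ?W" by (rule pmap_whitehead_map[OF k sa ib])
  have prod: "whitehead_product k l E (pi_induced k E s (pi_class k B a)) (pi_induced l E i (pi_class l F b)) =
      pi_class ?N E ?W"
    by (simp only: pi_induced_class[OF a s] pi_induced_class[OF b i] whitehead_product_class[OF k sa ib])
  have pib: "phomotopic (psphere l) B (p \<circ> (i \<circ> b)) (\<lambda>_. snd B)"
  proof (rule phomotopic_eq[OF pmap_compose[OF ib p] psphere_base])
    fix x assume "x \<in> topspace (fst (psphere l))"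
    then have "b x \<in> topspace (fst F)" using b by (auto simp: pmap_def continuous_map_def)
    then show "(p \<circ> (i \<circ> b)) x = snd B" by (simp add: pi)
  qed
  have psa: "pmap (psphere k) B (p \<circ> (s \<circ> a))" by (rule pmap_compose[OF sa p])
  have "p \<circ> ?W = whitehead_map k l (p \<circ> (s \<circ> a)) (p \<circ> (i \<circ> b))"
    by (auto simp: whitehead_map_def Let_def)
  then have "phomotopic (psphere ?N) B (p \<circ> ?W) (whitehead_map k l (p \<circ> (s \<circ> a)) (\<lambda>_. snd B))"
    using whitehead_map_homotopic[OF k _ pib, of "p \<circ> (s \<circ> a)"] psa by (simp add: phomotopic_refl)
  from phomotopic_trans[OF this whitehead_map_const_null[OF k psa B0]]
  have pW: "phomotopic (psphere ?N) B (p \<circ> ?W) (\<lambda>_. snd B)" .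
  obtain g where g: "pmap (psphere ?N) F g" and Wg: "phomotopic (psphere ?N) E ?W (i \<circ> g)"
    by (rule fibre_inclusion_exact) (rule N, rule fib, rule F0, rule W, rule pW)
  have "james_brace k l F E i s (pi_class k B a) (pi_class l F b) = pi_class ?N F g"
    unfolding james_brace_def prod
  proof (rule the_equality)
    show "pi_class ?N F g \<in> pi_set ?N F \<and> pi_induced ?N E i (pi_class ?N F g) = pi_class ?N E ?W"
      unfolding pi_set_def pi_induced_class[OF g i] pi_class_eqI[OF Wg] using g by blast
  next
    fix \<gamma> assume \<gamma>: "\<gamma> \<in> pi_set ?N F \<and> pi_induced ?N E i \<gamma> = pi_class ?N E ?W"
    then obtain g' where g': "pmap (psphere ?N) F g'" "\<gamma> = pi_class ?N F g'" by (auto simp: pi_set_def)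
    have "pi_class ?N E (i \<circ> g') = pi_class ?N E (i \<circ> g)"
      using conjunct2[OF \<gamma>] unfolding g'(2) pi_induced_class[OF g'(1) i] pi_class_eqI[OF Wg] .
    then have "phomotopic (psphere ?N) E (i \<circ> g') (i \<circ> g)"
      unfolding pi_class_eq_iff[OF pmap_compose[OF g'(1) i]] .
    then show "\<gamma> = pi_class ?N F g"
      unfolding g'(2) by (intro pi_class_eqI fibre_inclusion_injective[OF N fib sec F0 g'(1) g])
  qed
  then have "james_brace k l F E i s (pi_class k B a) (pi_class l F b) = pi_zero ?N F \<longleftrightarrow>
      phomotopic (psphere ?N) F g (\<lambda>_. snd F)"
    by (simp only: pi_zero_def pi_class_eq_iff[OF g])
  also have "\<dots> \<longleftrightarrow> phomotopic (psphere ?N) E (i \<circ> g) (i \<circ> (\<lambda>_. snd F))"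
  proof
    have "pmap (psphere ?N) F (\<lambda>_. snd F)" using F0 by (simp add: pmap_def)
    then show "phomotopic (psphere ?N) F g (\<lambda>_. snd F)" if "phomotopic (psphere ?N) E (i \<circ> g) (i \<circ> (\<lambda>_. snd F))"
      using that by (rule fibre_inclusion_injective[OF N fib sec F0 g])
  qed (rule phomotopic_compose_left[OF _ i])
  also have "i \<circ> (\<lambda>_. snd F) = (\<lambda>_ :: nat \<Rightarrow> real. snd E)" using i by (auto simp: pmap_def)
  also have "phomotopic (psphere ?N) E (i \<circ> g) (\<lambda>_. snd E) \<longleftrightarrow> phomotopic (psphere ?N) E ?W (\<lambda>_. snd E)"
    using phomotopic_trans[OF Wg, of "\<lambda>_. snd E"] phomotopic_trans[OF phomotopic_sym[OF Wg], of "\<lambda>_. snd E"]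
    by (rule iffI)
  finally show ?thesis .
qed

section \<open>Products of wedges\<close>

lemma snd_wedge [simp]: "snd (wedge P I) = None"
  by (simp add: wedge_def)

lemma wedge_base: "snd (wedge P I) \<in> topspace (fst (wedge P I))"
  by (simp add: topspace_wedge wedge_carrier_def)

lemma pmap_wedge_incl:
  assumes "j \<in> I"
  shows "pmap (P j) (wedge P I) (wedge_incl P j)"
  unfolding pmap_def
proof
  show "continuous_map (fst (P j)) (fst (wedge P I)) (wedge_incl P j)"
    using assms unfolding continuous_map openin_wedge topspace_wedge wedge_carrier_def by blast
qed (simp add: wedge_incl_def)

lemma wedge_carrier_cases:
  assumes "w \<in> wedge_carrier P I"
  obtains "w = None"
  | j x where "j \<in> I" "x \<in> topspace (fst (P j))" "x \<noteq> snd (P j)" "w = Some (j, x)"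
  using assms by (auto simp: wedge_carrier_def wedge_incl_def split: if_splits)

definition wedge_proj :: "('i \<Rightarrow> 'a pointed) \<Rightarrow> 'i \<Rightarrow> ('i \<times> 'a) option \<Rightarrow> 'a" where
  "wedge_proj P j w = (case w of None \<Rightarrow> snd (P j) | Some (i, x) \<Rightarrow> if i = j then x else snd (P j))"

lemma wedge_proj_incl: "wedge_proj P j (wedge_incl P i x) = (if i = j then x else snd (P j))"
  by (auto simp: wedge_proj_def wedge_incl_def)

lemma continuous_map_wedge_proj:
  assumes "\<And>j. j \<in> I \<Longrightarrow> snd (P j) \<in> topspace (fst (P j))" "j \<in> I"
  shows "continuous_map (fst (wedge P I)) (fst (P j)) (wedge_proj P j)"
proof (subst continuous_map, intro conjI allI impI)
  show "wedge_proj P j ` topspace (fst (wedge P I)) \<subseteq> topspace (fst (P j))"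
    using assms by (auto simp: topspace_wedge wedge_proj_def elim!: wedge_carrier_cases)
  fix U assume U: "openin (fst (P j)) U"
  show "openin (fst (wedge P I)) {w \<in> topspace (fst (wedge P I)). wedge_proj P j w \<in> U}"
    unfolding openin_wedge
  proof (intro conjI ballI)
    fix i assume i: "i \<in> I"
    then have "{x \<in> topspace (fst (P i)). wedge_incl P i x \<in> {w \<in> topspace (fst (wedge P I)). wedge_proj P j w \<in> U}} =
        {x \<in> topspace (fst (P i)). (if i = j then x else snd (P j)) \<in> U}"
      by (auto simp: topspace_wedge wedge_proj_incl) (auto simp: wedge_carrier_def)
    also have "openin (fst (P i)) \<dots>"
      using U openin_subset[OF U] by (cases "i = j") (auto simp: Collect_conj_eq Int_absorb1 inf.absorb2)
    finally show "openin (fst (P i)) {x \<in> topspace (fst (P i)). wedge_incl P i x \<in>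
        {w \<in> topspace (fst (wedge P I)). wedge_proj P j w \<in> U}}" .
  qed (auto simp: topspace_wedge)
qed

text \<open>
  The complement of a summand is open, since it meets every other summand in the complement of its
  base point.
\<close>

lemma closedin_wedge_summand:
  assumes P: "\<And>j. j \<in> I \<Longrightarrow> snd (P j) \<in> topspace (fst (P j))" "\<And>j. j \<in> I \<Longrightarrow> t1_space (fst (P j))"
  shows "closedin (fst (wedge P I)) {w \<in> wedge_carrier P I. w = None \<or> fst (the w) = j}"
proof -
  have "openin (fst (wedge P I)) {w \<in> wedge_carrier P I. w \<noteq> None \<and> fst (the w) \<noteq> j}"
    unfolding openin_wedge
  proof (intro conjI ballI)
    fix i assume i: "i \<in> I"
    have "{x \<in> topspace (fst (P i)). wedge_incl P i x \<in> {w \<in> wedge_carrier P I. w \<noteq> None \<and> fst (the w) \<noteq> j}} =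
       (if i = j then {} else topspace (fst (P i)) - {snd (P i)})"
      using i by (auto simp: wedge_incl_def wedge_carrier_def)
    also have "openin (fst (P i)) \<dots>"
      using P[OF i] by (auto intro!: openin_diff simp: t1_space_closedin_singleton)
    finally show "openin (fst (P i)) {x \<in> topspace (fst (P i)). wedge_incl P i x \<in>
        {w \<in> wedge_carrier P I. w \<noteq> None \<and> fst (the w) \<noteq> j}}" .
  qed auto
  moreover have "topspace (fst (wedge P I)) - {w \<in> wedge_carrier P I. w = None \<or> fst (the w) = j} =
     {w \<in> wedge_carrier P I. w \<noteq> None \<and> fst (the w) \<noteq> j}"
    by (auto simp: topspace_wedge)
  ultimately show ?thesis by (auto simp: closedin_def topspace_wedge)
qed

text \<open>
  The maps on the products of summands agree on their overlaps, which lie on the axes.  As these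
  products form a finite closed cover, the maps can be pasted.  If one of the families is empty,
  there is no such product, and the other axis alone is the whole space.
\<close>

lemma wedge_axes_extend:
  assumes P: "\<And>j. j \<in> I \<Longrightarrow> snd (P j) \<in> topspace (fst (P j))" "\<And>j. j \<in> I \<Longrightarrow> t1_space (fst (P j))"
    and Q: "\<And>r. r \<in> J \<Longrightarrow> snd (Q r) \<in> topspace (fst (Q r))" "\<And>r. r \<in> J \<Longrightarrow> t1_space (fst (Q r))"
    and fin: "finite I" "finite J"
    and s: "pmap (wedge P I) E s" and i: "pmap (wedge Q J) E i"
    and h: "\<And>j r. j \<in> I \<Longrightarrow> r \<in> J \<Longrightarrow> \<exists>h. continuous_map (prod_topology (fst (P j)) (fst (Q r))) (fst E) h \<and>
        (\<forall>x\<in>topspace (fst (P j)). h (x, snd (Q r)) = s (wedge_incl P j x)) \<and>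
        (\<forall>y\<in>topspace (fst (Q r)). h (snd (P j), y) = i (wedge_incl Q r y))"
  obtains H where "continuous_map (prod_topology (fst (wedge P I)) (fst (wedge Q J))) (fst E) H"
    "\<And>b. H (b, None) = s b" "\<And>f. H (None, f) = i f"
proof -
  have s0: "s None = snd E" and i0: "i None = snd E" using s i by (auto simp: pmap_def)
  obtain h where hc: "\<And>j r. j \<in> I \<Longrightarrow> r \<in> J \<Longrightarrow> continuous_map (prod_topology (fst (P j)) (fst (Q r))) (fst E) (h j r)"
    and hs: "\<And>j r x. j \<in> I \<Longrightarrow> r \<in> J \<Longrightarrow> x \<in> topspace (fst (P j)) \<Longrightarrow> h j r (x, snd (Q r)) = s (wedge_incl P j x)"
    and hi: "\<And>j r y. j \<in> I \<Longrightarrow> r \<in> J \<Longrightarrow> y \<in> topspace (fst (Q r)) \<Longrightarrow> h j r (snd (P j), y) = i (wedge_incl Q r y)"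
  proof -
    have "\<forall>j r. \<exists>h. j \<in> I \<longrightarrow> r \<in> J \<longrightarrow> continuous_map (prod_topology (fst (P j)) (fst (Q r))) (fst E) h \<and>
        (\<forall>x\<in>topspace (fst (P j)). h (x, snd (Q r)) = s (wedge_incl P j x)) \<and>
        (\<forall>y\<in>topspace (fst (Q r)). h (snd (P j), y) = i (wedge_incl Q r y))"
      using h by blast
    then obtain h where "\<forall>j r. j \<in> I \<longrightarrow> r \<in> J \<longrightarrow> continuous_map (prod_topology (fst (P j)) (fst (Q r))) (fst E) (h j r) \<and>
        (\<forall>x\<in>topspace (fst (P j)). h j r (x, snd (Q r)) = s (wedge_incl P j x)) \<and>
        (\<forall>y\<in>topspace (fst (Q r)). h j r (snd (P j), y) = i (wedge_incl Q r y))"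
      unfolding choice_iff by (elim exE)
    then show ?thesis by (intro that[of h]) blast+
  qed
  define H where "H = (\<lambda>(b, f). case b of None \<Rightarrow> i f
     | Some (j, x) \<Rightarrow> (case f of None \<Rightarrow> s b | Some (r, y) \<Rightarrow> h j r (x, y)))"
  have H1: "H (b, None) = s b" for b by (auto simp: H_def s0 i0 split: option.split)
  have H2: "H (None, f) = i f" for f by (simp add: H_def)
  let ?W = "prod_topology (fst (wedge P I)) (fst (wedge Q J))"
  have "continuous_map ?W (fst E) H"
  proof (cases "I = {} \<or> J = {}")
    case True
    then show ?thesis
    proof
      assume "I = {}"
      then have "H x = i (snd x)" if "x \<in> topspace ?W" for x
        using that by (cases x) (auto simp: topspace_wedge wedge_carrier_def H2)
      moreover have "continuous_map ?W (fst E) (i \<circ> snd)"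
        using i unfolding pmap_def by (intro continuous_map_compose[OF continuous_map_snd]) blast
      ultimately show ?thesis by (elim continuous_map_eq) simp
    next
      assume "J = {}"
      then have "H x = s (fst x)" if "x \<in> topspace ?W" for x
        using that by (cases x) (auto simp: topspace_wedge wedge_carrier_def H1)
      moreover have "continuous_map ?W (fst E) (s \<circ> fst)"
        using s unfolding pmap_def by (intro continuous_map_compose[OF continuous_map_fst]) blast
      ultimately show ?thesis by (elim continuous_map_eq) simp
    qed
  next
    case False
    then obtain j0 r0 where j0: "j0 \<in> I" and r0: "r0 \<in> J" by blast
    let ?C = "\<lambda>j. {w \<in> wedge_carrier P I. w = None \<or> fst (the w) = j}"
    let ?D = "\<lambda>r. {w \<in> wedge_carrier Q J. w = None \<or> fst (the w) = r}"
    let ?g = "\<lambda>(j, r) x. h j r (wedge_proj P j (fst x), wedge_proj Q r (snd x))"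
    have eq: "H (b, f) = h j r (wedge_proj P j b, wedge_proj Q r f)"
      if "j \<in> I" "r \<in> J" "b \<in> ?C j" "f \<in> ?D r" for j r b f
    proof -
      have b: "b \<in> wedge_carrier P I" "b = None \<or> fst (the b) = j" and f: "f \<in> wedge_carrier Q J" "f = None \<or> fst (the f) = r"
        using that by auto
      from b(1) show ?thesis
      proof (cases rule: wedge_carrier_cases)
        case 1
        from f(1) show ?thesis
          using f(2) 1 hi[OF that(1,2)] hs[OF that(1,2)] P(1) Q(1) that(1,2) i0 s0
          by (cases rule: wedge_carrier_cases) (auto simp: H_def wedge_proj_def wedge_incl_def)
      next
        case (2 j' x)
        from f(1) show ?thesis
          using f(2) b(2) 2 hs[OF that(1,2)]
          by (cases rule: wedge_carrier_cases) (auto simp: H_def wedge_proj_def wedge_incl_def)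
      qed
    qed
    show ?thesis
    proof (rule pasting_lemma_closed[where I = "I \<times> J" and T = "\<lambda>(j, r). ?C j \<times> ?D r" and f = ?g])
      show "finite (I \<times> J)" using fin by simp
      fix q assume q: "q \<in> I \<times> J"
      show "closedin ?W (case q of (j, r) \<Rightarrow> ?C j \<times> ?D r)"
        using closedin_wedge_summand[of I P, OF P] closedin_wedge_summand[of J Q, OF Q]
        by (simp add: case_prod_unfold closedin_prod_Times_iff)
      obtain j r where jr: "q = (j, r)" "j \<in> I" "r \<in> J" using q by auto
      have "continuous_map ?W (prod_topology (fst (P j)) (fst (Q r))) (\<lambda>x. (wedge_proj P j (fst x), wedge_proj Q r (snd x)))"
        using continuous_map_wedge_proj[of I P j, OF P(1) jr(2)] continuous_map_wedge_proj[of J Q r, OF Q(1) jr(3)]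
        by (intro continuous_map_pairedI)
          (auto intro: continuous_map_compose[OF continuous_map_fst, unfolded comp_def]
             continuous_map_compose[OF continuous_map_snd, unfolded comp_def])
      from continuous_map_compose[OF this hc[OF jr(2,3)]]
      show "continuous_map (subtopology ?W (case q of (j, r) \<Rightarrow> ?C j \<times> ?D r)) (fst E) (?g q)"
        unfolding jr(1) prod.case comp_def by (rule continuous_map_from_subtopology)
    next
      fix q q' x assume q: "q \<in> I \<times> J" "q' \<in> I \<times> J"
        and x: "x \<in> topspace ?W \<inter> (case q of (j, r) \<Rightarrow> ?C j \<times> ?D r) \<inter> (case q' of (j, r) \<Rightarrow> ?C j \<times> ?D r)"
      obtain j r j' r' b f where [simp]: "q = (j, r)" "q' = (j', r')" "x = (b, f)"
        by (cases q, cases q', cases x)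
      have mem: "j \<in> I" "r \<in> J" "b \<in> ?C j" "f \<in> ?D r" "j' \<in> I" "r' \<in> J" "b \<in> ?C j'" "f \<in> ?D r'"
        using q x by simp_all
      show "?g q x = ?g q' x"
        using eq[OF mem(1-4)] eq[OF mem(5-8)] by simp
    next
      fix x assume x: "x \<in> topspace ?W"
      have "\<exists>j\<in>I. fst x \<in> ?C j"
        using x j0 by (cases x) (auto simp: topspace_wedge elim!: wedge_carrier_cases)
      then obtain j where j: "j \<in> I" "fst x \<in> ?C j" by blast
      have "\<exists>r\<in>J. snd x \<in> ?D r"
        using x r0 by (cases x) (auto simp: topspace_wedge elim!: wedge_carrier_cases)
      then obtain r where r: "r \<in> J" "snd x \<in> ?D r" by blast
      show "\<exists>q. q \<in> I \<times> J \<and> x \<in> (case q of (j, r) \<Rightarrow> ?C j \<times> ?D r) \<and> H x = ?g q x"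
        using j r eq[OF j(1) r(1) j(2) r(2)] by (intro exI[of _ "(j, r)"]) (cases x, simp)
    qed
  qed
  then show ?thesis using that H1 H2 by blast
qed

theorem corollary4p13:
  fixes m n :: nat and k l :: "nat \<Rightarrow> nat"
    and F B :: "(nat \<times> (nat \<Rightarrow> real)) option pointed" and E :: "'e pointed"
    and i :: "(nat \<times> (nat \<Rightarrow> real)) option \<Rightarrow> 'e"
    and p :: "'e \<Rightarrow> (nat \<times> (nat \<Rightarrow> real)) option"
    and s :: "(nat \<times> (nat \<Rightarrow> real)) option \<Rightarrow> 'e"
    and \<alpha> \<beta> :: "nat \<Rightarrow> (nat \<Rightarrow> real) \<Rightarrow> (nat \<times> (nat \<Rightarrow> real)) option"
  assumes k: "\<And>r. r \<in> {1..m} \<Longrightarrow> k r \<ge> 2"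
    and l: "\<And>j. j \<in> {1..n} \<Longrightarrow> l j \<ge> 2"
    and F: "F = wedge (\<lambda>r. psphere (k r)) {1..m}"
    and B: "B = wedge (\<lambda>j. psphere (l j)) {1..n}"
    and E: "CW_complex (fst E)"
    and fib: "fibration_sequence F E B i p"
    and s: "homotopy_section E B p s"
    and \<alpha>: "\<And>j. \<alpha> j = wedge_incl (\<lambda>j. psphere (l j)) j"
    and \<beta>: "\<And>r. \<beta> r = wedge_incl (\<lambda>r. psphere (k r)) r"
  shows "H_splitting F E B i s \<longleftrightarrow>
    (\<forall>r\<in>{1..m}. \<forall>j\<in>{1..n}.
       james_brace (l j) (k r) F E i s (pi_class (l j) B (\<alpha> j)) (pi_class (k r) F (\<beta> r))
         = pi_zero (l j + k r - 1) F)"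
proof -
  have F0: "snd F \<in> topspace (fst F)" and B0: "snd B \<in> topspace (fst B)"
    unfolding F B by (rule wedge_base)+
  have i: "pmap F E i" using fib by (simp add: fibration_sequence_def)
  have s': "pmap B E s" using s by (simp add: homotopy_section_def)
  have s0: "s (snd B) = snd E" using s' by (simp add: pmap_def)
  have "s \<in> topspace (fst B) \<rightarrow> topspace (fst E)" using s' by (simp add: pmap_def continuous_map_def)
  from funcset_mem[OF this B0] have E0: "snd E \<in> topspace (fst E)" by (simp add: s0)
  have kl: "1 \<le> k r" "1 \<le> l j" if "r \<in> {1..m}" "j \<in> {1..n}" for r j
    using k[OF that(1)] l[OF that(2)] by auto
  have \<alpha>': "pmap (psphere (l j)) B (\<alpha> j)" if "j \<in> {1..n}" for j
    using pmap_wedge_incl[OF that, of "\<lambda>j. psphere (l j)"] unfolding \<alpha> B .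
  have \<beta>': "pmap (psphere (k r)) F (\<beta> r)" if "r \<in> {1..m}" for r
    using pmap_wedge_incl[OF that, of "\<lambda>r. psphere (k r)"] unfolding \<beta> F .
  let ?null = "\<lambda>r j. phomotopic (psphere (l j + k r - 1)) E
      (whitehead_map (l j) (k r) (s \<circ> \<alpha> j) (i \<circ> \<beta> r)) (\<lambda>_. snd E)"
  have "H_splitting F E B i s \<longleftrightarrow> (\<forall>r\<in>{1..m}. \<forall>j\<in>{1..n}. ?null r j)"
  proof
    assume H: "H_splitting F E B i s"
    show "\<forall>r\<in>{1..m}. \<forall>j\<in>{1..n}. ?null r j"
      by (intro ballI whitehead_null_if_H_splitting[OF H s' i B0 F0] kl \<alpha>' \<beta>')
  next
    assume null: "\<forall>r\<in>{1..m}. \<forall>j\<in>{1..n}. ?null r j"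
    have ext: "\<exists>h. continuous_map (prod_topology (fst (psphere (l j))) (fst (psphere (k r)))) (fst E) h \<and>
        (\<forall>x\<in>topspace (fst (psphere (l j))). h (x, snd (psphere (k r))) = s (wedge_incl (\<lambda>j. psphere (l j)) j x)) \<and>
        (\<forall>y\<in>topspace (fst (psphere (k r))). h (snd (psphere (l j)), y) = i (wedge_incl (\<lambda>r. psphere (k r)) r y))"
      if j: "j \<in> {1..n}" and r: "r \<in> {1..m}" for j r
    proof -
      have nl: "?null r j" using null j r by blast
      obtain h where h: "continuous_map (prod_topology (nsphere (l j)) (nsphere (k r))) (fst E) h"
        "\<And>x. x \<in> topspace (nsphere (l j)) \<Longrightarrow> h (x, snd (psphere (k r))) = (s \<circ> \<alpha> j) x"
        "\<And>y. y \<in> topspace (nsphere (k r)) \<Longrightarrow> h (snd (psphere (l j)), y) = (i \<circ> \<beta> r) y"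
        by (rule axes_extend_if_whitehead_null[OF kl(2)[OF r j] kl(1)[OF r j]
          pmap_compose[OF \<alpha>'[OF j] s'] pmap_compose[OF \<beta>'[OF r] i] E0 nl]) (rule that)
      show ?thesis
        using h(1) by (intro exI[of _ h] conjI ballI) (simp_all add: h(2,3) \<alpha> \<beta>)
    qed
    have base: "snd (psphere N) \<in> topspace (fst (psphere N))" for N by (rule psphere_base)
    have t1: "t1_space (fst (psphere N))" for N
      by (simp add: Hausdorff_imp_t1_space Hausdorff_nsphere)
    obtain H where H: "continuous_map (prod_topology (fst B) (fst F)) (fst E) H"
      "\<And>b. H (b, None) = s b" "\<And>f. H (None, f) = i f"
      by (rule wedge_axes_extend[OF base t1 base t1 finite_atLeastAtMost finite_atLeastAtMost
            s'[unfolded B] i[unfolded F] ext, folded B F]) (assumption, assumption, rule that)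
    show "H_splitting F E B i s"
    proof (rule H_splitting_if_axes_extend[OF H(1)])
      show "H (b, snd F) = s b" for b by (simp add: F H(2))
      show "H (snd B, f) = i f" for f by (simp add: B H(3))
    qed (rule B0 F0 s0)+
  qed
  also have "\<dots> \<longleftrightarrow> (\<forall>r\<in>{1..m}. \<forall>j\<in>{1..n}.
       james_brace (l j) (k r) F E i s (pi_class (l j) B (\<alpha> j)) (pi_class (k r) F (\<beta> r))
         = pi_zero (l j + k r - 1) F)"
    by (intro ball_cong refl james_brace_zero_iff[OF fib s F0 B0, symmetric] kl \<alpha>' \<beta>')
  finally show ?thesis .
qed

end
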